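(* Let $\mathfrak{A}$ be a finitely generated commutative $\mathbb{K}$-algebra with unit that is an integral domain. Then any subalgebra of $\mathfrak{A}$ is finitely generated if and only if $\mathrm{Kdim}\,\mathfrak{A}\le 1$.
   Context: $\mathbb{K}$ is an algebraically closed field of characteristic zero. Subalgebras are $\mathbb{K}$-subalgebras with unit, and finite generation means finite generation as a $\mathbb{K}$-algebra. $\mathrm{Kdim}$ denotes Krull dimension. *)

theory Defs
  imports "HOL-Computational_Algebra.Polynomial" "HOL-Library.Extended_Nat"
begin

locale comm_algebra = vector_space scale
  for scale :: "'k::field \<Rightarrow> 'a::comm_ring_1 \<Rightarrow> 'a" (infixr \<open>*s\<close> 75) +
  assumes scale_mult_left: "(c *s x) * y = c *s (x * y)"
begin

definition is_subalgebra :: "'a set \<Rightarrow> bool" where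
  "is_subalgebra B \<longleftrightarrow> subspace B \<and> 1 \<in> B \<and> (\<forall>x\<in>B. \<forall>y\<in>B. x * y \<in> B)"

text \<open>The hull is the smallest subalgebra containing the generators, so a set that is finitely
  generated in this sense is itself a subalgebra.\<close>

definition finitely_generated :: "'a set \<Rightarrow> bool" where
  "finitely_generated B \<longleftrightarrow> (\<exists>S. finite S \<and> is_subalgebra hull S = B)"

lemma is_subalgebra_hull: "is_subalgebra (is_subalgebra hull S)"
  by (rule hull_in) (auto simp: is_subalgebra_def subspace_def)

lemma finitely_generated_imp_is_subalgebra: "finitely_generated B \<Longrightarrow> is_subalgebra B"
  using is_subalgebra_hull by (auto simp: finitely_generated_def)

end

text \<open>Ideals of a commutative ring are the submodules of the ring regarded as a module over
  itself.\<close>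

definition ring_ideal :: "'a::comm_ring_1 set \<Rightarrow> bool" where
  "ring_ideal I \<longleftrightarrow> module.subspace (*) I"

lemma module_times: "module ((*) :: 'a::comm_ring_1 \<Rightarrow> 'a \<Rightarrow> 'a)"
  by unfold_locales (simp_all add: algebra_simps)

lemma ring_ideal_iff:
  "ring_ideal I \<longleftrightarrow> 0 \<in> I \<and> (\<forall>x\<in>I. \<forall>y\<in>I. x + y \<in> I) \<and> (\<forall>r. \<forall>x\<in>I. r * x \<in> I)"
  by (auto simp: ring_ideal_def module.subspace_def[OF module_times])

definition prime_ideal :: "'a::comm_ring_1 set \<Rightarrow> bool" where
  "prime_ideal P \<longleftrightarrow> ring_ideal P \<and> P \<noteq> UNIV \<and> (\<forall>x y. x * y \<in> P \<longrightarrow> x \<in> P \<or> y \<in> P)"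

text \<open>The length of a chain of primes counts its strict inclusions, not its members.\<close>

definition prime_chain :: "nat \<Rightarrow> (nat \<Rightarrow> 'a::comm_ring_1 set) \<Rightarrow> bool" where
  "prime_chain n P \<longleftrightarrow> (\<forall>i\<le>n. prime_ideal (P i)) \<and> (\<forall>i<n. P i \<subset> P (Suc i))"

definition krull_dim :: "'a::comm_ring_1 itself \<Rightarrow> enat" where
  "krull_dim _ = (SUP n \<in> {n. \<exists>P :: nat \<Rightarrow> 'a set. prime_chain n P}. enat n)"

end

theory Submission
  imports Defs "Jordan_Normal_Form.Char_Poly" "HOL-Algebra.Algebraic_Closure_Type"
begin

text \<open>Suppose that all subalgebras are finitely generated and that \<open>P\<close> is a nonzero prime. If
  \<open>K + P\<close> is finitely generated, then \<open>P\<close> is a finite module over \<open>K + P\<close>, so every element of the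
  algebra is integral over \<open>K + P\<close>, hence algebraic over \<open>K\<close> modulo \<open>P\<close>. As \<open>K\<close> is algebraically
  closed, \<open>P\<close> is maximal.

  Conversely, if \<open>x\<close> and \<open>y\<close> are algebraically independent, then extending homomorphisms into
  algebraically closed fields (first \<open>x \<mapsto> \<lambda>\<close>, \<open>y \<mapsto> T\<close>, then \<open>T \<mapsto> \<mu>\<close>) yields a chain of primes
  of length 2. So in dimension at most 1 all elements are algebraic over \<open>K[y]\<close> for every \<open>y \<notin> K\<close>.
  Given a subalgebra \<open>B \<noteq> K\<close>, choose \<open>x \<in> B - K\<close> such that every element becomes integral over
  \<open>K[x]\<close> after multiplication by a power of \<open>x\<close>. For \<open>y \<in> B\<close> with \<open>x\<close> integral over \<open>K[y]\<close>, let
  \<open>C\<^sub>y\<close> be the integral closure of \<open>K[y]\<close> in \<open>B\<close>. It is a finite \<open>K[y]\<close>-module: the elements with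
  poles of bounded order at infinity inject into \<open>C\<^sub>y / y\<^sup>h\<^sup>+\<^sup>1 C\<^sub>y\<close>, whose dimension is bounded by the
  rank. If \<open>y\<close> is chosen with \<open>dim C\<^sub>y / x C\<^sub>y\<close> minimal, then \<open>C\<^sub>y = B\<close>.\<close>

hide_const (open) up_ring.coeff up_ring.monom Coset.order module.smult Module.smult
  Polynomials.degree Polynomials.lead_coeff
no_notation var (\<open>X\<index>\<close>)

text \<open>The algebra \<open>B\<close> need not be integral over \<open>K[x]\<close>: some of its
  elements may need a power of \<open>x\<close> to clear a denominator. Hence \<open>y\<close> has
  to vary. The choice is controlled by the Krull-Akizuki inequality: for \<open>C y\<close> inside
  \<open>C z\<close>, both containing \<open>x\<close>, the dimension of \<open>C z / x C z\<close>
  is at most that of \<open>C y / x C y\<close>. At a minimal \<open>y\<close> equality holds for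
  every larger \<open>C z\<close>; equality forces \<open>C z\<close> to be a finite module over
  \<open>C y\<close>, hence integral over it and equal to it. Finiteness over \<open>K[y]\<close> is
  obtained by a dimension count in the manner of Riemann's inequality. Orders of poles are not
  defined by valuations but by integrality over \<open>K[1/y]\<close> in the fraction field.
  Quotients are not formed. A set is independent modulo \<open>N\<close> if it is independent and
  its span meets \<open>N\<close> only in 0, and inequalities between dimensions become inequalities
  between cardinalities of such finite sets.\<close>

definition is_subring :: "'a::comm_ring_1 set \<Rightarrow> bool" where
  "is_subring R \<longleftrightarrow> 1 \<in> R \<and> (\<forall>x\<in>R. \<forall>y\<in>R. x - y \<in> R \<and> x * y \<in> R)"

lemma is_subringI:
  assumes "1 \<in> R" "\<And>x y. x \<in> R \<Longrightarrow> y \<in> R \<Longrightarrow> x - y \<in> R" "\<And>x y. x \<in> R \<Longrightarrow> y \<in> R \<Longrightarrow> x * y \<in> R"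
  shows "is_subring R"
  using assms by (auto simp: is_subring_def)

context
  fixes R :: "'a::comm_ring_1 set"
  assumes R: "is_subring R"
begin

lemma subring_1: "1 \<in> R"
  using R by (simp add: is_subring_def)

lemma subring_diff: "x \<in> R \<Longrightarrow> y \<in> R \<Longrightarrow> x - y \<in> R"
  using R by (simp add: is_subring_def)

lemma subring_mult: "x \<in> R \<Longrightarrow> y \<in> R \<Longrightarrow> x * y \<in> R"
  using R by (simp add: is_subring_def)

lemma subring_0: "0 \<in> R"
  using subring_diff[OF subring_1 subring_1] by simp

lemma subring_uminus: "x \<in> R \<Longrightarrow> - x \<in> R"
  using subring_diff[OF subring_0] by fastforce

lemma subring_add: "x \<in> R \<Longrightarrow> y \<in> R \<Longrightarrow> x + y \<in> R"
  using subring_diff[of x "- y"] subring_uminus by fastforce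

lemma subring_power: "x \<in> R \<Longrightarrow> x ^ n \<in> R"
  by (induction n) (auto intro: subring_1 subring_mult)

lemma subring_sum: "(\<And>x. x \<in> A \<Longrightarrow> f x \<in> R) \<Longrightarrow> sum f A \<in> R"
  by (induction A rule: infinite_finite_induct) (auto intro: subring_0 subring_add)

lemma subring_prod: "(\<And>x. x \<in> A \<Longrightarrow> f x \<in> R) \<Longrightarrow> prod f A \<in> R"
  by (induction A rule: infinite_finite_induct) (auto intro: subring_1 subring_mult)

end

lemmas subring_closed =
  subring_0 subring_1 subring_diff subring_mult subring_uminus subring_add subring_power
  subring_sum subring_prod

lemma is_subring_hull: "is_subring (is_subring hull S)"
  by (rule hull_in) (auto simp: is_subring_def)

section \<open>Polynomials over a subring and adjunction of one element\<close>

definition polys_over :: "'a::comm_ring_1 set \<Rightarrow> 'a poly set" where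
  "polys_over R = {p. \<forall>i. coeff p i \<in> R}"

lemma polys_overD: "p \<in> polys_over R \<Longrightarrow> coeff p i \<in> R"
  by (simp add: polys_over_def)

lemma polys_over_mono: "R \<subseteq> R' \<Longrightarrow> polys_over R \<subseteq> polys_over R'"
  by (auto simp: polys_over_def)

lemma is_subring_polys_over:
  assumes "is_subring R"
  shows "is_subring (polys_over R)"
  by (rule is_subringI)
    (auto simp: polys_over_def coeff_mult one_pCons coeff_pCons intro!: subring_closed[OF assms] split: nat.split)

lemma polys_over_const: "is_subring R \<Longrightarrow> c \<in> R \<Longrightarrow> [:c:] \<in> polys_over R"
  by (auto simp: polys_over_def coeff_pCons subring_0 split: nat.split)

lemma polys_over_X: "is_subring R \<Longrightarrow> [:0, 1:] \<in> polys_over R"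
  by (auto simp: polys_over_def coeff_pCons subring_0 subring_1 split: nat.split)

lemma polys_over_monom: "is_subring R \<Longrightarrow> c \<in> R \<Longrightarrow> monom c n \<in> polys_over R"
  by (auto simp: polys_over_def subring_0)

lemma polys_over_smult: "is_subring R \<Longrightarrow> c \<in> R \<Longrightarrow> p \<in> polys_over R \<Longrightarrow> smult c p \<in> polys_over R"
  by (auto simp: polys_over_def subring_mult)

lemma poly_in_subring:
  assumes "is_subring R" "p \<in> polys_over R" "a \<in> R"
  shows "poly p a \<in> R"
  unfolding poly_altdef using assms
  by (intro subring_sum subring_mult subring_power) (auto simp: polys_over_def)

definition adjoin :: "'a::comm_ring_1 set \<Rightarrow> 'a \<Rightarrow> 'a set" where
  "adjoin R a = {poly p a | p. p \<in> polys_over R}"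

lemma adjoinE:
  assumes "x \<in> adjoin R a"
  obtains p where "p \<in> polys_over R" "x = poly p a"
  using assms by (auto simp: adjoin_def)

lemma is_subring_adjoin:
  assumes "is_subring R"
  shows "is_subring (adjoin R a)"
proof -
  note P = is_subring_polys_over[OF assms]
  show ?thesis
  proof (rule is_subringI)
    show "1 \<in> adjoin R a"
      using subring_1[OF P] poly_1 unfolding adjoin_def by force
  next
    fix x y assume "x \<in> adjoin R a" "y \<in> adjoin R a"
    then obtain p q where pq: "p \<in> polys_over R" "q \<in> polys_over R" "x = poly p a" "y = poly q a"
      by (auto simp: adjoin_def)
    show "x - y \<in> adjoin R a"
      unfolding adjoin_def using pq subring_diff[OF P, of p q] by (intro CollectI exI[of _ "p - q"]) auto
    show "x * y \<in> adjoin R a"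
      unfolding adjoin_def using pq subring_mult[OF P, of p q] by (intro CollectI exI[of _ "p * q"]) auto
  qed
qed

lemma subset_adjoin: "is_subring R \<Longrightarrow> R \<subseteq> adjoin R a"
  unfolding adjoin_def using polys_over_const[of R] by force

lemma generator_in_adjoin: "is_subring R \<Longrightarrow> a \<in> adjoin R a"
  unfolding adjoin_def using polys_over_X[of R] by force

lemma adjoin_minimal: "is_subring R' \<Longrightarrow> R \<subseteq> R' \<Longrightarrow> a \<in> R' \<Longrightarrow> adjoin R a \<subseteq> R'"
  using poly_in_subring[of R' _ a] polys_over_mono[of R R'] by (auto simp: adjoin_def)

lemma adjoin_eq_hull:
  assumes "is_subring R"
  shows "adjoin R a = is_subring hull (insert a R)"
  using assms
  by (intro hull_unique[symmetric])
    (auto simp: is_subring_adjoin generator_in_adjoin subset_adjoin[THEN subsetD] dest: adjoin_minimal)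

section \<open>Integral elements\<close>

definition submod :: "'a::comm_ring_1 set \<Rightarrow> 'a set \<Rightarrow> bool" where
  "submod R M \<longleftrightarrow> 0 \<in> M \<and> (\<forall>x\<in>M. \<forall>y\<in>M. x + y \<in> M) \<and> (\<forall>r\<in>R. \<forall>x\<in>M. r * x \<in> M)"

definition rspan :: "'a::comm_ring_1 set \<Rightarrow> 'a set \<Rightarrow> 'a set" where
  "rspan R S = submod R hull S"

text \<open>The multiplier ring \<open>(M : M)\<close>. Integrality is handled through it: the
  multipliers of one finite nonzero module over \<open>R\<close> are integral over \<open>R\<close>,
  and they are closed under the ring operations.\<close>

definition stab :: "'a::comm_ring_1 set \<Rightarrow> 'a set" where
  "stab M = {c. \<forall>m\<in>M. c * m \<in> M}"

lemma submod_rspan: "submod R (rspan R S)"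
  unfolding rspan_def by (rule hull_in) (auto simp: submod_def)

lemma rspan_0: "0 \<in> rspan R S"
  using submod_rspan[of R S] by (simp add: submod_def)

lemma rspan_add: "x \<in> rspan R S \<Longrightarrow> y \<in> rspan R S \<Longrightarrow> x + y \<in> rspan R S"
  using submod_rspan[of R S] by (simp add: submod_def)

lemma rspan_scale: "r \<in> R \<Longrightarrow> x \<in> rspan R S \<Longrightarrow> r * x \<in> rspan R S"
  using submod_rspan[of R S] by (simp add: submod_def)

lemma rspan_base: "x \<in> S \<Longrightarrow> x \<in> rspan R S"
  unfolding rspan_def by (rule hull_inc)

lemma rspan_minimal: "S \<subseteq> M \<Longrightarrow> submod R M \<Longrightarrow> rspan R S \<subseteq> M"
  unfolding rspan_def by (rule hull_minimal)

lemma rspan_sum: "(\<And>i. i \<in> A \<Longrightarrow> f i \<in> rspan R S) \<Longrightarrow> sum f A \<in> rspan R S"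
  by (induction A rule: infinite_finite_induct) (auto intro: rspan_0 rspan_add)

lemma rspan_uminus: "is_subring R \<Longrightarrow> x \<in> rspan R S \<Longrightarrow> - x \<in> rspan R S"
  using rspan_scale[of "-1" R x S] by (auto intro: subring_closed)

lemma rspan_finite:
  assumes "is_subring R" "finite S"
  shows "rspan R S = {\<Sum>s\<in>S. f s * s | f. \<forall>s\<in>S. f s \<in> R}" (is "_ = ?M")
proof
  have "S \<subseteq> ?M"
  proof
    fix s assume s: "s \<in> S"
    have "s = (\<Sum>t\<in>S. (if t = s then 1 else 0) * t)"
      using s assms(2) by (simp add: if_distrib[of "\<lambda>x. x * _"] cong: if_cong)
    then show "s \<in> ?M"
      using subring_0[OF assms(1)] subring_1[OF assms(1)]
      by (intro CollectI exI[of _ "\<lambda>t. if t = s then 1 else 0"]) auto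
  qed
  moreover have "submod R ?M"
    unfolding submod_def
  proof (intro conjI ballI)
    show "0 \<in> ?M"
      using subring_0[OF assms(1)] by (intro CollectI exI[of _ "\<lambda>t. 0"]) auto
  next
    fix x y assume "x \<in> ?M" "y \<in> ?M"
    then obtain f g where "x = (\<Sum>s\<in>S. f s * s)" "y = (\<Sum>s\<in>S. g s * s)" "\<forall>s\<in>S. f s \<in> R" "\<forall>s\<in>S. g s \<in> R"
      by auto
    then show "x + y \<in> ?M"
      using subring_add[OF assms(1)]
      by (intro CollectI exI[of _ "\<lambda>t. f t + g t"]) (auto simp: algebra_simps sum.distrib)
  next
    fix r x assume "r \<in> R" "x \<in> ?M"
    then obtain f where "x = (\<Sum>s\<in>S. f s * s)" "\<forall>s\<in>S. f s \<in> R"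
      by auto
    then show "r * x \<in> ?M"
      using subring_mult[OF assms(1)] \<open>r \<in> R\<close>
      by (intro CollectI exI[of _ "\<lambda>t. r * f t"]) (auto simp: algebra_simps sum_distrib_left)
  qed
  ultimately show "rspan R S \<subseteq> ?M"
    by (rule rspan_minimal)
qed (auto intro!: rspan_sum intro: rspan_scale rspan_base)

lemma is_subring_stab:
  assumes "submod R M" "is_subring R"
  shows "is_subring (stab M)"
proof -
  have neg: "- x \<in> M" if "x \<in> M" for x
    using assms that by (metis mult_minus1 subring_1 subring_uminus submod_def)
  show ?thesis
  proof (rule is_subringI)
    fix x y assume "x \<in> stab M" "y \<in> stab M"
    then show "x - y \<in> stab M"
      using assms(1) neg unfolding stab_def submod_def
      by (simp add: left_diff_distrib) (metis diff_conv_add_uminus)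
  qed (auto simp: stab_def mult.assoc)
qed

lemma subset_stab: "R \<subseteq> stab (rspan R S)"
  by (auto simp: stab_def rspan_scale)

lemma stab_rspanI:
  assumes "\<And>s. s \<in> S \<Longrightarrow> c * s \<in> rspan R S"
  shows "c \<in> stab (rspan R S)"
proof -
  have "rspan R S \<subseteq> {m. c * m \<in> rspan R S}"
    using assms
    by (intro rspan_minimal)
      (auto simp: submod_def rspan_0 distrib_left rspan_add mult.left_commute[of c] rspan_scale)
  then show ?thesis
    by (auto simp: stab_def)
qed

definition integral_elem :: "'a::comm_ring_1 set \<Rightarrow> 'a \<Rightarrow> bool" where
  "integral_elem R a \<longleftrightarrow> (\<exists>p\<in>polys_over R. lead_coeff p = 1 \<and> poly p a = 0)"

lemma monic_root_power:
  fixes p :: "'a::comm_ring_1 poly"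
  assumes "lead_coeff p = 1" "poly p b = 0"
  shows "b ^ degree p = - (\<Sum>i<degree p. coeff p i * b ^ i)"
proof -
  have "poly p b = (\<Sum>i<degree p. coeff p i * b ^ i) + b ^ degree p"
    unfolding poly_altdef using assms(1)
    by (simp add: lessThan_Suc_atMost[symmetric])
  then show ?thesis
    using assms(2) by (simp add: add_eq_0_iff)
qed

text \<open>The determinant trick: \<open>a\<close> is an eigenvalue of the matrix that expresses
  multiplication by \<open>a\<close> on the generators, hence a root of its characteristic
  polynomial, which is monic over \<open>R\<close>. The generator \<open>s0\<close> makes the
  eigenvector nonzero.\<close>

lemma integral_if_stab:
  fixes a :: "'a::idom"
  assumes R: "is_subring R" and S: "finite S" "s0 \<in> S" "s0 \<noteq> 0"
    and a: "a \<in> stab (rspan R S)"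
  shows "integral_elem R a"
proof -
  obtain xs where xs: "set xs = S" "distinct xs"
    using finite_distinct_list S(1) by blast
  define n where "n = length xs"
  have "\<forall>s\<in>S. \<exists>f. (\<forall>t\<in>S. f t \<in> R) \<and> a * s = (\<Sum>t\<in>S. f t * t)"
  proof
    fix s assume "s \<in> S"
    then have "a * s \<in> rspan R S"
      using a rspan_base[of s S R] by (auto simp: stab_def)
    then show "\<exists>f. (\<forall>t\<in>S. f t \<in> R) \<and> a * s = (\<Sum>t\<in>S. f t * t)"
      unfolding rspan_finite[OF R S(1)] by auto
  qed
  then obtain F where F: "\<And>s t. s \<in> S \<Longrightarrow> t \<in> S \<Longrightarrow> F s t \<in> R" "\<And>s. s \<in> S \<Longrightarrow> a * s = (\<Sum>t\<in>S. F s t * t)"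
    by (metis bchoice)
  have sum_xs: "(\<Sum>t\<in>S. g t) = (\<Sum>j<n. g (xs ! j))" for g :: "'a \<Rightarrow> 'a"
    using sum.reindex_bij_betw[OF bij_betw_nth[OF xs(2) refl xs(1)[symmetric]], of g]
    by (simp add: n_def)
  define M where "M = mat n n (\<lambda>(i, j). F (xs ! i) (xs ! j))"
  have M: "M \<in> carrier_mat n n"
    by (simp add: M_def)
  let ?p = "char_poly M"
  have xs_S: "xs ! i \<in> S" if "i < n" for i
    using that xs n_def by auto
  have cpm: "char_poly_matrix M $$ (i, j) = (if i = j then [:0, 1:] else 0) - [:F (xs ! i) (xs ! j):]"
    if "i < n" "j < n" for i j
    using that by (auto simp: char_poly_matrix_def M_def)
  have "?p \<in> polys_over R"
    unfolding char_poly_def det_def'[OF char_poly_matrix_closed[OF M]]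
  proof (intro subring_sum[OF is_subring_polys_over[OF R]] subring_mult[OF is_subring_polys_over[OF R]]
      subring_prod[OF is_subring_polys_over[OF R]])
    fix p assume "p \<in> {p. p permutes {0..<n}}"
    show "signof p \<in> polys_over R"
      by (cases p rule: sign_cases)
        (auto intro: subring_closed is_subring_polys_over R)
  next
    fix p i assume p: "p \<in> {p. p permutes {0..<n}}" and i: "i \<in> {0..<n}"
    then have "p i < n"
      by (metis atLeastLessThan_iff mem_Collect_eq permutes_in_image)
    with i show "char_poly_matrix M $$ (i, p i) \<in> polys_over R"
      by (auto simp: cpm intro!: subring_diff[OF is_subring_polys_over[OF R]] polys_over_X R
          polys_over_const F xs_S subring_uminus[OF R] subring_0[OF is_subring_polys_over[OF R]]
          simp del: diff_pCons)
  qed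
  moreover have "lead_coeff ?p = 1"
    using degree_monic_char_poly[OF M] by simp
  moreover have "poly ?p a = 0"
  proof -
    have eval_hom: "comm_ring_hom (\<lambda>p. poly p a)"
      by standard auto
    \<comment> \<open>Evaluating \<open>X I - M\<close> at \<open>a\<close> gives
      \<open>N = a I - M\<close>, which annihilates the vector of generators; over a domain this
      forces \<open>det N = 0\<close>.\<close>
    define N where "N = map_mat (\<lambda>p. poly p a) (char_poly_matrix M)"
    have N: "N \<in> carrier_mat n n"
      using M by (simp add: N_def)
    have N_entry: "N $$ (i, j) = poly (char_poly_matrix M $$ (i, j)) a" if "i < n" "j < n" for i j
      using that char_poly_matrix_closed[OF M] by (simp add: N_def)
    define v where "v = vec n (\<lambda>i. xs ! i)"
    have "v \<noteq> 0\<^sub>v n"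
    proof
      assume "v = 0\<^sub>v n"
      obtain i where "i < n" "xs ! i = s0"
        using S(2) xs unfolding n_def by (metis in_set_conv_nth)
      with \<open>v = 0\<^sub>v n\<close> S(3) show False
        unfolding v_def by (metis index_vec index_zero_vec(1))
    qed
    moreover have "N *\<^sub>v v = 0\<^sub>v n"
    proof (rule eq_vecI)
      fix i assume "i < dim_vec (0\<^sub>v n :: 'a vec)"
      then have i: "i < n" by simp
      have "(N *\<^sub>v v) $ i = (\<Sum>j<n. N $$ (i, j) * xs ! j)"
        using i N by (simp add: v_def scalar_prod_def lessThan_atLeast0)
      also have "\<dots> = (\<Sum>j<n. (if i = j then a * xs ! j else 0) - F (xs ! i) (xs ! j) * xs ! j)"
        using i by (intro sum.cong) (auto simp: N_entry cpm algebra_simps)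
      also have "\<dots> = a * xs ! i - (\<Sum>j<n. F (xs ! i) (xs ! j) * xs ! j)"
        using i by (simp add: sum_subtractf)
      also have "\<dots> = 0"
        using F(2)[OF xs_S[OF i]] by (simp add: sum_xs)
      finally show "(N *\<^sub>v v) $ i = 0\<^sub>v n $ i"
        using i by simp
    qed (use N in auto)
    moreover have "v \<in> carrier_vec n"
      by (simp add: v_def)
    ultimately have "det N = 0"
      using det_0_iff_vec_prod_zero[OF N] by blast
    then show ?thesis
      using comm_ring_hom.hom_det[OF eval_hom, of "char_poly_matrix M"] unfolding N_def char_poly_def by simp
  qed
  ultimately show ?thesis
    by (auto simp: integral_elem_def)
qed

text \<open>With \<open>M = rspan R S\<close> and \<open>n = degree p\<close>, the new module is
  \<open>M + b M + ... + b ^ (n - 1) M\<close>. The coefficients of \<open>p\<close> only have to be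
  multipliers of \<open>M\<close>, not elements of \<open>R\<close>; this is what makes integrality
  transitive.\<close>

lemma stab_extend:
  fixes b :: "'a::comm_ring_1"
  assumes R: "is_subring R" and S: "finite S"
    and p: "p \<in> polys_over (stab (rspan R S))" "lead_coeff p = 1" "poly p b = 0"
  obtains S' where "finite S'" "S \<subseteq> rspan R S'" "stab (rspan R S) \<subseteq> stab (rspan R S')" "b \<in> stab (rspan R S')"
proof
  let ?n = "degree p"
  define S' where "S' = (\<lambda>(i, s). b ^ i * s) ` ({..<?n} \<times> S)"
  show "finite S'"
    using S by (simp add: S'_def)
  have n: "?n > 0"
  proof (rule ccontr)
    assume "\<not> ?n > 0"
    then have "p = [:1:]"
      using p(2) by (metis degree_eq_zeroE lead_coeff_pCons(2) neq0_conv)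
    with p(3) show False by simp
  qed
  have pow: "b ^ i * m \<in> rspan R S'" if "i < ?n" "m \<in> rspan R S" for i m
  proof -
    have "S \<subseteq> {m. b ^ i * m \<in> rspan R S'}"
      using \<open>i < ?n\<close> by (auto simp: S'_def intro!: rspan_base)
    moreover have "submod R {m. b ^ i * m \<in> rspan R S'}"
      by (auto simp: submod_def rspan_0 distrib_left rspan_add mult.left_commute[of "b ^ i"] rspan_scale)
    ultimately have "rspan R S \<subseteq> {m. b ^ i * m \<in> rspan R S'}"
      by (rule rspan_minimal)
    with that(2) show ?thesis by auto
  qed
  show "S \<subseteq> rspan R S'"
    using pow[OF n] rspan_base[of _ S R] by auto
  show "stab (rspan R S) \<subseteq> stab (rspan R S')"
  proof
    fix c assume c: "c \<in> stab (rspan R S)"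
    show "c \<in> stab (rspan R S')"
    proof (rule stab_rspanI)
      fix t assume "t \<in> S'"
      then obtain i s where t: "i < ?n" "s \<in> S" "t = b ^ i * s"
        by (auto simp: S'_def)
      have "b ^ i * (c * s) \<in> rspan R S'"
        using pow[OF t(1)] c rspan_base[OF t(2)] by (auto simp: stab_def)
      then show "c * t \<in> rspan R S'"
        by (simp add: t(3) ac_simps)
    qed
  qed
  show "b \<in> stab (rspan R S')"
  proof (rule stab_rspanI)
    fix t assume "t \<in> S'"
    then obtain i s where t: "i < ?n" "s \<in> S" "t = b ^ i * s"
      by (auto simp: S'_def)
    show "b * t \<in> rspan R S'"
    proof (cases "Suc i < ?n")
      case True
      have "b ^ Suc i * s \<in> rspan R S'"
        using pow[OF True] rspan_base[OF t(2)] by blast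
      then show ?thesis
        by (simp add: t(3) ac_simps)
    next
      case False
      then have i: "?n = Suc i"
        using t(1) by simp
      \<comment> \<open>The monic relation turns the top power into terms
        \<open>b ^ j * (coeff p j * s)\<close>, and \<open>coeff p j * s\<close> stays in the old
        module because \<open>coeff p j\<close> is a multiplier.\<close>
      have "b * t = b ^ ?n * s"
        by (simp add: i t(3) ac_simps)
      also have "\<dots> = - (\<Sum>j<?n. b ^ j * (coeff p j * s))"
        unfolding monic_root_power[OF p(2,3)] by (simp add: sum_distrib_left sum_distrib_right ac_simps)
      also have "\<dots> \<in> rspan R S'"
        using p(1) rspan_base[OF t(2)]
        by (intro rspan_uminus[OF R] rspan_sum pow) (auto simp: stab_def polys_over_def)
      finally show ?thesis .
    qed
  qed
qed

lemma rspan_nonzero_generator: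
  assumes "x \<in> rspan R S" "x \<noteq> 0"
  shows "\<exists>s\<in>S. s \<noteq> 0"
proof (rule ccontr)
  assume "\<not> ?thesis"
  then have "S \<subseteq> {0}" by auto
  then have "rspan R S \<subseteq> {0}"
    by (rule rspan_minimal) (auto simp: submod_def)
  with assms show False by auto
qed

lemma integral_if_stab_1:
  fixes a :: "'a::idom"
  assumes "is_subring R" "finite S" "1 \<in> rspan R S" "a \<in> stab (rspan R S)"
  shows "integral_elem R a"
proof -
  obtain s where "s \<in> S" "s \<noteq> 0"
    using rspan_nonzero_generator[OF assms(3)] by auto
  then show ?thesis
    using integral_if_stab[OF assms(1,2) _ _ assms(4)] by simp
qed

lemma rspan_trans: "S \<subseteq> rspan R S' \<Longrightarrow> rspan R S \<subseteq> rspan R S'"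
  by (rule rspan_minimal) (auto simp: submod_rspan)

text \<open>The elements are adjoined one after another, each step keeping the earlier multipliers.
  Having 1 in the module guarantees a nonzero generator for the determinant trick.\<close>

lemma common_stab:
  assumes R: "is_subring R" and "finite T" "\<And>t. t \<in> T \<Longrightarrow> integral_elem R t"
  obtains S where "finite S" "1 \<in> rspan R S" "T \<subseteq> stab (rspan R S)"
  using assms(2,3)
proof (induction T arbitrary: thesis)
  case empty
  then show ?case
    using rspan_base[of 1 "{1}"] by blast
next
  case (insert t T)
  obtain S where S: "finite S" "1 \<in> rspan R S" "T \<subseteq> stab (rspan R S)"
    using insert by (metis insertCI)
  obtain p where p: "p \<in> polys_over R" "lead_coeff p = 1" "poly p t = 0"
    using insert.prems(2)[of t] by (auto simp: integral_elem_def)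
  have "p \<in> polys_over (stab (rspan R S))"
    using p(1) polys_over_mono[OF subset_stab] by auto
  then obtain S' where S': "finite S'" "S \<subseteq> rspan R S'" "stab (rspan R S) \<subseteq> stab (rspan R S')"
      "t \<in> stab (rspan R S')"
    by (rule stab_extend[OF R S(1) _ p(2,3)])
  show ?case
    using S S' rspan_trans[OF S'(2)] by (intro insert.prems(1)[of S']) auto
qed

text \<open>The finitely many coefficients of the equation of \<open>b\<close> have a common module
  over \<open>R\<close>, which can be enlarged to one on which \<open>b\<close> acts as
  well.\<close>

lemma integral_closure_trans:
  fixes b :: "'a::idom"
  assumes R: "is_subring R" and R': "\<And>r. r \<in> R' \<Longrightarrow> integral_elem R r" and b: "integral_elem R' b"
  shows "integral_elem R b"
proof -
  obtain p where p: "p \<in> polys_over R'" "lead_coeff p = 1" "poly p b = 0"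
    using b by (auto simp: integral_elem_def)
  obtain S where S: "finite S" "1 \<in> rspan R S" "coeff p ` {..degree p} \<subseteq> stab (rspan R S)"
    by (rule common_stab[OF R, of "coeff p ` {..degree p}"]) (use p R' in \<open>auto simp: polys_over_def\<close>)
  have "p \<in> polys_over (stab (rspan R S))"
    unfolding polys_over_def
  proof (intro CollectI allI)
    fix i show "coeff p i \<in> stab (rspan R S)"
      using S(3) by (cases "i \<le> degree p") (auto simp: coeff_eq_0 stab_def rspan_0)
  qed
  then obtain S' where S': "finite S'" "S \<subseteq> rspan R S'" "b \<in> stab (rspan R S')"
    by (rule stab_extend[OF R S(1) _ p(2,3)])
  have "1 \<in> rspan R S'"
    using rspan_trans[OF S'(2)] S(2) by auto
  then show ?thesis
    using integral_if_stab_1[OF R S'(1) _ S'(3)] by simp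
qed

lemma integral_elem_base:
  assumes "is_subring R" "r \<in> R"
  shows "integral_elem R r"
  unfolding integral_elem_def using assms
  by (intro bexI[of _ "[:- r, 1:]"])
    (auto simp: polys_over_def coeff_pCons intro: subring_closed split: nat.split)

lemma is_subring_integral_closure:
  fixes R :: "'a::idom set"
  assumes R: "is_subring R"
  shows "is_subring {a. integral_elem R a}"
proof (rule is_subringI)
  fix x y assume xy: "x \<in> {a. integral_elem R a}" "y \<in> {a. integral_elem R a}"
  obtain S where S: "finite S" "1 \<in> rspan R S" "{x, y} \<subseteq> stab (rspan R S)"
    by (rule common_stab[OF R, of "{x, y}"]) (use xy in auto)
  note st = is_subring_stab[OF submod_rspan R, of S]
  show "x - y \<in> {a. integral_elem R a}" "x * y \<in> {a. integral_elem R a}"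
    using S integral_if_stab_1[OF R S(1,2)] subring_diff[OF st] subring_mult[OF st] by auto
next
  show "1 \<in> {a. integral_elem R a}"
    using integral_elem_base[OF R subring_1[OF R]] by simp
qed

lemma integral_elem_mono: "R \<subseteq> R' \<Longrightarrow> integral_elem R a \<Longrightarrow> integral_elem R' a"
  using polys_over_mono[of R R'] by (auto simp: integral_elem_def)

lemma integral_adjoin:
  fixes a :: "'a::idom"
  assumes "is_subring R" "R0 \<subseteq> R" "integral_elem R a" "b \<in> adjoin R0 a"
  shows "integral_elem R b"
  using adjoin_minimal[OF is_subring_integral_closure[OF assms(1)], of R0 a] assms integral_elem_base
  by blast

text \<open>The integral analogue of the fact that a polynomial in \<open>Y\<close> which is also a
  polynomial in \<open>1 / Y\<close> is constant. The monomials \<open>Y ^ i * b ^ j\<close> in a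
  finite box span a module that \<open>b\<close> maps into itself.\<close>

lemma integral_adjoin_inverse:
  fixes Y b :: "'a::field"
  assumes R: "is_subring R" and Y: "Y \<noteq> 0"
    and b1: "integral_elem (adjoin R Y) b" and b2: "integral_elem (adjoin R (1 / Y)) b"
  shows "integral_elem R b"
proof -
  obtain p where p: "p \<in> polys_over (adjoin R Y)" "lead_coeff p = 1" "poly p b = 0"
    using b1 by (auto simp: integral_elem_def)
  obtain q where q: "q \<in> polys_over (adjoin R (1 / Y))" "lead_coeff q = 1" "poly q b = 0"
    using b2 by (auto simp: integral_elem_def)
  let ?n = "degree p" and ?m = "degree q"
  have "\<forall>j. \<exists>h. h \<in> polys_over R \<and> coeff p j = poly h Y"
    using polys_overD[OF p(1)] unfolding adjoin_def by auto
  then obtain f where f: "\<And>j. f j \<in> polys_over R" "\<And>j. coeff p j = poly (f j) Y"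
    by metis
  have "\<forall>j. \<exists>h. h \<in> polys_over R \<and> coeff q j = poly h (1 / Y)"
    using polys_overD[OF q(1)] unfolding adjoin_def by auto
  then obtain g where g: "\<And>j. g j \<in> polys_over R" "\<And>j. coeff q j = poly (g j) (1 / Y)"
    by metis
  define s where "s = (\<Sum>j<?n. degree (f j))"
  define t where "t = (\<Sum>j<?m. degree (g j))"
  have s: "degree (f j) \<le> s" if "j < ?n" for j
    unfolding s_def using that by (intro member_le_sum) auto
  have t: "degree (g j) \<le> t" if "j < ?m" for j
    unfolding t_def using that by (intro member_le_sum) auto
  let ?S = "(\<lambda>(i, j). Y ^ i * b ^ j) ` ({..s + t} \<times> {..<?n + ?m})"
  have base: "Y ^ i * b ^ j \<in> rspan R ?S" if "i \<le> s + t" "j < ?n + ?m" for i j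
    using that by (intro rspan_base) auto
  \<comment> \<open>Reduction with \<open>p\<close> raises the exponent of \<open>Y\<close> by at
    most \<open>s\<close>, reduction with \<open>q\<close> lowers it by at most \<open>t\<close>.
    For \<open>i \<le> t\<close> the former, for \<open>i > t\<close> the latter stays between 0 and
    \<open>s + t\<close>.\<close>
  have top: "Y ^ i * b ^ (?n + ?m) \<in> rspan R ?S" if i: "i \<le> s + t" for i
  proof (cases "i \<le> t")
    case True
    have "Y ^ i * b ^ (?n + ?m) = Y ^ i * b ^ ?m * b ^ ?n"
      by (simp add: power_add)
    also have "\<dots> = - (\<Sum>j<?n. \<Sum>k\<le>degree (f j). coeff (f j) k * (Y ^ (i + k) * b ^ (?m + j)))"
      unfolding monic_root_power[OF p(2,3)] f(2) poly_altdef
      by (simp add: sum_distrib_left sum_distrib_right power_add ac_simps)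
    also have "\<dots> \<in> rspan R ?S"
    proof (intro rspan_uminus[OF R] rspan_sum rspan_scale[OF polys_overD base])
      fix j k assume "j \<in> {..<?n}" "k \<in> {..degree (f j)}"
      then show "i + k \<le> s + t"
        using s[of j] True by auto
    qed (use f(1) in \<open>auto simp: polys_over_def\<close>)
    finally show ?thesis .
  next
    case False
    have "Y ^ i * b ^ (?n + ?m) = Y ^ i * b ^ ?n * b ^ ?m"
      by (simp add: power_add)
    also have "\<dots> = - (\<Sum>j<?m. \<Sum>k\<le>degree (g j). coeff (g j) k * (Y ^ i * (1 / Y) ^ k * b ^ (?n + j)))"
      unfolding monic_root_power[OF q(2,3)] g(2) poly_altdef
      by (simp add: sum_distrib_left sum_distrib_right power_add ac_simps)
    also have "\<dots> = - (\<Sum>j<?m. \<Sum>k\<le>degree (g j). coeff (g j) k * (Y ^ (i - k) * b ^ (?n + j)))"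
    proof (intro arg_cong[of _ _ uminus] sum.cong refl)
      fix j k assume "j \<in> {..<?m}" "k \<in> {..degree (g j)}"
      then have "k \<le> i"
        using t[of j] False by auto
      then have "Y ^ i * (1 / Y) ^ k = Y ^ (i - k)"
        using Y by (simp add: power_diff power_one_over)
      then show "coeff (g j) k * (Y ^ i * (1 / Y) ^ k * b ^ (?n + j)) = coeff (g j) k * (Y ^ (i - k) * b ^ (?n + j))"
        by simp
    qed
    also have "\<dots> \<in> rspan R ?S"
    proof (intro rspan_uminus[OF R] rspan_sum rspan_scale[OF polys_overD base])
      fix k
      show "i - k \<le> s + t"
        using i by simp
    qed (use g(1) in \<open>auto simp: polys_over_def\<close>)
    finally show ?thesis .
  qed
  have "b \<in> stab (rspan R ?S)"
  proof (rule stab_rspanI)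
    fix v assume "v \<in> ?S"
    then obtain i j where ij: "i \<le> s + t" "j < ?n + ?m" "v = Y ^ i * b ^ j"
      by auto
    have "Y ^ i * b ^ Suc j \<in> rspan R ?S"
      using base[of i "Suc j"] top[of i] ij by (cases "Suc j < ?n + ?m") (auto simp: not_less_eq less_Suc_eq simp del: power_Suc)
    then show "b * v \<in> rspan R ?S"
      by (simp add: ij(3) ac_simps)
  qed
  moreover have "?n > 0"
  proof (rule ccontr)
    assume "\<not> ?n > 0"
    then have "p = [:1:]"
      using p(2) by (metis degree_eq_zeroE lead_coeff_pCons(2) neq0_conv)
    with p(3) show False by simp
  qed
  then have "1 \<in> rspan R ?S"
    using base[of 0 0] by simp
  ultimately show ?thesis
    by (intro integral_if_stab_1[OF R]) auto
qed

lemma polys_over_hom_range: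
  assumes "\<And>x. coeff p x \<in> range f" "f 0 = 0" "\<And>c. f c = 0 \<Longrightarrow> c = 0"
  shows "\<exists>q. map_poly f q = p \<and> degree q = degree p"
proof -
  have "\<forall>i. \<exists>c. coeff p i = f c"
    using assms(1) by blast
  then obtain g where g: "\<And>i. coeff p i = f (g i)"
    by metis
  define q where "q = Abs_poly g"
  have "\<forall>\<^sub>\<infinity>i. g i = 0"
    using MOST_coeff_eq_0[of p] by (rule MOST_mono) (use g assms(3) in auto)
  then have q: "coeff q i = g i" for i
    by (simp add: q_def Abs_poly_inverse)
  have "map_poly f q = p"
    by (rule poly_eqI) (simp add: coeff_map_poly assms(2) q g)
  moreover have "degree (map_poly f q) = degree q"
    by (rule degree_map_poly) (metis assms(2,3) leading_coeff_0_iff)+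
  ultimately show ?thesis by auto
qed

section \<open>Algebras over an algebraically closed field\<close>

locale acf_algebra = comm_algebra scale
  for scale :: "'k::{alg_closed_field, field_char_0} \<Rightarrow> 'a::idom \<Rightarrow> 'a" (infixr \<open>*s\<close> 75)
begin

definition emb :: "'k \<Rightarrow> 'a" where
  "emb c = c *s 1"

definition ev :: "'a \<Rightarrow> 'k poly \<Rightarrow> 'a" where
  "ev y p = poly (map_poly emb p) y"

abbreviation K0 :: "'a set" where
  "K0 \<equiv> range emb"

lemma scale_eq: "c *s x = emb c * x"
  by (simp add: emb_def scale_mult_left)

sublocale emb: inj_comm_ring_hom emb
proof
  show "emb (x * y) = emb x * emb y" for x y
    by (simp add: emb_def scale_mult_left)
  show "emb x = 0 \<Longrightarrow> x = 0" for x
    by (simp add: emb_def)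
qed (auto simp: emb_def scale_left_distrib)

sublocale map_emb: map_poly_inj_comm_ring_hom emb ..

lemma emb_inverse: "c \<noteq> 0 \<Longrightarrow> emb c * emb (inverse c) = 1"
  by (simp flip: emb.hom_mult)

lemma ev_hom [simp]:
  "ev y 0 = 0" "ev y 1 = 1" "ev y (p + q) = ev y p + ev y q" "ev y (p - q) = ev y p - ev y q"
  "ev y (p * q) = ev y p * ev y q" "ev y [:c:] = emb c" "ev y [:0, 1:] = y" "ev y (- p) = - ev y p"
  "ev y (p ^ n) = ev y p ^ n" "ev y (pCons c p) = emb c + y * ev y p"
  "ev y (smult c p) = emb c * ev y p" "ev y (monom c n) = emb c * y ^ n"
  by (simp_all add: ev_def hom_distribs poly_monom)

lemma is_subring_K0: "is_subring K0"
  unfolding is_subring_def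
  by (auto simp flip: emb.hom_minus emb.hom_mult)

lemma polys_over_K0: "polys_over K0 = range (map_poly emb)"
proof
  show "polys_over K0 \<subseteq> range (map_poly emb)"
  proof
    fix p assume "p \<in> polys_over K0"
    then obtain q where "map_poly emb q = p"
      using polys_over_hom_range[of p emb] by (auto simp: polys_over_def)
    then show "p \<in> range (map_poly emb)"
      by blast
  qed
qed (auto simp: polys_over_def coeff_map_poly)

lemma adjoin_K0: "adjoin K0 y = range (ev y)"
  unfolding adjoin_def polys_over_K0 ev_def by auto

lemma is_subalgebra_iff: "is_subalgebra B \<longleftrightarrow> is_subring B \<and> K0 \<subseteq> B"
proof
  assume B: "is_subalgebra B"
  then have "emb c \<in> B" for c
    unfolding is_subalgebra_def emb_def by (metis subspace_scale)
  then show "is_subring B \<and> K0 \<subseteq> B"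
    using B unfolding is_subalgebra_def is_subring_def by (auto intro: subspace_diff)
next
  assume B: "is_subring B \<and> K0 \<subseteq> B"
  then have "emb c \<in> B" for c by auto
  then show "is_subalgebra B"
    using B unfolding is_subalgebra_def subspace_def
    by (auto simp: scale_eq subring_closed)
qed

lemma is_subalgebra_hull_eq: "is_subalgebra hull S = is_subring hull (K0 \<union> S)"
proof (rule hull_unique)
  show "S \<subseteq> is_subring hull (K0 \<union> S)"
    by (meson hull_subset le_sup_iff)
  show "is_subalgebra (is_subring hull (K0 \<union> S))"
    unfolding is_subalgebra_iff using is_subring_hull hull_subset by (metis le_sup_iff)
  show "is_subring hull (K0 \<union> S) \<subseteq> t" if "S \<subseteq> t" "is_subalgebra t" for t
    using that unfolding is_subalgebra_iff by (intro hull_minimal) auto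
qed

text \<open>The polynomial \<open>q\<close> splits into linear factors, its leading coefficient is a
  unit, and a prime ideal containing a product of elements \<open>y - emb c\<close> contains one of
  them.\<close>

lemma root_mod_prime:
  assumes P: "prime_ideal P" and q: "q \<noteq> 0" "ev y q \<in> P"
  shows "\<exists>c. y - emb c \<in> P"
proof -
  have P_mult: "r * x \<in> P" if "x \<in> P" for r x
    using P that by (auto simp: prime_ideal_def ring_ideal_iff)
  have P_1: "1 \<notin> P"
    using P P_mult[of 1] by (auto simp: prime_ideal_def)
  have P_prime: "x \<in> P \<or> z \<in> P" if "x * z \<in> P" for x z
    using P that by (auto simp: prime_ideal_def)
  obtain A where A: "q = smult (lead_coeff q) (\<Prod>x\<in>#A. [:- x, 1:])"
    using alg_closed_imp_factorization[OF q(1)] by blast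
  have "emb (lead_coeff q) * ev y (\<Prod>x\<in>#A. [:- x, 1:]) \<in> P"
    using q(2) by (subst (asm) A) (simp del: emb.hom_mult)
  from P_mult[OF this, of "emb (inverse (lead_coeff q))"]
  have "(emb (lead_coeff q) * emb (inverse (lead_coeff q))) * ev y (\<Prod>x\<in>#A. [:- x, 1:]) \<in> P"
    by (simp only: ac_simps)
  then have "ev y (\<Prod>x\<in>#A. [:- x, 1:]) \<in> P"
    using emb_inverse[of "lead_coeff q"] q(1) by simp
  then show ?thesis
  proof (induction A)
    case (add x A)
    then have "(y - emb x) * ev y (\<Prod>x\<in>#A. [:- x, 1:]) \<in> P"
      by (simp add: algebra_simps)
    then show ?case
      using P_prime add.IH by blast
  qed (use P_1 in auto)
qed

lemma prime_ideal_0: "prime_ideal {0::'a}"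
  unfolding prime_ideal_def ring_ideal_iff by (auto simp: set_eq_iff intro!: exI[of _ 1])

lemma root_in_K0: "q \<noteq> 0 \<Longrightarrow> ev y q = 0 \<Longrightarrow> y \<in> K0"
  using root_mod_prime[OF prime_ideal_0, of q y] by auto

text \<open>Elements outside \<open>K0\<close> are thus transcendental; \<open>y \<notin> K0\<close>
  is the form in which transcendence is assumed from here on.\<close>

lemma ev_eq_0_iff: "y \<notin> K0 \<Longrightarrow> ev y p = 0 \<longleftrightarrow> p = 0"
  using root_in_K0 by auto

lemma integral_K0_iff: "integral_elem K0 y \<longleftrightarrow> y \<in> K0"
proof
  assume "integral_elem K0 y"
  then obtain p where p: "lead_coeff (map_poly emb p) = 1" "ev y p = 0"
    unfolding integral_elem_def polys_over_K0 ev_def by blast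
  then have "p \<noteq> 0" by auto
  with p show "y \<in> K0"
    using root_in_K0[of p y] by auto
qed (rule integral_elem_base[OF is_subring_K0])

section \<open>Finite generation of all subalgebras bounds the dimension\<close>

text \<open>The conclusion says that the quotient by \<open>P\<close> consists of constants. The
  point to settle is that \<open>P\<close> is a finite module over \<open>B = K + P\<close>: after
  subtraction of constants the algebra generators of \<open>B\<close> lie in \<open>P\<close>, and
  they generate \<open>P\<close> over \<open>B\<close>.\<close>

lemma maximal_if_constants_plus_prime_fg:
  assumes P: "prime_ideal P" "P \<noteq> {0}"
    and fg: "finitely_generated {emb c + p | c p. p \<in> P}"
  shows "\<exists>c. a - emb c \<in> P"
proof -
  define B where "B = {emb c + p | c p. p \<in> P}"
  have PI: "0 \<in> P" "\<And>x y. x \<in> P \<Longrightarrow> y \<in> P \<Longrightarrow> x + y \<in> P" "\<And>r x. x \<in> P \<Longrightarrow> r * x \<in> P"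
    using P by (auto simp: prime_ideal_def ring_ideal_iff)
  have P_1: "1 \<notin> P"
    using P(1) PI(3)[of 1] by (auto simp: prime_ideal_def)
  have P_diff: "x - y \<in> P" if "x \<in> P" "y \<in> P" for x y
    using PI(2)[OF that(1) PI(3)[OF that(2), of "- 1"]] by simp
  have emb_P: "c = 0" if "emb c \<in> P" for c
    using PI(3)[OF that, of "emb (inverse c)"] emb_inverse[of c] P_1
    by (cases "c = 0") (auto simp: mult.commute)
  obtain S where S: "finite S" "is_subring hull (K0 \<union> S) = B"
    using fg by (auto simp: finitely_generated_def is_subalgebra_hull_eq B_def)
  have B: "is_subring B"
    using is_subring_hull[of "K0 \<union> S"] S(2) by simp
  have B_iff: "x \<in> B \<longleftrightarrow> (\<exists>c. x - emb c \<in> P)" for x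
  proof
    assume "x \<in> B"
    then obtain c p where "x = emb c + p" "p \<in> P"
      by (auto simp: B_def)
    then show "\<exists>c. x - emb c \<in> P"
      by (intro exI[of _ c]) simp
  next
    assume "\<exists>c. x - emb c \<in> P"
    then obtain c where "x - emb c \<in> P" ..
    moreover have "x = emb c + (x - emb c)" by simp
    ultimately show "x \<in> B"
      unfolding B_def by blast
  qed
  have PB: "P \<subseteq> B"
    by (auto simp: B_iff intro!: exI[of _ 0])
  have KB: "emb c \<in> B" for c
    using PI(1) by (auto simp: B_iff intro!: exI[of _ c])
  have "S \<subseteq> B"
    using hull_subset[of "K0 \<union> S" is_subring] S(2) by auto
  then have "\<forall>s\<in>S. \<exists>c. s - emb c \<in> P"
    by (auto simp: B_iff)
  then obtain cf where cf: "\<And>s. s \<in> S \<Longrightarrow> s - emb (cf s) \<in> P"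
    by metis
  define G where "G = (\<lambda>s. s - emb (cf s)) ` S"
  have "finite G"
    using S(1) by (simp add: G_def)
  have "submod B P"
    using PI by (auto simp: submod_def)
  then have span_P: "rspan B G \<subseteq> P"
    using cf by (intro rspan_minimal) (auto simp: G_def)
  \<comment> \<open>Constants plus the \<open>B\<close>-module generated by \<open>G\<close> form a
    subring that contains the generators of \<open>B\<close>, hence all of \<open>B\<close>. As
    \<open>P\<close> contains no nonzero constant, \<open>P = rspan B G\<close> follows.\<close>
  define B' where "B' = {emb c + m | c m. m \<in> rspan B G}"
  have B'I: "emb c + m \<in> B'" if "m \<in> rspan B G" for c m
    using that by (auto simp: B'_def)
  have "is_subring hull (K0 \<union> S) \<subseteq> B'"
  proof (rule hull_minimal)
    show "K0 \<union> S \<subseteq> B'"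
    proof
      fix x assume "x \<in> K0 \<union> S"
      then show "x \<in> B'"
      proof
        assume "x \<in> S"
        then have "x - emb (cf x) \<in> rspan B G"
          by (auto simp: G_def intro: rspan_base)
        from B'I[OF this, of "cf x"] show ?thesis by simp
      next
        assume "x \<in> K0"
        then show ?thesis
          using B'I[OF rspan_0] by auto
      qed
    qed
    show "is_subring B'"
    proof (rule is_subringI)
      show "1 \<in> B'"
        using B'I[OF rspan_0, of 1] by simp
    next
      fix x y assume "x \<in> B'" "y \<in> B'"
      then obtain c m d n where xy: "x = emb c + m" "m \<in> rspan B G" "y = emb d + n" "n \<in> rspan B G"
        by (auto simp: B'_def)
      have "m + (- n) \<in> rspan B G"
        using xy rspan_uminus[OF B] by (intro rspan_add) auto
      from B'I[OF this, of "c - d"] show "x - y \<in> B'"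
        by (simp add: xy hom_distribs algebra_simps)
      have "m \<in> B"
        using xy span_P PB by auto
      then have "emb c * n + emb d * m + m * n \<in> rspan B G"
        using xy KB by (intro rspan_add rspan_scale) auto
      from B'I[OF this, of "c * d"] show "x * y \<in> B'"
        by (simp add: xy hom_distribs algebra_simps)
    qed
  qed
  then have BB': "B \<subseteq> B'"
    using S(2) by simp
  have span_eq: "rspan B G = P"
  proof
    show "P \<subseteq> rspan B G"
    proof
      fix p assume p: "p \<in> P"
      then obtain c m where cm: "p = emb c + m" "m \<in> rspan B G"
        using PB BB' by (auto simp: B'_def)
      then have "emb c \<in> P"
        using P_diff[OF p, of m] span_P by auto
      then show "p \<in> rspan B G"
        using emb_P[of c] cm by simp
    qed
  qed (rule span_P)
  obtain p0 where "p0 \<in> P" "p0 \<noteq> 0"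
    using P(2) PI(1) by blast
  then obtain s0 where s0: "s0 \<in> G" "s0 \<noteq> 0"
    using rspan_nonzero_generator[of p0 B G] span_eq by auto
  have "a \<in> stab (rspan B G)"
    unfolding span_eq stab_def using PI(3) by auto
  then have "integral_elem B a"
    by (rule integral_if_stab[OF B \<open>finite G\<close> s0])
  then obtain p where p: "p \<in> polys_over B" "lead_coeff p = 1" "poly p a = 0"
    by (auto simp: integral_elem_def)
  have "\<exists>c. coeff p i - emb c \<in> P" for i
    using polys_overD[OF p(1), of i] by (simp add: B_iff)
  then obtain g where g: "\<And>i. coeff p i - emb (g i) \<in> P"
    by metis
  \<comment> \<open>Each lower coefficient of \<open>p\<close> is replaced by its constant part.
    This changes the value at \<open>a\<close> only by an element of \<open>P\<close>, and
    \<open>q\<close> is nonzero because it stays monic.\<close>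
  define q where "q = monom 1 (degree p) + (\<Sum>i<degree p. monom (g i) i)"
  have "coeff q (degree p) = 1"
    by (simp add: q_def coeff_sum)
  then have "q \<noteq> 0" by auto
  have sumP: "sum f A \<in> P" if "\<And>i. i \<in> A \<Longrightarrow> f i \<in> P" for f and A :: "nat set"
    using that by (induction A rule: infinite_finite_induct) (auto intro: PI)
  have ev_sum: "ev a (sum f A) = (\<Sum>i\<in>A. ev a (f i))" for f and A :: "nat set"
    by (induction A rule: infinite_finite_induct) auto
  have "ev a q = ev a q + (poly p a - poly p a)"
    by simp
  also have "\<dots> = a ^ degree p + (\<Sum>i<degree p. emb (g i) * a ^ i) - ((\<Sum>i<degree p. coeff p i * a ^ i) + a ^ degree p) + poly p a"
    using p(2) by (simp add: q_def ev_sum poly_altdef lessThan_Suc_atMost[symmetric])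
  also have "\<dots> = - (\<Sum>i<degree p. (coeff p i - emb (g i)) * a ^ i)"
    by (simp add: p(3) left_diff_distrib sum_subtractf)
  also have "\<dots> = (\<Sum>i<degree p. (- (a ^ i)) * (coeff p i - emb (g i)))"
    by (simp add: sum_negf mult.commute)
  also have "\<dots> \<in> P"
    by (intro sumP PI(3) g)
  finally show ?thesis
    using root_mod_prime[OF P(1) \<open>q \<noteq> 0\<close>] by simp
qed

text \<open>In a chain of length at least 2 the prime \<open>P 1\<close> is nonzero, so every
  \<open>a\<close> in \<open>P 2\<close> is a constant modulo \<open>P 1\<close>. That constant lies
  in the proper ideal \<open>P 2\<close>, so it is zero and \<open>a\<close> is in
  \<open>P 1\<close>.\<close>

lemma krull_dim_le_1_if_subalgebras_fg:
  assumes "\<And>B. is_subalgebra B \<Longrightarrow> finitely_generated B"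
  shows "krull_dim TYPE('a) \<le> 1"
  unfolding krull_dim_def
proof (intro SUP_least)
  fix n assume "n \<in> {n. \<exists>P :: nat \<Rightarrow> 'a set. prime_chain n P}"
  then obtain P :: "nat \<Rightarrow> 'a set" where P: "prime_chain n P" by auto
  have "n \<le> 1"
  proof (rule ccontr)
    assume "\<not> n \<le> 1"
    then have n: "0 < n" "1 < n" "0 \<le> n" "1 \<le> n" "2 \<le> n" by auto
    have pr: "prime_ideal (P 0)" "prime_ideal (P 1)" "prime_ideal (P 2)"
      using P n by (auto simp: prime_chain_def)
    have sub: "P 0 \<subset> P 1" "P 1 \<subset> P 2"
      using P n unfolding prime_chain_def by (force simp: numeral_2_eq_2)+
    have PI: "0 \<in> P i" "\<And>x y. x \<in> P i \<Longrightarrow> y \<in> P i \<Longrightarrow> x + y \<in> P i" "\<And>r x. x \<in> P i \<Longrightarrow> r * x \<in> P i"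
      if "i \<in> {0, 1, 2}" for i
      using pr that by (auto simp: prime_ideal_def ring_ideal_iff)
    have "P 1 \<noteq> {0}"
      using sub(1) PI(1)[of 0] by auto
    define B where "B = {emb c + p | c p. p \<in> P 1}"
    have BI: "emb c + p \<in> B" if "p \<in> P 1" for c p
      using that by (auto simp: B_def)
    have "is_subalgebra B"
      unfolding is_subalgebra_iff
    proof
      show "K0 \<subseteq> B"
        using BI[OF PI(1)] by auto
      show "is_subring B"
      proof (rule is_subringI)
        show "1 \<in> B"
          using BI[OF PI(1), of 1] by simp
      next
        fix x y assume "x \<in> B" "y \<in> B"
        then obtain c m d n where xy: "x = emb c + m" "m \<in> P 1" "y = emb d + n" "n \<in> P 1"
          by (auto simp: B_def)
        have "m + (- 1) * n \<in> P 1"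
          using xy by (intro PI) auto
        from BI[OF this, of "c - d"] show "x - y \<in> B"
          by (simp add: xy hom_distribs algebra_simps)
        have "emb c * n + emb d * m + m * n \<in> P 1"
          using xy by (intro PI) auto
        from BI[OF this, of "c * d"] show "x * y \<in> B"
          by (simp add: xy hom_distribs algebra_simps)
      qed
    qed
    then have fg: "finitely_generated {emb c + p | c p. p \<in> P 1}"
      unfolding B_def by (rule assms)
    obtain a where a: "a \<in> P 2" "a \<notin> P 1"
      using sub(2) by auto
    obtain c where c: "a - emb c \<in> P 1"
      using maximal_if_constants_plus_prime_fg[OF pr(2) \<open>P 1 \<noteq> {0}\<close> fg] by blast
    have "a + (- 1) * (a - emb c) \<in> P 2"
      using a(1) c sub(2) by (intro PI) auto
    then have ec: "emb c \<in> P 2" by simp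
    have "c = 0"
    proof (rule ccontr)
      assume "c \<noteq> 0"
      then have "1 \<in> P 2"
        using PI(3)[of 2 "emb c" "emb (inverse c)"] ec emb_inverse[of c] by (simp add: mult.commute)
      then have "P 2 = UNIV"
        using PI(3)[of 2 1] by auto
      then show False
        using pr(3) by (simp add: prime_ideal_def)
    qed
    then show False
      using c a(2) by simp
  qed
  then show "enat n \<le> 1"
    by (simp add: one_enat_def)
qed

end

section \<open>Extension of homomorphisms\<close>

text \<open>Subrings are sets, so a homomorphism from \<open>R\<close> is a total function with
  arbitrary values outside \<open>R\<close>; extending it means agreeing with it on
  \<open>R\<close>.\<close>

definition ring_hom_on :: "'a::comm_ring_1 set \<Rightarrow> ('a \<Rightarrow> 'b::comm_ring_1) \<Rightarrow> bool" where
  "ring_hom_on R \<phi> \<longleftrightarrow> \<phi> 1 = 1 \<and> (\<forall>x\<in>R. \<forall>y\<in>R. \<phi> (x + y) = \<phi> x + \<phi> y \<and> \<phi> (x * y) = \<phi> x * \<phi> y)"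

context
  fixes R :: "'a::comm_ring_1 set" and \<phi> :: "'a \<Rightarrow> 'b::comm_ring_1"
  assumes R: "is_subring R" and \<phi>: "ring_hom_on R \<phi>"
begin

lemma ring_hom_on_1: "\<phi> 1 = 1"
  using \<phi> by (simp add: ring_hom_on_def)

lemma ring_hom_on_add: "x \<in> R \<Longrightarrow> y \<in> R \<Longrightarrow> \<phi> (x + y) = \<phi> x + \<phi> y"
  using \<phi> by (simp add: ring_hom_on_def)

lemma ring_hom_on_mult: "x \<in> R \<Longrightarrow> y \<in> R \<Longrightarrow> \<phi> (x * y) = \<phi> x * \<phi> y"
  using \<phi> by (simp add: ring_hom_on_def)

lemma ring_hom_on_0: "\<phi> 0 = 0"
  using ring_hom_on_add[OF subring_0[OF R] subring_0[OF R]] by simp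

lemma ring_hom_on_diff:
  assumes "x \<in> R" "y \<in> R"
  shows "\<phi> (x - y) = \<phi> x - \<phi> y"
  using ring_hom_on_add[OF subring_diff[OF R assms] assms(2)] by (simp add: algebra_simps)

lemma ring_hom_on_power: "x \<in> R \<Longrightarrow> \<phi> (x ^ n) = \<phi> x ^ n"
  by (induction n) (auto simp: ring_hom_on_1 ring_hom_on_mult subring_power[OF R])

lemma ring_hom_on_sum: "(\<And>x. x \<in> A \<Longrightarrow> f x \<in> R) \<Longrightarrow> \<phi> (sum f A) = (\<Sum>x\<in>A. \<phi> (f x))"
  by (induction A rule: infinite_finite_induct)
    (auto simp: ring_hom_on_0 ring_hom_on_add subring_sum[OF R])

lemma ring_hom_on_eval:
  "ring_hom_on (polys_over R) (\<lambda>p. poly (map_poly \<phi> p) \<xi>)"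
  unfolding ring_hom_on_def
proof (intro conjI ballI)
  show "poly (map_poly \<phi> 1) \<xi> = 1"
    by (simp add: ring_hom_on_1)
next
  fix p q assume pq: "p \<in> polys_over R" "q \<in> polys_over R"
  have "map_poly \<phi> (p + q) = map_poly \<phi> p + map_poly \<phi> q"
    using pq by (intro poly_eqI) (simp add: coeff_map_poly ring_hom_on_0 ring_hom_on_add polys_overD)
  then show "poly (map_poly \<phi> (p + q)) \<xi> = poly (map_poly \<phi> p) \<xi> + poly (map_poly \<phi> q) \<xi>"
    by simp
  have "map_poly \<phi> (p * q) = map_poly \<phi> p * map_poly \<phi> q"
    using pq by (intro poly_eqI)
      (simp add: coeff_map_poly ring_hom_on_0 coeff_mult ring_hom_on_sum ring_hom_on_mult polys_overD subring_mult[OF R])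
  then show "poly (map_poly \<phi> (p * q)) \<xi> = poly (map_poly \<phi> p) \<xi> * poly (map_poly \<phi> q) \<xi>"
    by simp
qed

end

lemma map_poly_const: "f 0 = 0 \<Longrightarrow> map_poly f [:c:] = [:f c:]"
  by (rule poly_eqI) (simp add: coeff_map_poly coeff_pCons split: nat.split)

lemma map_poly_X: "f 0 = 0 \<Longrightarrow> f 1 = 1 \<Longrightarrow> map_poly f [:0, 1:] = [:0, 1:]"
  by (rule poly_eqI) (simp add: coeff_map_poly coeff_pCons split: nat.split)

text \<open>\<open>R[a]\<close> is the quotient of \<open>R[X]\<close> by the relations of
  \<open>a\<close>, so \<open>a\<close> may be sent to any \<open>\<xi>\<close> that satisfies the
  images of these relations.\<close>

lemma extend_ring_hom_adjoin:
  assumes R: "is_subring R" and \<phi>: "ring_hom_on R \<phi>"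
    and root: "\<And>q. q \<in> polys_over R \<Longrightarrow> poly q a = 0 \<Longrightarrow> poly (map_poly \<phi> q) \<xi> = 0"
  obtains \<psi> where "ring_hom_on (adjoin R a) \<psi>"
    "\<And>q. q \<in> polys_over R \<Longrightarrow> \<psi> (poly q a) = poly (map_poly \<phi> q) \<xi>"
    "\<And>r. r \<in> R \<Longrightarrow> \<psi> r = \<phi> r" "\<psi> a = \<xi>"
proof
  define \<psi> where "\<psi> z = poly (map_poly \<phi> (SOME q. q \<in> polys_over R \<and> z = poly q a)) \<xi>" for z
  note P = is_subring_polys_over[OF R]
  note h = ring_hom_on_eval[OF R \<phi>, of \<xi>]
  show \<psi>: "\<psi> (poly q a) = poly (map_poly \<phi> q) \<xi>" if q: "q \<in> polys_over R" for q
  proof -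
    define q' where "q' = (SOME q'. q' \<in> polys_over R \<and> poly q a = poly q' a)"
    have q': "q' \<in> polys_over R \<and> poly q a = poly q' a"
      unfolding q'_def by (rule someI[of _ q]) (use q in auto)
    then have "poly (map_poly \<phi> (q - q')) \<xi> = 0"
      using q by (intro root subring_diff[OF P]) auto
    then show ?thesis
      unfolding \<psi>_def q'_def[symmetric] using q q' ring_hom_on_diff[OF P h, of q q'] by simp
  qed
  show "ring_hom_on (adjoin R a) \<psi>"
    unfolding ring_hom_on_def
  proof (intro conjI ballI)
    show "\<psi> 1 = 1"
      using \<psi>[OF subring_1[OF P]] ring_hom_on_1[OF P h] by simp
  next
    fix x y assume "x \<in> adjoin R a" "y \<in> adjoin R a"
    then obtain p q where pq: "p \<in> polys_over R" "q \<in> polys_over R" "x = poly p a" "y = poly q a"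
      by (auto simp: adjoin_def)
    show "\<psi> (x + y) = \<psi> x + \<psi> y"
      using \<psi>[OF subring_add[OF P pq(1,2)]] \<psi>[OF pq(1)] \<psi>[OF pq(2)] ring_hom_on_add[OF P h pq(1,2)] pq
      by simp
    show "\<psi> (x * y) = \<psi> x * \<psi> y"
      using \<psi>[OF subring_mult[OF P pq(1,2)]] \<psi>[OF pq(1)] \<psi>[OF pq(2)] ring_hom_on_mult[OF P h pq(1,2)] pq
      by simp
  qed
  show "\<psi> r = \<phi> r" if "r \<in> R" for r
    using \<psi>[OF polys_over_const[OF R that]] ring_hom_on_0[OF R \<phi>] by (simp add: map_poly_const)
  show "\<psi> a = \<xi>"
    using \<psi>[OF polys_over_X[OF R]] ring_hom_on_0[OF R \<phi>] ring_hom_on_1[OF R \<phi>] by (simp add: map_poly_X)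
qed

text \<open>The leading coefficient need not be invertible in \<open>R\<close>; multiplying
  \<open>q\<close> by a power of it keeps quotient and remainder over \<open>R\<close>.\<close>

lemma pseudo_division_over_subring:
  fixes p q :: "'a::idom poly"
  assumes R: "is_subring R" and p: "p \<in> polys_over R" "p \<noteq> 0" and q: "q \<in> polys_over R"
  obtains k h r where "h \<in> polys_over R" "r \<in> polys_over R" "smult (lead_coeff p ^ k) q = p * h + r"
    "r = 0 \<or> degree r < degree p"
proof -
  note P = is_subring_polys_over[OF R]
  let ?c = "lead_coeff p"
  have c: "?c \<in> R"
    using p(1) by (rule polys_overD)
  have "\<exists>k h r. h \<in> polys_over R \<and> r \<in> polys_over R \<and> smult (?c ^ k) q = p * h + r \<and> (r = 0 \<or> degree r < degree p)"
    if "q = 0 \<or> degree q < n" "q \<in> polys_over R" for n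
    using that
  proof (induction n arbitrary: q)
    case 0
    then show ?case
      by (intro exI[of _ 0]) (auto intro: subring_0[OF P])
  next
    case (Suc n)
    show ?case
    proof (cases "q = 0 \<or> degree q < degree p \<or> degree q < n")
      case True
      then show ?thesis
      proof (elim disjE)
        assume "degree q < degree p"
        then show ?thesis
          using Suc.prems by (intro exI[of _ 0] exI[of _ q]) (auto intro: subring_0[OF P])
      qed (use Suc in auto)
    next
      case False
      then have n: "degree q = n" "degree p \<le> n" "q \<noteq> 0"
        using Suc.prems by auto
      define m where "m = monom (lead_coeff q) (n - degree p)"
      have m: "m \<in> polys_over R"
        unfolding m_def using Suc.prems(2) by (intro polys_over_monom R polys_overD)
      define q1 where "q1 = smult ?c q - m * p"
      have q1: "q1 \<in> polys_over R"
        unfolding q1_def using m p(1) c Suc.prems(2) by (intro subring_diff[OF P] subring_mult[OF P] polys_over_smult R)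
      have "coeff q1 i = 0" if "i \<ge> n" for i
      proof (cases "i = n")
        case True
        then show ?thesis
          using n by (simp add: q1_def m_def coeff_monom_mult)
      next
        case False
        then have "i > n" using that by simp
        moreover have "degree p < i - (n - degree p)"
          using \<open>i > n\<close> n by simp
        ultimately show ?thesis
          using n by (simp add: q1_def m_def coeff_monom_mult coeff_eq_0)
      qed
      then have "q1 = 0 \<or> degree q1 < n"
        by (metis leading_coeff_0_iff not_le)
      from Suc.IH[OF this q1] obtain k h r where
        kh: "h \<in> polys_over R" "r \<in> polys_over R" "smult (?c ^ k) q1 = p * h + r" "r = 0 \<or> degree r < degree p"
        by blast
      have "smult (?c ^ Suc k) q = smult (?c ^ k) q1 + smult (?c ^ k) m * p"
        by (simp add: q1_def smult_diff_right mult.commute)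
      then have "smult (?c ^ Suc k) q = p * (h + smult (?c ^ k) m) + r"
        by (simp add: kh(3) algebra_simps)
      moreover have "h + smult (?c ^ k) m \<in> polys_over R"
        using kh(1) m c by (intro subring_add[OF P] polys_over_smult R subring_power)
      ultimately show ?thesis
        using kh(2,4) by blast
    qed
  qed
  from this[of "Suc (degree q)"] q that show thesis
    by auto
qed

definition alg_elem :: "'a::comm_ring_1 set \<Rightarrow> 'a \<Rightarrow> bool" where
  "alg_elem R a \<longleftrightarrow> (\<exists>p\<in>polys_over R. p \<noteq> 0 \<and> poly p a = 0)"

lemma alg_elem_minimal:
  assumes "alg_elem R a"
  obtains p where "p \<in> polys_over R" "p \<noteq> 0" "poly p a = 0"
    "\<And>q. q \<in> polys_over R \<Longrightarrow> poly q a = 0 \<Longrightarrow> degree q < degree p \<Longrightarrow> q = 0"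
proof -
  let ?P = "\<lambda>p. p \<in> polys_over R \<and> p \<noteq> 0 \<and> poly p a = 0"
  obtain p where "?P p" "\<forall>q. ?P q \<longrightarrow> degree p \<le> degree q"
    using assms ex_has_least_nat[of ?P _ degree] unfolding alg_elem_def by blast
  then show thesis
    using that by (meson not_le)
qed

text \<open>Over the fraction field of \<open>R\<close> the element \<open>v\<close> has an inverse
  that is a polynomial in \<open>a\<close>; \<open>w\<close> is that inverse with denominators
  cleared. It is found from a polynomial \<open>q\<close> of least degree whose value at
  \<open>a\<close> is a nonzero multiple of \<open>v\<close>.\<close>

lemma nonzero_multiple_in_base:
  fixes a :: "'a::idom"
  assumes R: "is_subring R" and a: "alg_elem R a" and v: "v \<in> adjoin R a" "v \<noteq> 0"
  obtains w where "w \<in> adjoin R a" "v * w \<in> R" "v * w \<noteq> 0"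
proof -
  note A = is_subring_adjoin[OF R, of a]
  obtain p where p: "p \<in> polys_over R" "p \<noteq> 0" "poly p a = 0"
    and pmin: "\<And>q. q \<in> polys_over R \<Longrightarrow> poly q a = 0 \<Longrightarrow> degree q < degree p \<Longrightarrow> q = 0"
    by (rule alg_elem_minimal[OF a]) blast
  have pa: "poly q a \<in> adjoin R a" if "q \<in> polys_over R" for q
    using that by (auto simp: adjoin_def)
  let ?Q = "\<lambda>q. q \<in> polys_over R \<and> poly q a \<noteq> 0 \<and> (\<exists>w\<in>adjoin R a. poly q a = v * w)"
  obtain g where "g \<in> polys_over R" "v = poly g a"
    using v(1) by (rule adjoinE)
  then have "?Q g"
    using v(2) subring_1[OF A] by auto
  then obtain q where q: "?Q q" and qmin: "\<And>r. ?Q r \<Longrightarrow> degree q \<le> degree r"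
    using ex_has_least_nat[of ?Q g degree] by blast
  obtain w where w: "w \<in> adjoin R a" "poly q a = v * w"
    using q by blast
  \<comment> \<open>Dividing \<open>q\<close> by \<open>p\<close> gives
    \<open>degree q < degree p\<close>. Dividing \<open>p\<close> by \<open>q\<close> leaves a
    remainder whose value is a multiple of \<open>v\<close>, hence zero by the choice of
    \<open>q\<close>; then the remainder is zero by the choice of \<open>p\<close>, and the quotient
    is a relation of \<open>a\<close> of too small a degree.\<close>
  have "degree q = 0"
  proof (rule ccontr)
    assume "degree q \<noteq> 0"
    have "q \<noteq> 0" using q by auto
    obtain k h r where 1: "h \<in> polys_over R" "r \<in> polys_over R" "smult (lead_coeff p ^ k) q = p * h + r"
        "r = 0 \<or> degree r < degree p"
      by (rule pseudo_division_over_subring[OF R p(1,2)]) (use q in blast)+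
    have "poly r a = lead_coeff p ^ k * poly q a"
      using arg_cong[OF 1(3), of "\<lambda>f. poly f a"] p(3) by simp
    then have ra: "poly r a = v * (lead_coeff p ^ k * w)"
      by (simp add: w(2) mult.left_commute)
    have "lead_coeff p ^ k \<in> adjoin R a"
      using subset_adjoin[OF R] subring_power[OF R polys_overD[OF p(1)]] by blast
    then have "lead_coeff p ^ k * w \<in> adjoin R a"
      using w(1) by (intro subring_mult[OF A])
    moreover have "poly r a \<noteq> 0"
      using ra w(2) q p(2) by auto
    ultimately have "degree q \<le> degree r" "r \<noteq> 0"
      using qmin[of r] 1(2) ra by auto
    then have qp: "degree q < degree p"
      using 1(4) by auto
    obtain k h r where 2: "h \<in> polys_over R" "r \<in> polys_over R" "smult (lead_coeff q ^ k) p = q * h + r"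
        "r = 0 \<or> degree r < degree q"
      by (rule pseudo_division_over_subring[OF R _ \<open>q \<noteq> 0\<close> p(1)]) (use q in blast)+
    have e: "poly q a * poly h a + poly r a = 0"
      using arg_cong[OF 2(3), of "\<lambda>f. poly f a"] p(3) by simp
    then have ra: "poly r a = v * (- (w * poly h a))"
      by (simp add: w(2) algebra_simps eq_neg_iff_add_eq_0)
    have "- (w * poly h a) \<in> adjoin R a"
      using w(1) pa[OF 2(1)] by (intro subring_uminus[OF A] subring_mult[OF A])
    then have "poly r a = 0"
      using qmin[of r] 2(2,4) ra by force
    then have "r = 0"
      using pmin[OF 2(2)] 2(4) qp by fastforce
    have "poly h a = 0"
      using e \<open>poly r a = 0\<close> q by auto
    have "smult (lead_coeff q ^ k) p = q * h"
      using 2(3) \<open>r = 0\<close> by simp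
    moreover have "smult (lead_coeff q ^ k) p \<noteq> 0"
      using \<open>q \<noteq> 0\<close> p(2) by simp
    ultimately have "h \<noteq> 0" by auto
    have "degree p = degree (smult (lead_coeff q ^ k) p)"
      using \<open>q \<noteq> 0\<close> by simp
    also have "\<dots> = degree q + degree h"
      using \<open>smult (lead_coeff q ^ k) p = q * h\<close> \<open>q \<noteq> 0\<close> \<open>h \<noteq> 0\<close> by (simp add: degree_mult_eq)
    finally have "degree h < degree p"
      using \<open>degree q \<noteq> 0\<close> by simp
    then show False
      using pmin[OF 2(1) \<open>poly h a = 0\<close>] \<open>h \<noteq> 0\<close> by simp
  qed
  then obtain c where c: "q = [:c:]"
    by (rule degree_eq_zeroE)
  then have "c \<in> R"
    using q polys_overD[of q R 0] by simp
  then show thesis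
    using that[OF w(1)] q w(2) c by auto
qed

text \<open>If \<open>g\<close> is not constant, a root of \<open>g - 1\<close> is a point where
  \<open>g\<close> does not vanish.\<close>

lemma alg_closed_nonroot:
  fixes g :: "'a::alg_closed_field poly"
  assumes "g \<noteq> 0"
  obtains \<xi> where "poly g \<xi> \<noteq> 0"
proof (cases "degree g = 0")
  case True
  then obtain c where "g = [:c:]"
    by (rule degree_eq_zeroE)
  then show thesis
    using assms that[of 0] by auto
next
  case False
  then have "degree (g + [:- 1:]) > 0"
    by (subst degree_add_eq_left) auto
  then obtain \<xi> where "poly (g + [:- 1:]) \<xi> = 0"
    using alg_closed_imp_poly_has_root by blast
  then show thesis
    using that[of \<xi>] by auto
qed

text \<open>The element \<open>u\<close> is chosen before \<open>\<phi>\<close>, so that a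
  nonvanishing condition can be pushed down one generator at a time.\<close>

lemma extend_ring_hom_generator:
  fixes v :: "'a::idom"
  assumes R: "is_subring R" and v: "v \<in> adjoin R a" "v \<noteq> 0"
  obtains u where "u \<in> R" "u \<noteq> 0"
    "\<And>\<phi> :: 'a \<Rightarrow> 'b::alg_closed_field. ring_hom_on R \<phi> \<Longrightarrow> \<phi> u \<noteq> 0 \<Longrightarrow>
      \<exists>\<psi>. ring_hom_on (adjoin R a) \<psi> \<and> (\<forall>r\<in>R. \<psi> r = \<phi> r) \<and> \<psi> v \<noteq> 0"
proof (cases "alg_elem R a")
  case True
  obtain p where p: "p \<in> polys_over R" "p \<noteq> 0" "poly p a = 0"
    and pmin: "\<And>q. q \<in> polys_over R \<Longrightarrow> poly q a = 0 \<Longrightarrow> degree q < degree p \<Longrightarrow> q = 0"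
    by (rule alg_elem_minimal[OF True]) blast
  obtain w where w: "w \<in> adjoin R a" "v * w \<in> R" "v * w \<noteq> 0"
    by (rule nonzero_multiple_in_base[OF R True v])
  let ?c = "lead_coeff p"
  have c: "?c \<in> R"
    using p(1) by (rule polys_overD)
  show thesis
  proof (rule that)
    \<comment> \<open>The factor \<open>?c\<close> preserves the degree of \<open>p\<close> under
      \<open>\<phi>\<close>, so a root \<open>\<xi>\<close> exists; the factor \<open>v * w\<close>
      makes \<open>\<psi> v\<close> nonzero because
      \<open>\<psi> v * \<psi> w = \<phi> (v * w)\<close>.\<close>
    show "?c * (v * w) \<in> R"
      by (rule subring_mult[OF R c w(2)])
    show "?c * (v * w) \<noteq> 0"
      using p(2) w(3) by simp
  next
    fix \<phi> :: "'a \<Rightarrow> 'b"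
    assume \<phi>: "ring_hom_on R \<phi>" and "\<phi> (?c * (v * w)) \<noteq> 0"
    then have nz: "\<phi> ?c \<noteq> 0" "\<phi> (v * w) \<noteq> 0"
      using ring_hom_on_mult[OF R \<phi> c w(2)] by auto
    have "degree p \<noteq> 0"
      using p(2,3) by (metis degree_eq_zeroE mult_zero_right pCons_0_0 poly_0 poly_pCons add.right_neutral)
    moreover have "degree (map_poly \<phi> p) = degree p"
      using nz(1) by (intro map_poly_degree_eq)
    ultimately obtain \<xi> where \<xi>: "poly (map_poly \<phi> p) \<xi> = 0"
      using alg_closed_imp_poly_has_root[of "map_poly \<phi> p"] by auto
    note h = ring_hom_on_eval[OF R \<phi>, of \<xi>] and P = is_subring_polys_over[OF R]
    \<comment> \<open>After multiplication by a power of \<open>?c\<close> every relation of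
      \<open>a\<close> is a multiple of \<open>p\<close>, and \<open>\<phi>\<close> does not kill
      that power.\<close>
    have root: "poly (map_poly \<phi> q) \<xi> = 0" if q: "q \<in> polys_over R" "poly q a = 0" for q
    proof -
      obtain k h r where kh: "h \<in> polys_over R" "r \<in> polys_over R" "smult (?c ^ k) q = p * h + r"
          "r = 0 \<or> degree r < degree p"
        by (rule pseudo_division_over_subring[OF R p(1,2) q(1)])
      have "poly r a = 0"
        using arg_cong[OF kh(3), of "\<lambda>f. poly f a"] p(3) q(2) by simp
      then have "r = 0"
        using pmin[OF kh(2)] kh(4) by auto
      then have eq: "[:?c ^ k:] * q = p * h"
        using kh(3) by simp
      have ck: "?c ^ k \<in> R"
        by (rule subring_power[OF R c])
      have "poly (map_poly \<phi> ([:?c ^ k:] * q)) \<xi> = poly (map_poly \<phi> [:?c ^ k:]) \<xi> * poly (map_poly \<phi> q) \<xi>"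
        by (rule ring_hom_on_mult[OF P ring_hom_on_eval[OF R \<phi>] polys_over_const[OF R ck] q(1)])
      moreover have "poly (map_poly \<phi> (p * h)) \<xi> = 0"
        using ring_hom_on_mult[OF P ring_hom_on_eval[OF R \<phi>] p(1) kh(1), of \<xi>] \<xi> by simp
      moreover have "poly (map_poly \<phi> [:?c ^ k:]) \<xi> \<noteq> 0"
        using nz(1) ring_hom_on_power[OF R \<phi> c] ring_hom_on_0[OF R \<phi>] by (simp add: map_poly_const)
      ultimately show ?thesis
        unfolding eq by simp
    qed
    obtain \<psi> where \<psi>: "ring_hom_on (adjoin R a) \<psi>" "\<And>r. r \<in> R \<Longrightarrow> \<psi> r = \<phi> r"
      by (rule extend_ring_hom_adjoin[OF R \<phi> root]) blast+
    have "\<psi> v * \<psi> w = \<phi> (v * w)"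
      using ring_hom_on_mult[OF is_subring_adjoin[OF R] \<psi>(1) v(1) w(1)] \<psi>(2)[OF w(2)] by simp
    then have "\<psi> v \<noteq> 0"
      using nz(2) by auto
    then show "\<exists>\<psi>. ring_hom_on (adjoin R a) \<psi> \<and> (\<forall>r\<in>R. \<psi> r = \<phi> r) \<and> \<psi> v \<noteq> 0"
      using \<psi> by blast
  qed
next
  case False
  obtain g where g: "g \<in> polys_over R" "v = poly g a"
    using v(1) by (rule adjoinE)
  then have "g \<noteq> 0" using v(2) by auto
  show thesis
  proof (rule that)
    \<comment> \<open>Without relations \<open>a\<close> may be sent anywhere; \<open>\<xi>\<close>
      only has to avoid the roots of the image of \<open>g\<close>, which is nonzero if the leading
      coefficient survives.\<close>
    show "lead_coeff g \<in> R" "lead_coeff g \<noteq> 0"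
      using g(1) \<open>g \<noteq> 0\<close> by (auto intro: polys_overD)
  next
    fix \<phi> :: "'a \<Rightarrow> 'b"
    assume \<phi>: "ring_hom_on R \<phi>" and nz: "\<phi> (lead_coeff g) \<noteq> 0"
    have "coeff (map_poly \<phi> g) (degree g) \<noteq> 0"
      using nz ring_hom_on_0[OF R \<phi>] by (simp add: coeff_map_poly)
    then have "map_poly \<phi> g \<noteq> 0" by auto
    then obtain \<xi> where \<xi>: "poly (map_poly \<phi> g) \<xi> \<noteq> 0"
      by (rule alg_closed_nonroot)
    have root: "poly (map_poly \<phi> q) \<xi> = 0" if "q \<in> polys_over R" "poly q a = 0" for q
      using that False by (auto simp: alg_elem_def)
    obtain \<psi> where "ring_hom_on (adjoin R a) \<psi>" "\<And>r. r \<in> R \<Longrightarrow> \<psi> r = \<phi> r"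
        "\<And>q. q \<in> polys_over R \<Longrightarrow> \<psi> (poly q a) = poly (map_poly \<phi> q) \<xi>"
      by (rule extend_ring_hom_adjoin[OF R \<phi> root]) blast+
    then show "\<exists>\<psi>. ring_hom_on (adjoin R a) \<psi> \<and> (\<forall>r\<in>R. \<psi> r = \<phi> r) \<and> \<psi> v \<noteq> 0"
      using \<xi> g by (intro exI[of _ \<psi>]) auto
  qed
qed

text \<open>Induction on the generators trades the condition at \<open>v\<close> for one at
  \<open>w\<close> a step below, and finally for one at \<open>u\<close> in \<open>R\<close>.
  Applied with \<open>v = 1\<close> the lemma just produces an extension.\<close>

lemma extend_ring_hom_fg:
  fixes v :: "'a::idom"
  assumes R: "is_subring R" and "finite S" and v: "v \<in> is_subring hull (R \<union> S)" "v \<noteq> 0"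
  shows "\<exists>u\<in>R. u \<noteq> 0 \<and> (\<forall>\<phi> :: 'a \<Rightarrow> 'b::alg_closed_field. ring_hom_on R \<phi> \<longrightarrow> \<phi> u \<noteq> 0 \<longrightarrow>
      (\<exists>\<psi>. ring_hom_on (is_subring hull (R \<union> S)) \<psi> \<and> (\<forall>r\<in>R. \<psi> r = \<phi> r) \<and> \<psi> v \<noteq> 0))"
  using \<open>finite S\<close> v
proof (induction S arbitrary: v)
  case empty
  then show ?case
    using hull_same[of is_subring R] R by auto
next
  case (insert a S)
  let ?A = "is_subring hull (R \<union> S)"
  have A: "is_subring ?A"
    by (rule is_subring_hull)
  have RA: "R \<subseteq> ?A"
    by (meson hull_subset le_sup_iff)
  have eq: "is_subring hull (R \<union> insert a S) = adjoin ?A a"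
    unfolding adjoin_eq_hull[OF A] hull_insert[of is_subring a "?A"] hull_insert[of is_subring a "R \<union> S"]
    by (simp add: hull_insert[symmetric])
  obtain w where w: "w \<in> ?A" "w \<noteq> 0" and ext:
    "\<And>\<phi> :: 'a \<Rightarrow> 'b. ring_hom_on ?A \<phi> \<Longrightarrow> \<phi> w \<noteq> 0 \<Longrightarrow>
      \<exists>\<psi>. ring_hom_on (adjoin ?A a) \<psi> \<and> (\<forall>r\<in>?A. \<psi> r = \<phi> r) \<and> \<psi> v \<noteq> 0"
    by (rule extend_ring_hom_generator[OF A, of v a, where 'b = 'b]) (use insert.prems eq in auto)
  obtain u where u: "u \<in> R" "u \<noteq> 0" and ext':
    "\<And>\<phi> :: 'a \<Rightarrow> 'b. ring_hom_on R \<phi> \<Longrightarrow> \<phi> u \<noteq> 0 \<Longrightarrow>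
      \<exists>\<psi>. ring_hom_on ?A \<psi> \<and> (\<forall>r\<in>R. \<psi> r = \<phi> r) \<and> \<psi> w \<noteq> 0"
    using insert.IH[OF w] by blast
  show ?case
    unfolding eq
  proof (intro bexI[OF _ u(1)] conjI u(2) allI impI)
    fix \<phi> :: "'a \<Rightarrow> 'b" assume "ring_hom_on R \<phi>" "\<phi> u \<noteq> 0"
    then obtain \<psi> where \<psi>: "ring_hom_on ?A \<psi>" "\<forall>r\<in>R. \<psi> r = \<phi> r" "\<psi> w \<noteq> 0"
      using ext' by blast
    obtain \<chi> where "ring_hom_on (adjoin ?A a) \<chi>" "\<forall>r\<in>?A. \<chi> r = \<psi> r" "\<chi> v \<noteq> 0"
      using ext[OF \<psi>(1,3)] by blast
    then show "\<exists>\<psi>. ring_hom_on (adjoin ?A a) \<psi> \<and> (\<forall>r\<in>R. \<psi> r = \<phi> r) \<and> \<psi> v \<noteq> 0"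
      using \<psi>(2) RA by (intro exI[of _ \<chi>]) auto
  qed
qed

section \<open>Kernels as primes and a chain of length 2\<close>

lemma prime_ideal_kernel:
  fixes \<phi> :: "'a::comm_ring_1 \<Rightarrow> 'b::idom"
  assumes \<phi>: "ring_hom_on UNIV \<phi>"
  shows "prime_ideal {x. \<phi> x = 0}"
proof -
  have U: "is_subring (UNIV :: 'a set)"
    by (auto simp: is_subring_def)
  show ?thesis
    unfolding prime_ideal_def ring_ideal_iff set_eq_iff
    using ring_hom_on_0[OF U \<phi>] ring_hom_on_1[OF U \<phi>] ring_hom_on_add[OF U \<phi>] ring_hom_on_mult[OF U \<phi>]
    by (auto intro!: exI[of _ 1])
qed

context acf_algebra
begin

text \<open>The kernels grow strictly: \<open>\<psi>\<close> kills \<open>x - l\<close>, but it is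
  injective on \<open>K[y]\<close>, so \<open>y - m\<close> is killed only by the second
  specialization \<open>\<chi>\<close>.\<close>

lemma prime_chain_2_if_algebraically_independent:
  assumes fg: "finitely_generated UNIV" and y: "y \<notin> K0" and x: "\<not> alg_elem (adjoin K0 y) x"
  shows "\<exists>P :: nat \<Rightarrow> 'a set. prime_chain 2 P"
proof -
  define \<tau> :: "'k poly \<Rightarrow> ('k poly fract) alg_closure" where "\<tau> p = to_ac (to_fract p)" for p
  have \<tau>_hom: "\<tau> 1 = 1" "\<tau> 0 = 0" "\<tau> (p + q) = \<tau> p + \<tau> q" "\<tau> (p * q) = \<tau> p * \<tau> q" "\<tau> (p - q) = \<tau> p - \<tau> q" for p q
    by (simp_all add: \<tau>_def)
  have \<tau>_inj: "\<tau> p = \<tau> q \<longleftrightarrow> p = q" for p q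
    by (simp add: \<tau>_def)
  have inv_\<tau>: "inv_into UNIV \<tau> (\<tau> p) = p" for p
    by (rule inv_f_f) (auto simp: inj_def \<tau>_inj)
  have inv_ev: "inv_into UNIV (ev y) (ev y p) = p" for p
  proof (rule inv_f_f, rule injI)
    fix p q assume "ev y p = ev y q"
    then have "ev y (p - q) = 0" by simp
    then have "p - q = 0"
      using ev_eq_0_iff[OF y] by blast
    then show "p = q" by simp
  qed
  obtain S where S: "finite S" "is_subring hull (K0 \<union> S) = UNIV"
    using fg unfolding finitely_generated_def is_subalgebra_hull_eq by blast
  let ?R1 = "adjoin K0 y"
  have R1: "is_subring ?R1"
    by (rule is_subring_adjoin[OF is_subring_K0])
  let ?R = "adjoin ?R1 x"
  have R: "is_subring ?R"
    by (rule is_subring_adjoin[OF R1])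
  have R1R: "?R1 \<subseteq> ?R"
    by (rule subset_adjoin[OF R1])
  have K0R: "K0 \<subseteq> ?R"
    using R1R subset_adjoin[OF is_subring_K0] by blast
  have hull_R: "is_subring hull (?R \<union> S) = UNIV"
    using hull_mono[of "K0 \<union> S" "?R \<union> S" is_subring] K0R S(2) by auto
  obtain u where u: "u \<in> ?R" "u \<noteq> 0" and ext:
    "\<And>\<phi> :: 'a \<Rightarrow> ('k poly fract) alg_closure. ring_hom_on ?R \<phi> \<Longrightarrow> \<phi> u \<noteq> 0 \<Longrightarrow>
      (\<exists>\<psi>. ring_hom_on UNIV \<psi> \<and> (\<forall>r\<in>?R. \<psi> r = \<phi> r) \<and> \<psi> 1 \<noteq> 0)"
    using extend_ring_hom_fg[OF R S(1), of 1, where 'b = "('k poly fract) alg_closure"] unfolding hull_R by auto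
  obtain U where U: "U \<in> polys_over ?R1" "u = poly U x"
    using u(1) by (rule adjoinE)
  define \<phi>1 where "\<phi>1 z = \<tau> (inv_into UNIV (ev y) z)" for z
  have \<phi>1: "\<phi>1 (ev y p) = \<tau> p" for p
    by (simp add: \<phi>1_def inv_ev)
  have \<phi>1_hom: "ring_hom_on ?R1 \<phi>1"
    unfolding ring_hom_on_def adjoin_K0 using \<phi>1[of 1]
    by (auto simp: \<phi>1 \<tau>_hom simp flip: ev_hom(3,5))
  have \<phi>1_0: "z = 0" if "z \<in> ?R1" "\<phi>1 z = 0" for z
    using that \<tau>_inj[of _ 0] by (auto simp: adjoin_K0 \<phi>1 \<tau>_hom)
  have "lead_coeff U \<noteq> 0"
    using u(2) U(2) by auto
  then have "coeff (map_poly \<phi>1 U) (degree U) \<noteq> 0"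
    using \<phi>1_0[OF polys_overD[OF U(1)]] ring_hom_on_0[OF R1 \<phi>1_hom] by (metis coeff_map_poly)
  then have "map_poly \<phi>1 U \<noteq> 0" by auto
  then have "finite {z. poly (map_poly \<phi>1 U) z = 0}"
    by (rule poly_roots_finite)
  \<comment> \<open>Characteristic zero makes the field of constants infinite, so some constant
    \<open>l\<close> avoids the finitely many roots of the image of \<open>U\<close>; then
    \<open>\<phi>2\<close> does not kill \<open>u\<close> and can be extended.\<close>
  moreover have "inj (\<lambda>c. \<tau> [:c:])"
    by (auto simp: inj_def \<tau>_inj)
  then have "infinite (range (\<lambda>c. \<tau> [:c:]))"
    using infinite_UNIV_char_0 by (auto dest: finite_imageD)
  ultimately have "\<exists>z\<in>range (\<lambda>c. \<tau> [:c:]). poly (map_poly \<phi>1 U) z \<noteq> 0"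
    using finite_subset[of "range (\<lambda>c. \<tau> [:c:])" "{z. poly (map_poly \<phi>1 U) z = 0}"] by blast
  then obtain l where l: "poly (map_poly \<phi>1 U) (\<tau> [:l:]) \<noteq> 0"
    by blast
  have root: "poly (map_poly \<phi>1 q) (\<tau> [:l:]) = 0" if "q \<in> polys_over ?R1" "poly q x = 0" for q
    using that x by (auto simp: alg_elem_def)
  obtain \<phi>2 where \<phi>2: "ring_hom_on ?R \<phi>2"
    "\<And>q. q \<in> polys_over ?R1 \<Longrightarrow> \<phi>2 (poly q x) = poly (map_poly \<phi>1 q) (\<tau> [:l:])"
    "\<And>r. r \<in> ?R1 \<Longrightarrow> \<phi>2 r = \<phi>1 r" "\<phi>2 x = \<tau> [:l:]"
    by (rule extend_ring_hom_adjoin[OF R1 \<phi>1_hom root]) blast+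
  have "\<phi>2 u \<noteq> 0"
    using \<phi>2(2)[OF U(1)] U(2) l by simp
  then obtain \<psi> where \<psi>: "ring_hom_on UNIV \<psi>" "\<And>r. r \<in> ?R \<Longrightarrow> \<psi> r = \<phi>2 r"
    using ext[OF \<phi>2(1)] by blast
  have \<psi>_ev: "\<psi> (ev y p) = \<tau> p" for p
  proof -
    have "ev y p \<in> ?R1"
      by (simp add: adjoin_K0)
    then show ?thesis
      using \<psi>(2)[of "ev y p"] R1R \<phi>2(3)[of "ev y p"] \<phi>1 by auto
  qed
  have \<psi>_x: "\<psi> x = \<tau> [:l:]"
    using \<psi>(2)[OF generator_in_adjoin[OF R1]] \<phi>2(4) by simp
  have UN: "is_subring (UNIV :: 'a set)"
    by (auto simp: is_subring_def)
  let ?T = "range \<tau>"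
  have T: "is_subring ?T"
    unfolding is_subring_def by (auto simp flip: \<tau>_hom)
  \<comment> \<open>The image of \<open>\<psi>\<close> lies in \<open>?H\<close>, which is finitely
    generated over the copy \<open>?T\<close> of the polynomial ring. So the extension lemma applies
    again, now with values in the base field.\<close>
  let ?H = "is_subring hull (?T \<union> \<psi> ` S)"
  have H: "is_subring ?H"
    by (rule is_subring_hull)
  have "K0 \<union> S \<subseteq> {z. \<psi> z \<in> ?H}"
  proof
    fix z assume "z \<in> K0 \<union> S"
    then have "\<psi> z \<in> ?T \<union> \<psi> ` S"
      using \<psi>_ev[of "[:_:]"] by auto
    then show "z \<in> {z. \<psi> z \<in> ?H}"
      by (auto intro: hull_inc)
  qed
  moreover have "is_subring {z. \<psi> z \<in> ?H}"
    using ring_hom_on_1[OF UN \<psi>(1)] ring_hom_on_diff[OF UN \<psi>(1)] ring_hom_on_mult[OF UN \<psi>(1)]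
      subring_1[OF H] subring_diff[OF H] subring_mult[OF H]
    by (intro is_subringI) auto
  ultimately have \<psi>_H: "\<psi> z \<in> ?H" for z
    using hull_minimal[of "K0 \<union> S" "{z. \<psi> z \<in> ?H}" is_subring] S(2) by auto
  obtain w where w: "w \<in> ?T" "w \<noteq> 0" and ext2:
    "\<And>\<phi> :: ('k poly fract) alg_closure \<Rightarrow> 'k. ring_hom_on ?T \<phi> \<Longrightarrow> \<phi> w \<noteq> 0 \<Longrightarrow>
      (\<exists>\<psi>. ring_hom_on ?H \<psi> \<and> (\<forall>r\<in>?T. \<psi> r = \<phi> r) \<and> \<psi> 1 \<noteq> 0)"
    using extend_ring_hom_fg[OF T finite_imageI[OF S(1)], of 1 \<psi>, where 'b = 'k] subring_1[OF H] by auto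
  obtain W where W: "w = \<tau> W" "W \<noteq> 0"
    using w \<tau>_hom(2) by auto
  \<comment> \<open>A point where \<open>W\<close> does not vanish: evaluation at \<open>m\<close>
    then does not kill \<open>w\<close>, the condition for extending it to
    \<open>?H\<close>.\<close>
  obtain m where m: "poly W m \<noteq> 0"
    by (rule alg_closed_nonroot[OF W(2)])
  define \<chi>0 where "\<chi>0 z = poly (inv_into UNIV \<tau> z) m" for z
  have \<chi>0: "\<chi>0 (\<tau> p) = poly p m" for p
    by (simp add: \<chi>0_def inv_\<tau>)
  have "ring_hom_on ?T \<chi>0"
    unfolding ring_hom_on_def using \<chi>0[of 1] by (auto simp: \<chi>0 \<tau>_hom(1) simp flip: \<tau>_hom(3,4))
  moreover have "\<chi>0 w \<noteq> 0"
    using m by (simp add: W \<chi>0)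
  ultimately obtain \<chi> where \<chi>: "ring_hom_on ?H \<chi>" "\<And>r. r \<in> ?T \<Longrightarrow> \<chi> r = \<chi>0 r"
    using ext2 by blast
  have "ring_hom_on UNIV (\<lambda>z. \<chi> (\<psi> z))"
    unfolding ring_hom_on_def
    using ring_hom_on_1[OF UN \<psi>(1)] ring_hom_on_add[OF UN \<psi>(1)] ring_hom_on_mult[OF UN \<psi>(1)]
      ring_hom_on_1[OF H \<chi>(1)] ring_hom_on_add[OF H \<chi>(1)] ring_hom_on_mult[OF H \<chi>(1)] \<psi>_H
    by auto
  then have P2: "prime_ideal {z. \<chi> (\<psi> z) = 0}"
    by (rule prime_ideal_kernel)
  have P1: "prime_ideal {z. \<psi> z = 0}"
    by (rule prime_ideal_kernel[OF \<psi>(1)])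
  have "\<psi> (x - ev y [:l:]) = 0"
    using ring_hom_on_diff[OF UN \<psi>(1), of x "ev y [:l:]"] unfolding \<psi>_ev \<psi>_x by simp
  moreover have "x - ev y [:l:] \<noteq> 0"
  proof
    assume "x - ev y [:l:] = 0"
    then have "x \<in> ?R1"
      by (auto simp: adjoin_K0 simp del: ev_hom)
    then have "[:- x, 1:] \<in> polys_over ?R1"
      by (auto simp: polys_over_def coeff_pCons intro: subring_closed[OF R1] split: nat.split)
    then show False
      using x unfolding alg_elem_def by (auto dest: bspec[of _ _ "[:- x, 1:]"])
  qed
  moreover have "\<psi> 0 = 0"
    using ring_hom_on_0[OF UN \<psi>(1)] .
  ultimately have lt1: "{0} \<subset> {z. \<psi> z = 0}"
    by blast
  let ?z = "ev y [:- m, 1:]"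
  have "\<chi> 0 = 0"
    using ring_hom_on_0[OF H \<chi>(1)] .
  moreover have "\<chi> (\<psi> ?z) = 0"
    using \<chi>(2)[of "\<tau> [:- m, 1:]"] \<chi>0[of "[:- m, 1:]"] by (simp add: \<psi>_ev del: ev_hom)
  moreover have "\<psi> ?z \<noteq> 0"
    using \<tau>_inj[of "[:- m, 1:]" 0] by (simp add: \<psi>_ev \<tau>_hom del: ev_hom)
  ultimately have lt2: "{z. \<psi> z = 0} \<subset> {z. \<chi> (\<psi> z) = 0}"
    by auto
  define P where "P i = (if i = 0 then {0} else if i = 1 then {z. \<psi> z = 0} else {z. \<chi> (\<psi> z) = 0})" for i :: nat
  have "prime_chain 2 P"
    unfolding prime_chain_def P_def using prime_ideal_0 P1 P2 lt1 lt2
    by (auto simp: less_Suc_eq numeral_2_eq_2)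
  then show ?thesis by blast
qed

lemma algebraic_if_krull_dim_le_1:
  assumes "finitely_generated UNIV" "krull_dim TYPE('a) \<le> 1" "y \<notin> K0"
  shows "alg_elem (adjoin K0 y) x"
proof (rule ccontr)
  assume "\<not> ?thesis"
  then have "2 \<in> {n. \<exists>P :: nat \<Rightarrow> 'a set. prime_chain n P}"
    using prime_chain_2_if_algebraically_independent assms by blast
  then have "enat 2 \<le> krull_dim TYPE('a)"
    unfolding krull_dim_def by (rule SUP_upper)
  then have "enat 2 \<le> 1"
    using assms(2) by (rule order_trans)
  then show False
    by (simp add: one_enat_def)
qed

end

section \<open>Algebras of transcendence degree at most one\<close>

text \<open>Stated with an index \<open>n\<close> in place of the degree, so that an application
  only bounds the degree and computes one coefficient, which may be any unit of
  \<open>R\<close>.\<close>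

lemma integral_if_unit_coeff:
  fixes p :: "'a::idom poly"
  assumes R: "is_subring R" and p: "p \<in> polys_over R" "poly p a = 0" "degree p \<le> n"
    and u: "coeff p n * u = 1" "u \<in> R"
  shows "integral_elem R a"
proof -
  have "coeff p n \<noteq> 0" using u(1) by auto
  then have "degree p = n"
    using p(3) le_degree[of p n] by simp
  moreover have "u \<noteq> 0" using u(1) by auto
  ultimately have "lead_coeff (smult u p) = 1"
    using u(1) by (simp add: mult.commute)
  moreover have "smult u p \<in> polys_over R"
    using u(2) p(1) by (intro polys_over_smult[OF R])
  ultimately show ?thesis
    unfolding integral_elem_def using p(2) by (intro bexI[of _ "smult u p"]) auto
qed

text \<open>With \<open>c\<close> the leading coefficient and \<open>n\<close> the degree of a
  relation \<open>p\<close>, the product \<open>c ^ (n - 1) * poly p a\<close> is a monic polynomial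
  in \<open>c * a\<close>.\<close>

lemma integral_multiple_if_algebraic:
  fixes a :: "'a::idom"
  assumes R: "is_subring R" and a: "alg_elem R a"
  obtains c where "c \<in> R" "c \<noteq> 0" "integral_elem R (c * a)"
proof -
  obtain p where p: "p \<in> polys_over R" "p \<noteq> 0" "poly p a = 0"
    using a by (auto simp: alg_elem_def)
  let ?n = "degree p" and ?c = "lead_coeff p"
  have c: "?c \<in> R"
    using p(1) by (rule polys_overD)
  have "?n \<noteq> 0"
    using p(2,3) by (metis degree_eq_zeroE mult_zero_right pCons_0_0 poly_0 poly_pCons add.right_neutral)
  define q where "q = monom 1 ?n + (\<Sum>i<?n. monom (coeff p i * ?c ^ (?n - 1 - i)) i)"
  note P = is_subring_polys_over[OF R]
  have "q \<in> polys_over R"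
    unfolding q_def
    by (intro subring_add[OF P] subring_sum[OF P] polys_over_monom[OF R] subring_mult[OF R] subring_1[OF R]
        subring_power[OF R] c polys_overD[OF p(1)])
  moreover have "poly q (?c * a) = ?c ^ (?n - 1) * poly p a"
  proof -
    have "poly q (?c * a) = (?c * a) ^ ?n + (\<Sum>i<?n. coeff p i * ?c ^ (?n - 1 - i) * (?c * a) ^ i)"
      by (simp add: q_def poly_monom poly_sum)
    also have "(?c * a) ^ ?n = ?c ^ (?n - 1) * (?c * a ^ ?n)"
      using \<open>?n \<noteq> 0\<close> by (cases ?n) (auto simp: power_mult_distrib)
    also have "(\<Sum>i<?n. coeff p i * ?c ^ (?n - 1 - i) * (?c * a) ^ i) = (\<Sum>i<?n. ?c ^ (?n - 1) * (coeff p i * a ^ i))"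
    proof (intro sum.cong refl)
      fix i assume "i \<in> {..<?n}"
      then have "?n - 1 = (?n - 1 - i) + i" by auto
      then have "?c ^ (?n - 1) = ?c ^ (?n - 1 - i) * ?c ^ i"
        by (metis power_add)
      then show "coeff p i * ?c ^ (?n - 1 - i) * (?c * a) ^ i = ?c ^ (?n - 1) * (coeff p i * a ^ i)"
        by (simp add: power_mult_distrib)
    qed
    finally show ?thesis
      by (simp add: poly_altdef lessThan_Suc_atMost[symmetric] sum_distrib_left distrib_left)
  qed
  moreover have "degree q \<le> ?n"
    unfolding q_def by (intro degree_add_le degree_sum_le) (auto intro: degree_monom_le order.trans[OF degree_monom_le])
  moreover have "coeff q ?n * 1 = 1"
    by (simp add: q_def coeff_sum)
  ultimately have "integral_elem R (?c * a)"
    using p(3) subring_1[OF R] by (intro integral_if_unit_coeff[OF R]) auto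
  then show thesis
    using that c p(2) by simp
qed

text \<open>The elements that some power of \<open>d\<close> moves into \<open>I\<close> form a
  subring, so it suffices to test the generators.\<close>

lemma power_multiple_in_subring:
  fixes d :: "'a::comm_ring_1"
  assumes I: "is_subring I" "K \<subseteq> I" and S: "is_subring hull (K \<union> S) = UNIV"
    and d: "d \<in> I" "\<And>s. s \<in> S \<Longrightarrow> d * s \<in> I"
  shows "\<exists>k. d ^ k * a \<in> I"
proof -
  have "is_subring {a. \<exists>k. d ^ k * a \<in> I}"
  proof (rule is_subringI)
    show "1 \<in> {a. \<exists>k. d ^ k * a \<in> I}"
      using subring_1[OF I(1)] by (auto intro!: exI[of _ 0])
  next
    fix x y assume "x \<in> {a. \<exists>k. d ^ k * a \<in> I}" "y \<in> {a. \<exists>k. d ^ k * a \<in> I}"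
    then obtain k l where kl: "d ^ k * x \<in> I" "d ^ l * y \<in> I"
      by auto
    have "d ^ l * (d ^ k * x) - d ^ k * (d ^ l * y) \<in> I"
      by (intro subring_diff[OF I(1)] subring_mult[OF I(1) subring_power[OF I(1) d(1)]] kl)
    then show "x - y \<in> {a. \<exists>k. d ^ k * a \<in> I}"
      by (auto simp: algebra_simps power_add intro!: exI[of _ "k + l"])
    have "(d ^ k * x) * (d ^ l * y) \<in> I"
      by (rule subring_mult[OF I(1) kl])
    then show "x * y \<in> {a. \<exists>k. d ^ k * a \<in> I}"
      by (auto simp: algebra_simps power_add intro!: exI[of _ "k + l"])
  qed
  moreover have "K \<union> S \<subseteq> {a. \<exists>k. d ^ k * a \<in> I}"
  proof
    fix x assume "x \<in> K \<union> S"
    then have "d ^ 0 * x \<in> I \<or> d ^ 1 * x \<in> I"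
      using d(2) I(2) by auto
    then show "x \<in> {a. \<exists>k. d ^ k * a \<in> I}"
      by blast
  qed
  ultimately show ?thesis
    using hull_minimal[of "K \<union> S" "{a. \<exists>k. d ^ k * a \<in> I}" is_subring] S by auto
qed

context acf_algebra
begin

lemma is_subring_adjoin_K0: "is_subring (adjoin K0 y)"
  by (rule is_subring_adjoin[OF is_subring_K0])

lemma emb_in_adjoin: "emb c \<in> adjoin K0 y"
  using subset_adjoin[OF is_subring_K0] by blast

lemma gen_in_adjoin: "y \<in> adjoin K0 y"
  by (rule generator_in_adjoin[OF is_subring_K0])

lemma ev_in_adjoin: "ev y p \<in> adjoin K0 y"
  by (simp add: adjoin_K0 del: ev_hom)

end

text \<open>The second assumption bounds the transcendence degree by one and takes the place of the
  Krull dimension from here on.\<close>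

locale curve_algebra = acf_algebra scale
  for scale :: "'k::{alg_closed_field, field_char_0} \<Rightarrow> 'a::idom \<Rightarrow> 'a" (infixr \<open>*s\<close> 75) +
  assumes fg: "finitely_generated UNIV"
    and algebraic: "y \<notin> K0 \<Longrightarrow> alg_elem (adjoin K0 y) x"
begin

lemma integral_over_adjoin_trans:
  assumes "integral_elem (adjoin K0 x) y" "integral_elem (adjoin K0 y) b"
  shows "integral_elem (adjoin K0 x) b"
  by (rule integral_closure_trans[OF is_subring_adjoin_K0 _ assms(2)])
    (rule integral_adjoin[OF is_subring_adjoin_K0 subset_adjoin[OF is_subring_K0] assms(1)])

lemma transcendental_if_integral:
  assumes "x \<notin> K0" "integral_elem (adjoin K0 y) x"
  shows "y \<notin> K0"
proof
  assume "y \<in> K0"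
  then have "adjoin K0 y \<subseteq> K0"
    by (intro adjoin_minimal is_subring_K0) auto
  with assms show False
    using integral_elem_mono integral_K0_iff by blast
qed

lemma common_denominator:
  assumes y: "y \<notin> K0" and "finite S"
  shows "\<exists>q. q \<noteq> 0 \<and> (\<forall>s\<in>S. integral_elem (adjoin K0 y) (ev y q * s))"
  using \<open>finite S\<close>
proof induction
  case empty
  then show ?case by (auto intro: exI[of _ 1])
next
  case (insert s S)
  note I = is_subring_integral_closure[OF is_subring_adjoin_K0, of y]
  obtain q where q: "q \<noteq> 0" "\<forall>s\<in>S. integral_elem (adjoin K0 y) (ev y q * s)"
    using insert.IH by blast
  obtain c where c: "c \<in> adjoin K0 y" "c \<noteq> 0" "integral_elem (adjoin K0 y) (c * s)"
    by (rule integral_multiple_if_algebraic[OF is_subring_adjoin_K0 algebraic[OF y, of s]])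
  obtain r where r: "c = ev y r"
    using c(1) by (auto simp: adjoin_K0)
  have mult: "integral_elem (adjoin K0 y) (ev y p * x)" if "integral_elem (adjoin K0 y) x" for p x
    using subring_mult[OF I, of "ev y p" x] integral_elem_base[OF is_subring_adjoin_K0 ev_in_adjoin] that by simp
  have "integral_elem (adjoin K0 y) (ev y (q * r) * t)" if t: "t \<in> insert s S" for t
  proof (cases "t = s")
    case True
    then show ?thesis
      using mult[OF c(3), of q] r by (simp add: mult.assoc)
  next
    case False
    then have "integral_elem (adjoin K0 y) (ev y r * (ev y q * t))"
      using mult q(2) t by blast
    then show ?thesis
      by (simp add: ac_simps)
  qed
  moreover have "q * r \<noteq> 0"
    using q(1) c(2) r by auto
  ultimately show ?case by blast
qed

lemma integral_over_adjoin_poly: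
  assumes "degree q > 0" "x = ev x0 q"
  shows "integral_elem (adjoin K0 x) x0"
proof (rule integral_if_unit_coeff[OF is_subring_adjoin_K0])
  let ?p = "map_poly emb q - [:x:]"
  note P = is_subring_polys_over[OF is_subring_adjoin_K0[of x]]
  have "map_poly emb q \<in> polys_over (adjoin K0 x)"
    by (auto simp: polys_over_def coeff_map_poly emb_in_adjoin)
  then show "?p \<in> polys_over (adjoin K0 x)"
    using polys_over_const[OF is_subring_adjoin_K0 gen_in_adjoin] by (intro subring_diff[OF P])
  show "poly ?p x0 = 0"
    using assms(2) by (simp add: ev_def)
  show "degree ?p \<le> degree q"
    by (intro degree_diff_le) auto
  have "coeff ?p (degree q) = emb (lead_coeff q)"
    using assms(1) by (simp add: coeff_map_poly coeff_pCons split: nat.split)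
  moreover have "lead_coeff q \<noteq> 0"
    using assms(1) by auto
  ultimately show "coeff ?p (degree q) * emb (inverse (lead_coeff q)) = 1"
    using emb_inverse by simp
  show "emb (inverse (lead_coeff q)) \<in> adjoin K0 x"
    by (rule emb_in_adjoin)
qed

text \<open>A common denominator of the algebra generators over \<open>K[x0]\<close> is built into
  \<open>x\<close>; powers of \<open>x\<close> then clear the denominators of every element.\<close>

lemma generically_integral:
  assumes x0: "x0 \<notin> K0"
  obtains x where "x \<in> adjoin K0 x0" "x \<notin> K0" "\<And>a. \<exists>k. integral_elem (adjoin K0 x) (x ^ k * a)"
proof -
  obtain S where S: "finite S" "is_subring hull (K0 \<union> S) = UNIV"
    using fg unfolding finitely_generated_def is_subalgebra_hull_eq by blast
  obtain q where q: "q \<noteq> 0" "\<And>s. s \<in> S \<Longrightarrow> integral_elem (adjoin K0 x0) (ev x0 q * s)"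
    using common_denominator[OF x0 S(1)] by blast
  \<comment> \<open>The factor \<open>[:0, 1:]\<close> makes the degree positive even for constant
    \<open>q\<close>. Therefore \<open>x0\<close> is integral over \<open>K[x]\<close>, and
    \<open>x\<close> is not a constant.\<close>
  define x where "x = ev x0 ([:0, 1:] * q)"
  have deg: "degree ([:0, 1:] * q) > 0"
    using q(1) by (subst degree_mult_eq) auto
  have x0_int: "integral_elem (adjoin K0 x) x0"
    by (rule integral_over_adjoin_poly[OF deg x_def])
  note I = is_subring_integral_closure[OF is_subring_adjoin_K0, of x0]
  show thesis
  proof (rule that)
    show "x \<in> adjoin K0 x0"
      unfolding x_def by (rule ev_in_adjoin)
    show "x \<notin> K0"
      by (rule transcendental_if_integral[OF x0 x0_int])
    fix a
    have "\<exists>k. x ^ k * a \<in> {a. integral_elem (adjoin K0 x) a}"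
    proof (rule power_multiple_in_subring[OF is_subring_integral_closure[OF is_subring_adjoin_K0] _ S(2)])
      show "K0 \<subseteq> {a. integral_elem (adjoin K0 x) a}" "x \<in> {a. integral_elem (adjoin K0 x) a}"
        using integral_elem_base[OF is_subring_adjoin_K0] emb_in_adjoin gen_in_adjoin by auto
    next
      fix s assume s: "s \<in> S"
      have "integral_elem (adjoin K0 x0) (x0 * (ev x0 q * s))"
        using subring_mult[OF I, of x0 "ev x0 q * s"] q(2)[OF s]
          integral_elem_base[OF is_subring_adjoin_K0 gen_in_adjoin] by simp
      then show "x * s \<in> {a. integral_elem (adjoin K0 x) a}"
        using integral_over_adjoin_trans[OF x0_int] by (simp add: x_def mult.assoc)
    qed
    then show "\<exists>k. integral_elem (adjoin K0 x) (x ^ k * a)"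
      by simp
  qed
qed

text \<open>The substitution behind Noether normalization: with \<open>b = y' - y ^ N\<close> and
  \<open>N\<close> large, the equation of \<open>b\<close> over \<open>K[y]\<close> becomes an
  equation of \<open>y\<close> over \<open>K[y']\<close> whose leading coefficient is a nonzero
  constant.\<close>

lemma common_integral_base:
  assumes y: "y \<notin> K0"
  obtains N where "integral_elem (adjoin K0 (b + y ^ N)) y" "integral_elem (adjoin K0 (b + y ^ N)) b"
proof -
  obtain p where p: "p \<in> polys_over (adjoin K0 y)" "p \<noteq> 0" "poly p b = 0"
    using algebraic[OF y, of b] by (auto simp: alg_elem_def)
  have "\<forall>j. \<exists>c. coeff p j = ev y c"
    using polys_overD[OF p(1)] by (auto simp: adjoin_K0 simp del: ev_hom)
  then obtain c where c: "\<And>j. coeff p j = ev y (c j)"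
    by metis
  let ?n = "degree p"
  have cn: "c ?n \<noteq> 0"
    using c[of ?n] p(2) by auto
  \<comment> \<open>As \<open>N\<close> exceeds every \<open>degree (c j)\<close>, the term with
    index \<open>j < ?n\<close> has degree below \<open>N * (j + 1)\<close>, so only the term with
    \<open>j = ?n\<close> reaches the degree \<open>?D\<close>.\<close>
  define N where "N = Suc (\<Sum>j\<le>?n. degree (c j))"
  have N: "degree (c j) < N" if "j \<le> ?n" for j
    unfolding N_def less_Suc_eq_le using that by (intro member_le_sum) auto
  define y' where "y' = b + y ^ N"
  define L where "L = [:y':] - monom 1 N"
  have degL: "degree L = N" "lead_coeff L = - 1"
  proof -
    have "degree (- monom (1::'a) N + [:y':]) = degree (- monom (1::'a) N)"
      by (rule degree_add_eq_left) (simp add: degree_monom_eq N_def)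
    then show "degree L = N"
      by (simp add: L_def degree_monom_eq)
    then show "lead_coeff L = - 1"
      by (simp add: L_def N_def)
  qed
  define F where "F = (\<Sum>j\<le>?n. map_poly emb (c j) * L ^ j)"
  let ?D = "degree (c ?n) + N * ?n"
  have "L \<noteq> 0" using degL by auto
  have top: "degree (map_poly emb (c ?n) * L ^ ?n) = ?D"
    using cn \<open>L \<noteq> 0\<close> degL(1) by (subst degree_mult_eq) (auto simp: degree_power_eq)
  have low: "degree (map_poly emb (c j) * L ^ j) < ?D" if "j < ?n" for j
  proof -
    have "degree (map_poly emb (c j) * L ^ j) \<le> degree (c j) + N * j"
      using degree_mult_le[of "map_poly emb (c j)" "L ^ j"] degree_power_le[of L j] degL(1) by (simp add: mult.commute)
    also have "\<dots> < N + N * j"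
      using N[of j] that by simp
    also have "\<dots> \<le> N * ?n"
      using that by (metis Suc_leI mult_Suc_right mult_le_mono2)
    finally show ?thesis by simp
  qed
  have y_int: "integral_elem (adjoin K0 y') y"
  proof (rule integral_if_unit_coeff[OF is_subring_adjoin_K0])
    note P = is_subring_polys_over[OF is_subring_adjoin_K0[of y']]
    have "map_poly emb r \<in> polys_over (adjoin K0 y')" for r
      by (auto simp: polys_over_def coeff_map_poly emb_in_adjoin)
    moreover have "L \<in> polys_over (adjoin K0 y')"
      unfolding L_def
      by (intro subring_diff[OF P] polys_over_const polys_over_monom is_subring_adjoin_K0 gen_in_adjoin
          subring_1[OF is_subring_adjoin_K0])
    ultimately show "F \<in> polys_over (adjoin K0 y')"
      unfolding F_def by (intro subring_sum[OF P] subring_mult[OF P] subring_power[OF P])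
    have "poly F y = (\<Sum>j\<le>?n. ev y (c j) * b ^ j)"
      by (simp add: F_def poly_sum ev_def L_def y'_def poly_monom)
    also have "\<dots> = 0"
      using p(3) by (simp add: poly_altdef c)
    finally show "poly F y = 0" .
    have F_split: "F = (\<Sum>j<?n. map_poly emb (c j) * L ^ j) + map_poly emb (c ?n) * L ^ ?n"
      by (simp add: F_def lessThan_Suc_atMost[symmetric])
    have "degree (map_poly emb (c j) * L ^ j) \<le> ?D" if "j < ?n" for j
      using low[OF that] by simp
    then show "degree F \<le> ?D"
      unfolding F_split using top by (intro degree_add_le degree_sum_le) auto
    have "coeff F ?D = coeff (map_poly emb (c ?n) * L ^ ?n) ?D"
      unfolding F_split using low by (simp add: coeff_sum coeff_eq_0)
    also have "\<dots> = emb (lead_coeff (c ?n)) * (- 1) ^ ?n"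
      using degL(2) by (simp add: top[symmetric] lead_coeff_mult lead_coeff_power)
    finally have "coeff F ?D * (emb (inverse (lead_coeff (c ?n))) * (- 1) ^ ?n)
      = emb (lead_coeff (c ?n)) * emb (inverse (lead_coeff (c ?n))) * ((- 1) ^ ?n * (- 1) ^ ?n)"
      by (simp only: ac_simps)
    then show "coeff F ?D * (emb (inverse (lead_coeff (c ?n))) * (- 1) ^ ?n) = 1"
      using emb_inverse[of "lead_coeff (c ?n)"] cn by (simp flip: power_mult_distrib)
    show "emb (inverse (lead_coeff (c ?n))) * (- 1) ^ ?n \<in> adjoin K0 y'"
      by (intro subring_mult[OF is_subring_adjoin_K0] subring_power[OF is_subring_adjoin_K0] emb_in_adjoin
          subring_uminus[OF is_subring_adjoin_K0] subring_1[OF is_subring_adjoin_K0])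
  qed
  note I = is_subring_integral_closure[OF is_subring_adjoin_K0, of y']
  have "integral_elem (adjoin K0 y') (y' - y ^ N)"
    using subring_diff[OF I, of y' "y ^ N"] subring_power[OF I, of y N] y_int
      integral_elem_base[OF is_subring_adjoin_K0 gen_in_adjoin] by simp
  then have "integral_elem (adjoin K0 y') b"
    by (simp add: y'_def)
  then show thesis
    using that[of N] y_int by (simp add: y'_def)
qed

end

section \<open>Counting dimensions\<close>

context acf_algebra
begin

abbreviation times_set :: "'a \<Rightarrow> 'a set \<Rightarrow> 'a set" (infixr \<open>*t\<close> 70) where
  "z *t A \<equiv> (\<lambda>x. z * x) ` A"

lemma scale_mult_right: "z * (c *s x) = c *s (z * x)"
  by (simp add: scale_eq mult.left_commute)

lemma subspace_times: "subspace N \<Longrightarrow> subspace (z *t N)"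
  unfolding subspace_def
  by (auto simp flip: distrib_left scale_mult_right)

lemma span_times: "span (z *t X) = z *t span X"
proof
  show "span (z *t X) \<subseteq> z *t span X"
    by (rule span_minimal) (auto intro: span_base subspace_times)
  have "span X \<subseteq> {v. z * v \<in> span (z *t X)}"
    by (rule span_minimal)
      (auto simp: subspace_def distrib_left scale_mult_right intro: span_base span_zero span_add span_scale)
  then show "z *t span X \<subseteq> span (z *t X)"
    by auto
qed

lemma independent_times:
  assumes "z \<noteq> 0" "finite X" "independent X"
  shows "independent (z *t X)"
proof (rule independent_if_scalars_zero)
  have inj: "inj_on (\<lambda>x. z * x) X"
    using assms(1) by (auto simp: inj_on_def)
  fix f v assume eq: "(\<Sum>v\<in>z *t X. f v *s v) = 0" and v: "v \<in> z *t X"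
  have "z * (\<Sum>x\<in>X. f (z * x) *s x) = 0"
    using eq by (simp add: sum.reindex[OF inj] sum_distrib_left scale_mult_right)
  then have "(\<Sum>x\<in>X. f (z * x) *s x) = 0"
    using assms(1) by simp
  then show "f v = 0"
    using independentD[OF assms(3,2) subset_refl, of "\<lambda>x. f (z * x)"] v by auto
qed (use assms in auto)

lemma independent_union:
  assumes X: "finite X" "independent X" and Y: "finite Y" "independent Y"
    and disj: "\<And>v. v \<in> span X \<Longrightarrow> v \<in> span Y \<Longrightarrow> v = 0"
  shows "independent (X \<union> Y)" "X \<inter> Y = {}"
proof -
  show XY: "X \<inter> Y = {}"
    using disj X(2) dependent_zero span_base by blast
  show "independent (X \<union> Y)"
  proof (rule independent_if_scalars_zero)
    fix f v assume eq: "(\<Sum>v\<in>X \<union> Y. f v *s v) = 0" and v: "v \<in> X \<union> Y"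
    have e: "(\<Sum>v\<in>X. f v *s v) + (\<Sum>v\<in>Y. f v *s v) = 0"
      using eq sum.union_disjoint[OF X(1) Y(1) XY, of "\<lambda>v. f v *s v"] by simp
    have sX: "(\<Sum>v\<in>X. f v *s v) \<in> span X" and sY: "(\<Sum>v\<in>Y. f v *s v) \<in> span Y"
      by (auto intro!: span_sum intro: span_scale span_base)
    have "(\<Sum>v\<in>X. f v *s v) = - (\<Sum>v\<in>Y. f v *s v)"
      using e by (simp add: eq_neg_iff_add_eq_0)
    then have X0: "(\<Sum>v\<in>X. f v *s v) = 0"
      using disj[OF sX] span_neg[OF sY] by simp
    then have "(\<Sum>v\<in>Y. f v *s v) = 0"
      using e by simp
    then show "f v = 0"
      using v independentD[OF X(2,1) subset_refl X0] independentD[OF Y(2,1) subset_refl] by auto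
  qed (use X Y in auto)
qed

text \<open>Independence is a property of sets, so a family also needs injectivity: two equal
  members would give the relation \<open>v x - v x' = 0\<close>.\<close>

lemma independent_family:
  assumes I: "finite I" and v: "\<And>c i. (\<Sum>i\<in>I. c i *s v i) = 0 \<Longrightarrow> i \<in> I \<Longrightarrow> c i = 0"
  shows "inj_on v I" "independent (v ` I)"
proof -
  show inj: "inj_on v I"
  proof (rule inj_onI, rule ccontr)
    fix x x' assume x: "x \<in> I" "x' \<in> I" "v x = v x'" "x \<noteq> x'"
    let ?c = "\<lambda>i. (if i = x then 1 else 0) - (if i = x' then 1 else 0) :: 'k"
    have "(\<Sum>i\<in>I. ?c i *s v i) = (\<Sum>i\<in>I. if i = x then v i else 0) - (\<Sum>i\<in>I. if i = x' then v i else 0)"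
      unfolding sum_subtractf[symmetric] by (intro sum.cong) (auto simp: scale_left_diff_distrib)
    also have "\<dots> = 0"
      using x I by simp
    finally have "?c x = 0"
      using v[of ?c x] x(1) by blast
    with x(4) show False by simp
  qed
  show "independent (v ` I)"
  proof (rule independent_if_scalars_zero)
    fix f w assume "(\<Sum>w\<in>v ` I. f w *s w) = 0" and w: "w \<in> v ` I"
    then have "(\<Sum>i\<in>I. f (v i) *s v i) = 0"
      by (simp add: sum.reindex[OF inj])
    then show "f w = 0"
      using v[of "\<lambda>i. f (v i)"] w by auto
  qed (use I in auto)
qed

text \<open>Each \<open>x\<close> is replaced by a representative in \<open>span T\<close>; a linear
  relation among the representatives is one among the \<open>x\<close> modulo \<open>N\<close>,
  hence trivial.\<close>

lemma card_independent_mod_le: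
  assumes X: "finite X" "independent X" "\<And>v. v \<in> span X \<Longrightarrow> v \<in> N \<Longrightarrow> v = 0"
    and N: "subspace N" and T: "finite T" "\<And>x. x \<in> X \<Longrightarrow> \<exists>t\<in>span T. x - t \<in> N"
  shows "card X \<le> card T"
proof -
  obtain g where g: "\<And>x. x \<in> X \<Longrightarrow> g x \<in> span T" "\<And>x. x \<in> X \<Longrightarrow> x - g x \<in> N"
    using T(2) by metis
  have zero: "c x = 0" if c: "(\<Sum>x\<in>X. c x *s g x) = 0" and x: "x \<in> X" for c x
  proof -
    have "(\<Sum>x\<in>X. c x *s x) = (\<Sum>x\<in>X. c x *s (x - g x))"
      using c by (simp add: scale_right_diff_distrib sum_subtractf)
    also have "\<dots> \<in> N"
      using N g(2) by (intro subspace_sum subspace_scale) auto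
    finally have "(\<Sum>x\<in>X. c x *s x) = 0"
      by (intro X(3)) (auto intro!: span_sum intro: span_scale span_base)
    then show ?thesis
      using independentD[OF X(2,1) subset_refl] x by blast
  qed
  have family: "inj_on g X" "independent (g ` X)"
    using independent_family[OF X(1), of g] zero by blast+
  have "g ` X \<subseteq> span T"
    using g by auto
  then have "card (g ` X) \<le> card T"
    using independent_span_bound[OF T(1) family(2)] by blast
  then show ?thesis
    by (simp add: card_image[OF family(1)])
qed

text \<open>An element of \<open>W\<close> not congruent to anything in \<open>span X\<close> could
  be added to \<open>X\<close>, so a largest \<open>X\<close> represents a basis of \<open>W\<close>
  modulo \<open>N\<close>.\<close>

lemma maximal_independent_mod:
  assumes W: "subspace W" and N: "subspace N"
    and bound: "\<And>X. finite X \<Longrightarrow> X \<subseteq> W \<Longrightarrow> independent X \<Longrightarrow> (\<And>v. v \<in> span X \<Longrightarrow> v \<in> N \<Longrightarrow> v = 0) \<Longrightarrow> card X \<le> n"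
  obtains X where "finite X" "X \<subseteq> W" "independent X" "\<And>v. v \<in> span X \<Longrightarrow> v \<in> N \<Longrightarrow> v = 0"
    "card X \<le> n" "\<And>w. w \<in> W \<Longrightarrow> \<exists>t\<in>span X. w - t \<in> N"
proof -
  let ?P = "\<lambda>X. finite X \<and> X \<subseteq> W \<and> independent X \<and> (\<forall>v\<in>span X. v \<in> N \<longrightarrow> v = 0)"
  have P0: "?P {}"
    by (simp add: independent_empty)
  have bd: "card X \<le> n" if "?P X" for X
    using that by (intro bound) auto
  then have "\<forall>X. ?P X \<longrightarrow> card X < Suc n"
    by (simp add: less_Suc_eq_le)
  then obtain X where X: "?P X" and max: "\<And>Y. ?P Y \<Longrightarrow> card Y \<le> card X"
    using ex_has_greatest_nat[of ?P "{}" card "Suc n"] P0 by auto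
  have "\<exists>t\<in>span X. w - t \<in> N" if w: "w \<in> W" for w
  proof (rule ccontr)
    assume no: "\<not> ?thesis"
    have "w \<notin> span X"
      using no subspace_0[OF N] by (metis diff_self)
    then have "w \<notin> X"
      using span_base by blast
    have "?P (insert w X)"
    proof (intro conjI ballI impI)
      show "independent (insert w X)"
        using X \<open>w \<notin> span X\<close> by (intro independent_insertI) auto
    next
      fix v assume v: "v \<in> span (insert w X)" "v \<in> N"
      then obtain k where k: "v - k *s w \<in> span X"
        by (auto simp: span_breakdown_eq)
      have "k = 0"
      proof (rule ccontr)
        assume "k \<noteq> 0"
        define t where "t = - (inverse k *s (v - k *s w))"
        have "t \<in> span X"
          unfolding t_def using k by (intro span_neg span_scale)
        moreover have "w - t = inverse k *s v"
          using \<open>k \<noteq> 0\<close> by (simp add: t_def scale_right_diff_distrib)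
        ultimately show False
          using no subspace_scale[OF N v(2)] by metis
      qed
      then show "v = 0"
        using k v(2) X by auto
    qed (use X w in auto)
    from max[OF this] show False
      using X \<open>w \<notin> X\<close> by simp
  qed
  then show thesis
    using X bd by (intro that[of X]) auto
qed

text \<open>A relation modulo \<open>N\<close> would express some \<open>t0\<close> by the rest of
  \<open>T\<close>, and then fewer than \<open>card X\<close> elements would span \<open>X\<close>
  modulo \<open>N\<close>.\<close>

lemma spanning_independent_mod:
  assumes T: "finite T" "independent T" and N: "subspace N"
    and X: "finite X" "independent X" "\<And>v. v \<in> span X \<Longrightarrow> v \<in> N \<Longrightarrow> v = 0" "card T \<le> card X"
    and span: "\<And>x. x \<in> X \<union> T \<Longrightarrow> \<exists>t\<in>span T. x - t \<in> N"
    and v: "v \<in> span T" "v \<in> N"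
  shows "v = 0"
proof (rule ccontr)
  assume "v \<noteq> 0"
  obtain c where c: "v = (\<Sum>t\<in>T. c t *s t)"
    using v(1) span_finite[OF T(1)] by auto
  have "\<exists>t0\<in>T. c t0 \<noteq> 0"
  proof (rule ccontr)
    assume "\<not> ?thesis"
    then have "v = 0"
      unfolding c by (intro sum.neutral) auto
    with \<open>v \<noteq> 0\<close> show False ..
  qed
  then obtain t0 where t0: "t0 \<in> T" "c t0 \<noteq> 0"
    by blast
  let ?T = "T - {t0}"
  define w where "w = - (\<Sum>t\<in>?T. (inverse (c t0) * c t) *s t)"
  have w: "w \<in> span ?T"
    unfolding w_def by (intro span_neg span_sum span_scale span_base)
  have "inverse (c t0) *s v = t0 - w"
    using t0 by (simp add: c w_def sum.remove[OF T(1) t0(1)] scale_right_distrib scale_sum_right)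
  then have t0w: "t0 - w \<in> N"
    using subspace_scale[OF N v(2), of "inverse (c t0)"] by simp
  have "card X \<le> card ?T"
  proof (rule card_independent_mod_le[OF X(1-3) N])
    fix x assume "x \<in> X"
    then obtain t where t: "t \<in> span T" "x - t \<in> N"
      using span by blast
    obtain k where k: "t - k *s t0 \<in> span ?T"
      using t(1) t0(1) span_breakdown by blast
    have "(t - k *s t0) + k *s w \<in> span ?T"
      using k w by (intro span_add span_scale)
    moreover have "x - ((t - k *s t0) + k *s w) = (x - t) + k *s (t0 - w)"
      by (simp add: scale_right_diff_distrib)
    moreover have "(x - t) + k *s (t0 - w) \<in> N"
      using t(2) t0w N by (intro subspace_add subspace_scale)
    ultimately show "\<exists>t\<in>span ?T. x - t \<in> N"
      by metis
  qed (use T(1) in auto)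
  also have "\<dots> < card T"
    using T(1) t0(1) by (intro psubset_card_mono) auto
  finally show False
    using X(4) by simp
qed

text \<open>The Krull-Akizuki inequality \<open>dim (W / zW) \<le> dim (U / zU)\<close>: filter both quotients by powers
  of \<open>z\<close>. A bounded shift \<open>z ^ e\<close> does not change the growth rate.\<close>

lemma card_independent_mod_times_le:
  assumes U: "subspace U" "U \<subseteq> W" "z *t U \<subseteq> U" and W: "subspace W" "z *t W \<subseteq> W" and z: "z \<noteq> 0"
    and T: "finite T" "\<And>u. u \<in> U \<Longrightarrow> \<exists>t\<in>span T. \<exists>u'\<in>U. u = t + z * u'"
    and X: "finite X" "independent X" "X \<subseteq> W" "\<And>v. v \<in> span X \<Longrightarrow> v \<in> z *t W \<Longrightarrow> v = 0"
    and e: "\<And>x. x \<in> X \<Longrightarrow> z ^ e * x \<in> U"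
  shows "card X \<le> card T"
proof -
  \<comment> \<open>\<open>Y J\<close> collects \<open>X, z X, ..., z ^ (J - 1) X\<close> and stays
    independent modulo \<open>z ^ J W\<close>; \<open>V M\<close> is built from \<open>T\<close> in
    the same way and spans \<open>U\<close> modulo \<open>z ^ M U\<close>.\<close>
  define Y where "Y = rec_nat {} (\<lambda>_ A. X \<union> z *t A)"
  define V where "V = rec_nat {} (\<lambda>_ A. T \<union> z *t A)"
  have Y_simps: "Y 0 = {}" "Y (Suc J) = X \<union> z *t Y J" for J
    by (simp_all add: Y_def)
  have V_simps: "V 0 = {}" "V (Suc J) = T \<union> z *t V J" for J
    by (simp_all add: V_def)
  have spanW: "span A \<subseteq> W" if "A \<subseteq> W" for A
    using span_minimal[OF that W(1)] .
  have Y: "finite (Y J) \<and> independent (Y J) \<and> card (Y J) = J * card X \<and> Y J \<subseteq> W \<and>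
      (\<forall>x\<in>Y J. z ^ e * x \<in> U) \<and> (\<forall>v\<in>span (Y J). v \<in> z ^ J *t W \<longrightarrow> v = 0)" for J
  proof (induction J)
    case 0
    then show ?case
      by (simp add: Y_simps independent_empty)
  next
    case (Suc J)
    have inj: "inj_on (\<lambda>x. z * x) (Y J)"
      using z by (auto simp: inj_on_def)
    have spanYW: "span (Y J) \<subseteq> W"
      using Suc by (intro spanW) auto
    have disj: "v = 0" if "v \<in> span X" "v \<in> span (z *t Y J)" for v
      using X(4)[OF that(1)] that(2) spanYW unfolding span_times by auto
    have fin: "finite (z *t Y J)"
      using Suc by simp
    have ind: "independent (z *t Y J)"
      using Suc by (intro independent_times z) auto
    note un = independent_union[OF X(1,2) fin ind disj]
    have "card (Y (Suc J)) = Suc J * card X"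
      using un(2) Suc X(1) fin by (simp add: Y_simps card_Un_disjoint card_image[OF inj])
    moreover have "Y (Suc J) \<subseteq> W"
      using Suc X(3) W(2) by (auto simp: Y_simps)
    moreover have "z ^ e * x \<in> U" if "x \<in> Y (Suc J)" for x
    proof -
      have "z ^ e * (z * x') \<in> U" if "x' \<in> Y J" for x'
      proof -
        have "z * (z ^ e * x') \<in> U"
          using Suc that U(3) by blast
        then show ?thesis by (simp add: mult.left_commute)
      qed
      then show ?thesis
        using that e by (auto simp: Y_simps)
    qed
    moreover have "v = 0" if v: "v \<in> span (Y (Suc J))" "v \<in> z ^ Suc J *t W" for v
    proof -
      obtain a b where ab: "v = a + z * b" "a \<in> span X" "b \<in> span (Y J)"
        using v(1) unfolding Y_simps span_Un span_times by auto
      obtain w where w: "v = z ^ Suc J * w" "w \<in> W"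
        using v(2) by auto
      have "z ^ k * w \<in> W" for k
        using w(2) W(2) by (induction k) (auto simp: mult.assoc)
      then have "z ^ J * w - b \<in> W"
        using ab(3) spanYW W(1) by (auto intro: subspace_diff)
      moreover have "a = z * (z ^ J * w - b)"
        using ab(1) w(1) by (simp add: algebra_simps)
      ultimately have "a = 0"
        using X(4)[OF ab(2)] by auto
      then have "z * (z ^ J * w - b) = 0"
        using \<open>a = z * (z ^ J * w - b)\<close> by simp
      then have "b = z ^ J * w"
        using z by simp
      then have "b = 0"
        using Suc ab(3) w(2) by blast
      then show "v = 0"
        using ab \<open>a = 0\<close> by simp
    qed
    ultimately show ?case
      using un(1) X(1) fin by (simp add: Y_simps)
  qed
  have V: "finite (V M) \<and> card (V M) \<le> M * card T \<and> (\<forall>u\<in>U. \<exists>t\<in>span (V M). \<exists>u'\<in>U. u = t + z ^ M * u')" for M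
  proof (induction M)
    case 0
    then show ?case
      by (auto simp: V_simps)
  next
    case (Suc M)
    have "card (V (Suc M)) \<le> card T + card (z *t V M)"
      unfolding V_simps by (rule card_Un_le)
    also have "\<dots> \<le> card T + card (V M)"
      using Suc by (intro add_left_mono card_image_le) auto
    finally have "card (V (Suc M)) \<le> Suc M * card T"
      using Suc by simp
    moreover have "\<exists>t\<in>span (V (Suc M)). \<exists>u'\<in>U. u = t + z ^ Suc M * u'" if u: "u \<in> U" for u
    proof -
      obtain t u' where 1: "t \<in> span T" "u' \<in> U" "u = t + z * u'"
        using T(2)[OF u] by blast
      obtain t' u'' where 2: "t' \<in> span (V M)" "u'' \<in> U" "u' = t' + z ^ M * u''"
        using Suc 1(2) by blast
      have "t + z * t' \<in> span (V (Suc M))"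
        unfolding V_simps span_Un span_times using 1 2 by auto
      moreover have "u = (t + z * t') + z ^ Suc M * u''"
        using 1 2 by (simp add: algebra_simps)
      ultimately show ?thesis
        using 2(2) by blast
    qed
    ultimately show ?case
      using Suc T(1) by (simp add: V_simps)
  qed
  \<comment> \<open>Multiplication by \<open>z ^ e\<close> moves \<open>Y J\<close> into
    \<open>U\<close>, where it is independent modulo \<open>z ^ (e + J) W\<close> and
    \<open>V (e + J)\<close> spans it modulo the same subspace.\<close>
  have "J * card X \<le> (e + J) * card T" for J
  proof -
    let ?Y = "z ^ e *t Y J"
    have inj: "inj_on (\<lambda>x. z ^ e * x) (Y J)"
      using z by (auto simp: inj_on_def)
    have ze: "z ^ e \<noteq> 0" using z by simp
    have "card ?Y \<le> card (V (e + J))"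
    proof (rule card_independent_mod_le[where N = "z ^ (e + J) *t W"])
      show "finite ?Y" "independent ?Y"
        using Y[of J] independent_times[OF ze] by auto
      show "subspace (z ^ (e + J) *t W)"
        by (rule subspace_times[OF W(1)])
      show "finite (V (e + J))"
        using V by blast
    next
      fix v assume v: "v \<in> span ?Y" "v \<in> z ^ (e + J) *t W"
      then obtain b w where "b \<in> span (Y J)" "w \<in> W" "v = z ^ e * b" "z ^ e * b = z ^ e * (z ^ J * w)"
        unfolding span_times by (auto simp: power_add mult.assoc)
      moreover from this have "b = z ^ J * w"
        using mult_left_cancel[OF ze] by metis
      ultimately show "v = 0"
        using Y[of J] by auto
    next
      fix x assume "x \<in> ?Y"
      then have "x \<in> U"
        using Y[of J] by auto
      then obtain t u' where "t \<in> span (V (e + J))" "u' \<in> U" "x = t + z ^ (e + J) * u'"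
        using V[of "e + J"] by blast
      then show "\<exists>t\<in>span (V (e + J)). x - t \<in> z ^ (e + J) *t W"
        using U(2) by (intro bexI[of _ t]) auto
    qed
    then show ?thesis
      using Y[of J] V[of "e + J"] by (simp add: card_image[OF inj])
  qed
  \<comment> \<open>If \<open>card X\<close> exceeded \<open>card T\<close>, the inequality would
    give \<open>J \<le> e * card T\<close>; this is the first \<open>J\<close> that violates
    it.\<close>
  from this[of "Suc (e * card T)"] show ?thesis
  proof (rule contrapos_pp)
    assume "\<not> card X \<le> card T"
    then have "Suc (e * card T) * Suc (card T) \<le> Suc (e * card T) * card X"
      by (intro mult_le_mono2) simp
    moreover have "(e + Suc (e * card T)) * card T < Suc (e * card T) * Suc (card T)"
      by (simp add: algebra_simps)
    ultimately show "\<not> Suc (e * card T) * card X \<le> (e + Suc (e * card T)) * card T"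
      by linarith
  qed
qed

end

section \<open>Linear independence over a subring\<close>

definition lin_indep :: "'a::comm_ring_1 set \<Rightarrow> 'a set \<Rightarrow> bool" where
  "lin_indep R X \<longleftrightarrow> (\<forall>f. (\<forall>x\<in>X. f x \<in> R) \<longrightarrow> (\<Sum>x\<in>X. f x * x) = 0 \<longrightarrow> (\<forall>x\<in>X. f x = 0))"

lemma lin_indepD:
  "lin_indep R X \<Longrightarrow> (\<And>x. x \<in> X \<Longrightarrow> f x \<in> R) \<Longrightarrow> (\<Sum>x\<in>X. f x * x) = 0 \<Longrightarrow> x \<in> X \<Longrightarrow> f x = 0"
  by (auto simp: lin_indep_def)

lemma lin_indep_times:
  fixes d :: "'a::idom"
  assumes "d \<noteq> 0" "lin_indep R X"
  shows "lin_indep R ((\<lambda>x. d * x) ` X)"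
  unfolding lin_indep_def
proof (intro allI impI ballI)
  have inj: "inj_on (\<lambda>x. d * x) X"
    using assms(1) by (auto simp: inj_on_def)
  fix f w assume f: "\<forall>x\<in>(\<lambda>x. d * x) ` X. f x \<in> R" "(\<Sum>x\<in>(\<lambda>x. d * x) ` X. f x * x) = 0"
    and w: "w \<in> (\<lambda>x. d * x) ` X"
  have "d * (\<Sum>x\<in>X. f (d * x) * x) = 0"
    using f(2) by (simp add: sum.reindex[OF inj] sum_distrib_left mult.left_commute)
  then have "(\<Sum>x\<in>X. f (d * x) * x) = 0"
    using assms(1) by simp
  then show "f w = 0"
    using lin_indepD[OF assms(2), of "\<lambda>x. f (d * x)"] f(1) w by auto
qed

text \<open>Adding \<open>b\<close> to a largest independent \<open>X\<close> creates a relation in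
  which \<open>b\<close> has a nonzero coefficient. So \<open>B\<close> is torsion modulo the free
  module on \<open>X\<close>.\<close>

lemma maximal_lin_indep:
  fixes B :: "'a::idom set"
  assumes R: "is_subring R"
    and bound: "\<And>X. finite X \<Longrightarrow> lin_indep R X \<Longrightarrow> card X \<le> n"
  obtains X where "finite X" "X \<subseteq> B" "lin_indep R X"
    "\<And>b. b \<in> B \<Longrightarrow> \<exists>q\<in>R. q \<noteq> 0 \<and> q * b \<in> rspan R X"
proof -
  let ?P = "\<lambda>X. finite X \<and> X \<subseteq> B \<and> lin_indep R X"
  have P0: "?P {}"
    by (simp add: lin_indep_def)
  have "\<forall>X. ?P X \<longrightarrow> card X < Suc n"
    using bound by (simp add: less_Suc_eq_le)
  then obtain X where X: "?P X" and max: "\<And>Y. ?P Y \<Longrightarrow> card Y \<le> card X"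
    using ex_has_greatest_nat[of ?P "{}" card "Suc n"] P0 by auto
  have "\<exists>q\<in>R. q \<noteq> 0 \<and> q * b \<in> rspan R X" if b: "b \<in> B" for b
  proof (cases "b \<in> X")
    case True
    then show ?thesis
      using subring_1[OF R] rspan_base[of b X R] by (intro bexI[of _ 1]) auto
  next
    case False
    have "\<not> lin_indep R (insert b X)"
      using max[of "insert b X"] X b False by auto
    then obtain f w where f: "\<And>x. x \<in> insert b X \<Longrightarrow> f x \<in> R" "(\<Sum>x\<in>insert b X. f x * x) = 0"
      "w \<in> insert b X" "f w \<noteq> 0"
      unfolding lin_indep_def by auto
    have eq: "f b * b + (\<Sum>x\<in>X. f x * x) = 0"
      using f(2) X False by simp
    have "f b \<noteq> 0"
    proof
      assume "f b = 0"
      then have "(\<Sum>x\<in>X. f x * x) = 0"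
        using eq by simp
      then have "f x = 0" if "x \<in> X" for x
        using X f(1) that by (intro lin_indepD[of R X f]) auto
      then show False
        using f(3,4) \<open>f b = 0\<close> by auto
    qed
    moreover have "f b * b = - (\<Sum>x\<in>X. f x * x)"
      using eq by (simp add: eq_neg_iff_add_eq_0)
    then have "f b * b \<in> rspan R X"
      using f(1) by (auto intro!: rspan_uminus[OF R] rspan_sum intro: rspan_scale rspan_base)
    ultimately show ?thesis
      using f(1) by blast
  qed
  then show thesis
    using X by (intro that[of X]) auto
qed

lemma integral_elem_hom:
  fixes f :: "'a::comm_ring_1 \<Rightarrow> 'b::idom"
  assumes f: "comm_ring_hom f" and R: "is_subring R'" "f ` R \<subseteq> R'" and a: "integral_elem R a"
  shows "integral_elem R' (f a)"
proof -
  interpret f: comm_ring_hom f by (rule f)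
  obtain p where p: "p \<in> polys_over R" "lead_coeff p = 1" "poly p a = 0"
    using a by (auto simp: integral_elem_def)
  show ?thesis
  proof (rule integral_if_unit_coeff[OF R(1)])
    show "map_poly f p \<in> polys_over R'"
      using p(1) R(2) by (auto simp: polys_over_def coeff_map_poly)
    show "poly (map_poly f p) (f a) = 0"
      using p(3) by (simp add: f.poly_map_poly)
    show "degree (map_poly f p) \<le> degree p"
      by (rule degree_map_poly_le)
    show "coeff (map_poly f p) (degree p) * 1 = 1"
      using p(2) by (simp add: coeff_map_poly)
  qed (rule subring_1[OF R(1)])
qed

section \<open>Truncated modules over \<open>K[y]\<close> and poles at infinity\<close>

context acf_algebra
begin

lemma subspace_if_submod:
  assumes "K0 \<subseteq> R" "submod R M"
  shows "subspace M"
proof -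
  have "emb c \<in> R" for c
    using assms(1) by auto
  then show ?thesis
    using assms(2) unfolding subspace_def submod_def by (simp add: scale_eq)
qed

lemma subspace_if_subring: "is_subring B \<Longrightarrow> K0 \<subseteq> B \<Longrightarrow> subspace B"
  by (rule subspace_if_submod[of B]) (auto simp: submod_def subring_0 subring_add subring_mult)

lemma subspace_rspan: "K0 \<subseteq> R \<Longrightarrow> subspace (rspan R S)"
  by (rule subspace_if_submod[OF _ submod_rspan])

lemma rspan_subset_subring:
  assumes "is_subring B" "R \<subseteq> B" "S \<subseteq> B"
  shows "rspan R S \<subseteq> B"
  using assms by (intro rspan_minimal) (auto simp: submod_def subring_0 subring_add subring_mult subset_iff)

text \<open>The span over \<open>K\<close> consists of the combinations of \<open>X\<close> whose
  coefficients in \<open>K[y]\<close> are polynomials of degree below \<open>m\<close>.\<close>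

definition power_multiples :: "'a \<Rightarrow> nat \<Rightarrow> 'a set \<Rightarrow> 'a set" where
  "power_multiples y m X = (\<lambda>(j, x). y ^ j * x) ` ({..<m} \<times> X)"

lemma ev_sum: "ev y (sum f A) = (\<Sum>i\<in>A. ev y (f i))"
  by (induction A rule: infinite_finite_induct) auto

lemma ev_altdef: "degree p < m \<Longrightarrow> ev y p = (\<Sum>j<m. emb (coeff p j) * y ^ j)"
proof -
  assume m: "degree p < m"
  have "ev y p = (\<Sum>j\<le>degree p. emb (coeff p j) * y ^ j)"
    by (simp add: ev_def poly_altdef coeff_map_poly)
  also have "\<dots> = (\<Sum>j<m. emb (coeff p j) * y ^ j)"
    using m by (intro sum.mono_neutral_left) (auto simp: coeff_eq_0)
  finally show ?thesis .
qed

lemma ev_times_in_span: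
  assumes "degree p < m" "x \<in> X"
  shows "ev y p * x \<in> span (power_multiples y m X)"
proof -
  have "ev y p * x = (\<Sum>j<m. coeff p j *s (y ^ j * x))"
    by (simp add: ev_altdef[OF assms(1)] sum_distrib_right scale_eq mult.assoc)
  also have "\<dots> \<in> span (power_multiples y m X)"
    using assms(2) by (intro span_sum span_scale span_base) (auto simp: power_multiples_def)
  finally show ?thesis .
qed

lemma finite_power_multiples: "finite X \<Longrightarrow> finite (power_multiples y m X)"
  by (simp add: power_multiples_def)

lemma card_power_multiples_le: "finite X \<Longrightarrow> card (power_multiples y m X) \<le> m * card X"
  using card_image_le[of "{..<m} \<times> X" "\<lambda>(j, x). y ^ j * x"] by (simp add: power_multiples_def)

lemma independent_power_multiples:
  assumes y: "y \<notin> K0" and X: "finite X" "lin_indep (adjoin K0 y) X"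
  shows "independent (power_multiples y m X)" "card (power_multiples y m X) = m * card X"
proof -
  let ?v = "\<lambda>(j, x). y ^ j * x" and ?I = "{..<m} \<times> X"
  have zero: "c i = 0" if c: "(\<Sum>i\<in>?I. c i *s ?v i) = 0" and i: "i \<in> ?I" for c i
  proof -
    define p where "p x = (\<Sum>j<m. monom (c (j, x)) j)" for x
    have "(\<Sum>x\<in>X. ev y (p x) * x) = (\<Sum>x\<in>X. \<Sum>j<m. c (j, x) *s (y ^ j * x))"
      by (simp add: p_def ev_sum sum_distrib_right scale_eq mult.assoc)
    also have "\<dots> = (\<Sum>i\<in>?I. c i *s ?v i)"
      by (subst sum.swap) (simp add: sum.cartesian_product case_prod_unfold)
    finally have "(\<Sum>x\<in>X. ev y (p x) * x) = 0"
      using c by simp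
    then have "ev y (p (snd i)) = 0"
      using lin_indepD[OF X(2), of "\<lambda>x. ev y (p x)" "snd i"] ev_in_adjoin i by auto
    then have "p (snd i) = 0"
      using ev_eq_0_iff[OF y] by blast
    moreover have "coeff (p (snd i)) (fst i) = c i"
      using i by (auto simp: p_def coeff_sum)
    ultimately show ?thesis by simp
  qed
  have fin: "finite ?I"
    using X(1) by simp
  have family: "inj_on ?v ?I" "independent (?v ` ?I)"
    using independent_family[OF fin, of ?v] zero by blast+
  show "independent (power_multiples y m X)"
    using family(2) by (simp add: power_multiples_def)
  show "card (power_multiples y m X) = m * card X"
    using card_image[OF family(1)] by (simp add: power_multiples_def card_cartesian_product)
qed

lemma rspan_adjoin_finite:
  assumes "finite G"
  shows "rspan (adjoin K0 y) G = {\<Sum>g\<in>G. ev y (p g) * g | p. True}" (is "_ = ?M")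
proof
  show "rspan (adjoin K0 y) G \<subseteq> ?M"
  proof
    fix v assume "v \<in> rspan (adjoin K0 y) G"
    then obtain f where f: "\<And>g. g \<in> G \<Longrightarrow> f g \<in> adjoin K0 y" "v = (\<Sum>g\<in>G. f g * g)"
      unfolding rspan_finite[OF is_subring_adjoin_K0 assms] by auto
    have "\<forall>g\<in>G. \<exists>p. f g = ev y p"
      using f(1) by (auto simp: adjoin_K0 simp del: ev_hom)
    then obtain p where "\<And>g. g \<in> G \<Longrightarrow> f g = ev y (p g)"
      by metis
    then have "v = (\<Sum>g\<in>G. ev y (p g) * g)"
      using f(2) by simp
    then show "v \<in> ?M" by blast
  qed
  show "?M \<subseteq> rspan (adjoin K0 y) G"
    using ev_in_adjoin by (auto intro!: rspan_sum intro: rspan_scale rspan_base)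
qed

text \<open>Each coefficient is divided by \<open>y ^ m\<close> with remainder. Hence the module
  modulo its multiples of \<open>y ^ m\<close> has dimension at most
  \<open>m * card G\<close>.\<close>

lemma rspan_adjoin_decomposition:
  assumes "finite G" "u \<in> rspan (adjoin K0 y) G"
  shows "\<exists>t\<in>span (power_multiples y m G). \<exists>u'\<in>rspan (adjoin K0 y) G. u = t + y ^ m * u'"
proof -
  obtain p where p: "u = (\<Sum>g\<in>G. ev y (p g) * g)"
    using assms by (auto simp: rspan_adjoin_finite)
  let ?q = "monom (1::'k) m"
  define t where "t = (\<Sum>g\<in>G. ev y (p g mod ?q) * g)"
  define u' where "u' = (\<Sum>g\<in>G. ev y (p g div ?q) * g)"
  have "ev y (p g) * g = ev y (p g mod ?q) * g + y ^ m * (ev y (p g div ?q) * g)" for g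
  proof -
    have "ev y (p g) = ev y (p g div ?q * ?q + p g mod ?q)"
      by (simp only: div_mult_mod_eq)
    then show ?thesis
      unfolding ev_hom by (simp add: algebra_simps)
  qed
  then have "u = t + y ^ m * u'"
    unfolding p t_def u'_def by (simp add: sum.distrib sum_distrib_left)
  moreover have "u' \<in> rspan (adjoin K0 y) G"
    unfolding u'_def using ev_in_adjoin by (auto intro!: rspan_sum intro: rspan_scale rspan_base)
  moreover have "t \<in> span (power_multiples y m G)"
    unfolding t_def
  proof (intro span_sum)
    fix g assume g: "g \<in> G"
    show "ev y (p g mod ?q) * g \<in> span (power_multiples y m G)"
    proof (cases "m = 0")
      case True
      then have "?q = 1"
        by (simp add: monom_eq_1)
      then show ?thesis
        by (simp add: span_zero)
    next
      case False
      have "degree (p g mod ?q) < m"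
        using degree_mod_less[of ?q "p g"] False by (auto simp: degree_monom_eq)
      then show ?thesis
        using g by (rule ev_times_in_span)
    qed
  qed
  ultimately show ?thesis by blast
qed

text \<open>The fraction field as an algebra over the same constants: it contains
  \<open>1 / y\<close>, and the facts about adjoined elements apply there.\<close>

definition fract_scale :: "'k \<Rightarrow> 'a fract \<Rightarrow> 'a fract" where
  "fract_scale c v = to_fract (emb c) * v"

interpretation fr: acf_algebra fract_scale
  by unfold_locales (simp_all add: fract_scale_def emb.hom_add emb.hom_mult distrib_left distrib_right mult.assoc)

lemma fr_emb: "fr.emb c = to_fract (emb c)"
  by (simp add: fr.emb_def fract_scale_def)

lemma to_fract_hom: "comm_ring_hom to_fract"
  by unfold_locales auto

lemma to_fract_adjoin: "to_fract ` adjoin K0 y \<subseteq> adjoin fr.K0 (to_fract y)"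
proof -
  note A = fr.is_subring_adjoin_K0[of "to_fract y"]
  have "is_subring {z. to_fract z \<in> adjoin fr.K0 (to_fract y)}"
    by (rule is_subringI) (auto intro: subring_closed[OF A])
  moreover have "K0 \<subseteq> {z. to_fract z \<in> adjoin fr.K0 (to_fract y)}"
    unfolding image_subset_iff mem_Collect_eq fr_emb[symmetric] using fr.emb_in_adjoin by blast
  moreover have "y \<in> {z. to_fract z \<in> adjoin fr.K0 (to_fract y)}"
    using fr.gen_in_adjoin by simp
  ultimately have "adjoin K0 y \<subseteq> {z. to_fract z \<in> adjoin fr.K0 (to_fract y)}"
    by (rule adjoin_minimal)
  then show ?thesis by auto
qed

text \<open>The elements whose pole order at the places above \<open>y = \<infinity>\<close> is at most \<open>h\<close> times that of \<open>y\<close>.\<close>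

definition pole_bounded :: "'a \<Rightarrow> nat \<Rightarrow> 'a set" where
  "pole_bounded y h = {b. integral_elem (adjoin fr.K0 (1 / to_fract y)) (to_fract b / to_fract y ^ h)}"

context
  fixes y assumes y: "y \<notin> K0"
begin

abbreviation "Y \<equiv> to_fract y"
abbreviation "Ainf \<equiv> adjoin fr.K0 (1 / Y)"

lemma Y_nonzero: "Y \<noteq> 0"
proof
  assume "Y = 0"
  then have "y = emb 0" by simp
  then show False using y by blast
qed

lemma is_subring_integral_infinity: "is_subring {b. integral_elem Ainf b}"
  by (rule is_subring_integral_closure[OF fr.is_subring_adjoin_K0])

lemma inverse_Y_integral: "integral_elem Ainf (1 / Y)"
  by (rule integral_elem_base[OF fr.is_subring_adjoin_K0 fr.gen_in_adjoin])

lemma subspace_pole_bounded: "subspace (pole_bounded y h)"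
proof -
  note I = is_subring_integral_infinity
  show ?thesis
    unfolding subspace_def
  proof (intro conjI allI ballI)
    show "0 \<in> pole_bounded y h"
      using subring_0[OF I] by (simp add: pole_bounded_def)
  next
    fix a b assume "a \<in> pole_bounded y h" "b \<in> pole_bounded y h"
    then show "a + b \<in> pole_bounded y h"
      using subring_add[OF I] by (simp add: pole_bounded_def add_divide_distrib)
  next
    fix c a assume "a \<in> pole_bounded y h"
    moreover have "integral_elem Ainf (fr.emb c)"
      by (rule integral_elem_base[OF fr.is_subring_adjoin_K0 fr.emb_in_adjoin])
    ultimately have "integral_elem Ainf (fr.emb c * (to_fract a / Y ^ h))"
      using subring_mult[OF I, of "fr.emb c" "to_fract a / Y ^ h"]
      by (simp add: pole_bounded_def del: times_divide_eq_right)
    then show "c *s a \<in> pole_bounded y h"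
      by (simp add: pole_bounded_def scale_eq fr_emb)
  qed
qed

lemma power_times_pole_bounded:
  assumes "b \<in> pole_bounded y s" "j + s \<le> h"
  shows "y ^ j * b \<in> pole_bounded y h"
proof -
  note I = is_subring_integral_infinity
  have "(1 / Y) ^ (h - (j + s)) * (to_fract b / Y ^ s) \<in> {b. integral_elem Ainf b}"
    using assms(1) inverse_Y_integral by (intro subring_mult[OF I] subring_power[OF I]) (auto simp: pole_bounded_def)
  moreover have "(1 / Y) ^ (h - (j + s)) * (to_fract b / Y ^ s) = to_fract (y ^ j * b) / Y ^ h"
  proof -
    have "Y ^ h = Y ^ (h - (j + s)) * (Y ^ j * Y ^ s)"
      using assms(2) by (simp flip: power_add)
    moreover have "to_fract (y ^ j) = Y ^ j"
      by (induction j) auto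
    ultimately show ?thesis
      using Y_nonzero by (simp add: field_simps)
  qed
  ultimately show ?thesis
    by (simp add: pole_bounded_def)
qed

text \<open>With \<open>n\<close> the degree of the equation of \<open>b\<close>, division by
  \<open>Y ^ (h * n)\<close> gives one of \<open>b / Y ^ h\<close> whose coefficient of index
  \<open>j\<close> is the old one divided by \<open>Y ^ (h * (n - j))\<close>. Once \<open>h\<close>
  bounds the degrees of the old coefficients, the new ones are polynomials in
  \<open>1 / Y\<close>.\<close>

lemma ex_pole_bounded:
  assumes "integral_elem (adjoin K0 y) b"
  shows "\<exists>h. b \<in> pole_bounded y h"
proof -
  note I = fr.is_subring_adjoin_K0[of "1 / Y"] and P = is_subring_polys_over[OF fr.is_subring_adjoin_K0[of "1 / Y"]]
  obtain p where p: "p \<in> polys_over (adjoin K0 y)" "lead_coeff p = 1" "poly p b = 0"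
    using assms by (auto simp: integral_elem_def)
  let ?n = "degree p"
  have "\<forall>j. \<exists>c. coeff p j = ev y c"
    using polys_overD[OF p(1)] by (auto simp: adjoin_K0 simp del: ev_hom)
  then obtain c where c: "\<And>j. coeff p j = ev y (c j)"
    by metis
  define h where "h = (\<Sum>j<?n. degree (c j))"
  have h: "degree (c j) \<le> h * (?n - j)" if "j < ?n" for j
  proof -
    have "degree (c j) \<le> h"
      unfolding h_def using that by (intro member_le_sum) auto
    also have "h * 1 \<le> h * (?n - j)"
      using that by (intro mult_le_mono2) simp
    finally show ?thesis by simp
  qed
  have in_A: "to_fract (ev y r) / Y ^ m \<in> Ainf" if "degree r \<le> m" for r m
  proof -
    have pow: "to_fract (y ^ k) = Y ^ k" for k
      by (induction k) auto
    have "ev y r = (\<Sum>k<Suc m. emb (coeff r k) * y ^ k)"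
      using that by (intro ev_altdef) simp
    then have "to_fract (ev y r) / Y ^ m = (\<Sum>k<Suc m. to_fract (emb (coeff r k)) * (Y ^ k / Y ^ m))"
      by (simp only: to_fract_sum to_fract_mult pow sum_divide_distrib times_divide_eq_right)
    also have "\<dots> = (\<Sum>k<Suc m. fr.emb (coeff r k) * (1 / Y) ^ (m - k))"
    proof (intro sum.cong refl)
      fix k assume "k \<in> {..<Suc m}"
      then have "Y ^ m = Y ^ k * Y ^ (m - k)"
        by (simp flip: power_add)
      then have "Y ^ k / Y ^ m = (1 / Y) ^ (m - k)"
        using Y_nonzero by (simp add: power_one_over)
      then show "to_fract (emb (coeff r k)) * (Y ^ k / Y ^ m) = fr.emb (coeff r k) * (1 / Y) ^ (m - k)"
        by (simp add: fr_emb)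
    qed
    also have "\<dots> \<in> Ainf"
      by (intro subring_sum[OF I] subring_mult[OF I] subring_power[OF I] fr.emb_in_adjoin fr.gen_in_adjoin)
    finally show ?thesis .
  qed
  let ?b = "to_fract b / Y ^ h"
  define q where "q = monom 1 ?n + (\<Sum>j<?n. monom (to_fract (coeff p j) / Y ^ (h * (?n - j))) j)"
  have "integral_elem Ainf ?b"
  proof (rule integral_if_unit_coeff[OF I])
    show "q \<in> polys_over Ainf"
      unfolding q_def
      using in_A h by (intro subring_add[OF P] subring_sum[OF P] polys_over_monom[OF I] subring_1[OF I]) (auto simp: c)
    show "degree q \<le> ?n"
      unfolding q_def by (intro degree_add_le degree_sum_le) (auto intro: degree_monom_le order.trans[OF degree_monom_le])
    show "coeff q ?n * 1 = 1"
      by (simp add: q_def coeff_sum)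
    show "1 \<in> Ainf"
      by (rule subring_1[OF I])
    have pow: "to_fract (b ^ k) = to_fract b ^ k" for k
      by (induction k) auto
    have "poly q ?b = ?b ^ ?n + (\<Sum>j<?n. to_fract (coeff p j) / Y ^ (h * (?n - j)) * ?b ^ j)"
      by (simp add: q_def poly_monom poly_sum)
    also have "(\<Sum>j<?n. to_fract (coeff p j) / Y ^ (h * (?n - j)) * ?b ^ j)
      = (\<Sum>j<?n. to_fract (coeff p j * b ^ j) / Y ^ (h * ?n))"
    proof (intro sum.cong refl)
      fix j assume "j \<in> {..<?n}"
      then have "h * ?n = h * (?n - j) + h * j"
        by (simp flip: distrib_left)
      then have "Y ^ (h * ?n) = Y ^ (h * (?n - j)) * (Y ^ h) ^ j"
        by (simp add: power_add power_mult)
      then show "to_fract (coeff p j) / Y ^ (h * (?n - j)) * ?b ^ j = to_fract (coeff p j * b ^ j) / Y ^ (h * ?n)"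
        using Y_nonzero by (simp add: pow power_divide)
    qed
    also have "?b ^ ?n = to_fract (b ^ ?n) / Y ^ (h * ?n)"
      by (simp add: pow power_divide power_mult)
    also have "to_fract (b ^ ?n) / Y ^ (h * ?n) + (\<Sum>j<?n. to_fract (coeff p j * b ^ j) / Y ^ (h * ?n))
      = to_fract (b ^ ?n + (\<Sum>j<?n. coeff p j * b ^ j)) / Y ^ (h * ?n)"
      by (simp only: to_fract_add to_fract_sum add_divide_distrib sum_divide_distrib)
    also have "b ^ ?n + (\<Sum>j<?n. coeff p j * b ^ j) = 0"
      using monic_root_power[OF p(2,3)] by simp
    finally show "poly q ?b = 0" by simp
  qed
  then show ?thesis
    by (auto simp: pole_bounded_def)
qed

text \<open>An element without poles at finite places that vanishes at all places above \<open>y = \<infinity>\<close> is zero.\<close>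

lemma pole_bounded_multiple_eq_0:
  assumes b: "integral_elem (adjoin K0 y) b" and pb: "y ^ Suc h * b \<in> pole_bounded y h"
  shows "b = 0"
proof (rule ccontr)
  assume "b \<noteq> 0"
  note I = is_subring_integral_infinity
  have pow: "to_fract (y ^ k) = Y ^ k" for k
    by (induction k) auto
  \<comment> \<open>The exponent \<open>Suc h\<close> leaves a factor \<open>Y\<close>: even
    \<open>Y * b\<close> is integral at infinity, which expresses that \<open>b\<close> vanishes
    there.\<close>
  have "to_fract (y ^ Suc h * b) / Y ^ h = Y * to_fract b"
    using Y_nonzero by (simp only: to_fract_mult pow) simp
  then have Yb: "integral_elem Ainf (Y * to_fract b)"
    using pb by (simp add: pole_bounded_def)
  have "1 / Y * (Y * to_fract b) \<in> {b. integral_elem Ainf b}"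
    by (rule subring_mult[OF I]) (use Yb inverse_Y_integral in blast)+
  then have "integral_elem Ainf (to_fract b)"
    using Y_nonzero by simp
  moreover have "integral_elem (adjoin fr.K0 Y) (to_fract b)"
    by (rule integral_elem_hom[OF to_fract_hom fr.is_subring_adjoin_K0 to_fract_adjoin b])
  \<comment> \<open>Integrality over \<open>K[Y]\<close> and over \<open>K[1/Y]\<close> makes
    \<open>b\<close> a constant. If it were nonzero, \<open>Y\<close> itself would be integral at
    infinity and, by the same argument, a constant.\<close>
  ultimately have "integral_elem fr.K0 (to_fract b)"
    using integral_adjoin_inverse[OF fr.is_subring_K0 Y_nonzero] by blast
  then obtain c where c: "to_fract b = fr.emb c"
    using fr.integral_K0_iff by blast
  have "c \<noteq> 0"
    using c \<open>b \<noteq> 0\<close> by (auto simp: fr_emb)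
  have "fr.emb (inverse c) * (Y * to_fract b) \<in> {b. integral_elem Ainf b}"
    by (rule subring_mult[OF I])
      (use Yb integral_elem_base[OF fr.is_subring_adjoin_K0 fr.emb_in_adjoin] in blast)+
  moreover have "fr.emb (inverse c) * (Y * to_fract b) = Y"
    using fr.emb_inverse[OF \<open>c \<noteq> 0\<close>] by (simp only: c ac_simps) simp
  ultimately have "integral_elem Ainf Y"
    by simp
  then have "integral_elem fr.K0 Y"
    using integral_adjoin_inverse[OF fr.is_subring_K0 Y_nonzero]
      integral_elem_base[OF fr.is_subring_adjoin_K0 fr.gen_in_adjoin] by blast
  then obtain d where "Y = fr.emb d"
    using fr.integral_K0_iff by blast
  then have "y = emb d"
    by (simp add: fr_emb)
  then show False
    using y by blast
qed

end

end

text \<open>Up to a nonzero constant \<open>p\<close> is \<open>1 - g'\<close> with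
  \<open>g'\<close> divisible by \<open>X\<close>, and a finite geometric series inverts it modulo
  \<open>X ^ m\<close>.\<close>

lemma coprime_to_power_of_X:
  fixes p :: "'a::field poly"
  assumes "poly p 0 \<noteq> 0"
  obtains a b where "a * p + monom 1 m * b = 1"
proof -
  let ?c = "poly p 0"
  obtain g where g: "p = [:?c:] + [:0, 1:] * g"
    by (cases p) auto
  define g' where "g' = smult (- inverse ?c) ([:0, 1:] * g)"
  have 1: "smult (inverse ?c) p = 1 - g'"
    using assms by (subst g) (simp add: g'_def smult_add_right one_pCons)
  have "1 - g' ^ m = (1 - g') * (\<Sum>i<m. g' ^ i)"
    by (rule one_diff_power_eq)
  moreover have "g' ^ m = monom 1 m * (smult (- inverse ?c) g) ^ m"
  proof -
    have "g' = monom 1 1 * smult (- inverse ?c) g"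
      by (simp add: g'_def monom_altdef)
    then show ?thesis
      by (simp only: power_mult_distrib monom_power) simp
  qed
  moreover have "smult (inverse ?c) (\<Sum>i<m. g' ^ i) * p = (1 - g') * (\<Sum>i<m. g' ^ i)"
    unfolding 1[symmetric] by (simp add: mult.commute)
  ultimately have "smult (inverse ?c) (\<Sum>i<m. g' ^ i) * p + monom 1 m * (smult (- inverse ?c) g) ^ m = 1"
    by (metis diff_add_cancel)
  then show thesis
    by (rule that)
qed

section \<open>Finiteness over \<open>K[y]\<close> of integral subalgebras\<close>

context curve_algebra
begin

text \<open>One finite module, generated by \<open>G\<close>, absorbs every element after
  multiplication by a power of \<open>d\<close>, so \<open>card G\<close> bounds the rank. The bound
  is read off from the growth in \<open>J\<close> of the number of products \<open>y ^ j * x\<close>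
  with \<open>j < J\<close>.\<close>

lemma card_lin_indep_bounded:
  assumes y: "y \<notin> K0"
  shows "\<exists>n. \<forall>X. finite X \<longrightarrow> lin_indep (adjoin K0 y) X \<longrightarrow> card X \<le> n"
proof -
  let ?R = "adjoin K0 y"
  note R = is_subring_adjoin_K0[of y]
  obtain S where S: "finite S" "is_subring hull (K0 \<union> S) = UNIV"
    using fg unfolding finitely_generated_def is_subalgebra_hull_eq by blast
  obtain q where q: "q \<noteq> 0" "\<And>s. s \<in> S \<Longrightarrow> integral_elem ?R (ev y q * s)"
    using common_denominator[OF y S(1)] by blast
  define d where "d = ev y q"
  have d: "d \<noteq> 0" "d \<in> ?R"
    using q(1) ev_eq_0_iff[OF y] ev_in_adjoin by (auto simp: d_def simp del: ev_hom)
  obtain G where G: "finite G" "1 \<in> rspan ?R G" "(\<lambda>s. d * s) ` S \<subseteq> stab (rspan ?R G)"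
    by (rule common_stab[OF R, of "(\<lambda>s. d * s) ` S"]) (use S(1) q(2) d_def in auto)
  \<comment> \<open>Some \<open>d ^ k * a\<close> is a multiplier of the module; applied to 1 it
    lands in the module itself.\<close>
  have denom: "\<exists>k. d ^ k * a \<in> rspan ?R G" for a
  proof -
    have "\<exists>k. d ^ k * a \<in> stab (rspan ?R G)"
    proof (rule power_multiple_in_subring[OF is_subring_stab[OF submod_rspan R] _ S(2)])
      show "K0 \<subseteq> stab (rspan ?R G)" "d \<in> stab (rspan ?R G)"
        using subset_stab[of ?R G] emb_in_adjoin d(2) by auto
    qed (use G(3) in auto)
    then show ?thesis
      using G(2) by (fastforce simp: stab_def)
  qed
  show ?thesis
  proof (intro exI allI impI)
    fix X assume X: "finite X" "lin_indep ?R X"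
    obtain k where k: "\<And>x. d ^ k x * x \<in> rspan ?R G"
      using denom by metis
    define K where "K = (\<Sum>x\<in>X. k x)"
    have dK: "d ^ K * x \<in> rspan ?R G" if "x \<in> X" for x
    proof -
      have "k x \<le> K"
        unfolding K_def using that X(1) by (intro member_le_sum) auto
      then have "d ^ K * x = d ^ (K - k x) * (d ^ k x * x)"
        by (simp flip: power_add mult.assoc)
      also have "\<dots> \<in> rspan ?R G"
        by (intro rspan_scale subring_power[OF R] d(2) k)
      finally show ?thesis .
    qed
    define X' where "X' = (\<lambda>x. d ^ K * x) ` X"
    have inj: "inj_on (\<lambda>x. d ^ K * x) X"
      using d(1) by (auto simp: inj_on_def)
    have X': "finite X'" "lin_indep ?R X'" "card X' = card X"
      unfolding X'_def using X d(1) card_image[OF inj] by (auto intro: lin_indep_times)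
    have "\<forall>x\<in>X'. \<exists>p. x = (\<Sum>g\<in>G. ev y (p g) * g)"
      using dK by (auto simp: X'_def rspan_adjoin_finite[OF G(1)])
    then obtain p where p: "\<And>x. x \<in> X' \<Longrightarrow> x = (\<Sum>g\<in>G. ev y (p x g) * g)"
      by metis
    \<comment> \<open>\<open>D\<close> exceeds the degrees of all coefficients, so passing from
      \<open>X'\<close> to \<open>G\<close> costs only the constant \<open>D\<close>, which growing
      \<open>J\<close> makes negligible.\<close>
    define D where "D = Suc (\<Sum>x\<in>X'. \<Sum>g\<in>G. degree (p x g))"
    have D: "degree (p x g) < D" if "x \<in> X'" "g \<in> G" for x g
    proof -
      have "degree (p x g) \<le> (\<Sum>g\<in>G. degree (p x g))"
        using that G(1) by (intro member_le_sum) auto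
      also have "\<dots> \<le> (\<Sum>x\<in>X'. \<Sum>g\<in>G. degree (p x g))"
        using that X'(1) by (intro member_le_sum[of x X' "\<lambda>x. \<Sum>g\<in>G. degree (p x g)"]) auto
      finally show ?thesis
        by (simp add: D_def)
    qed
    have le: "J * card X \<le> (J + D) * card G" for J
    proof -
      have "power_multiples y J X' \<subseteq> span (power_multiples y (J + D) G)"
      proof
        fix v assume "v \<in> power_multiples y J X'"
        then obtain j x where jx: "j < J" "x \<in> X'" "v = y ^ j * x"
          by (auto simp: power_multiples_def)
        have "v = y ^ j * (\<Sum>g\<in>G. ev y (p x g) * g)"
          using p[OF jx(2)] jx(3) by metis
        also have "\<dots> = (\<Sum>g\<in>G. ev y (monom 1 j * p x g) * g)"
          by (simp add: sum_distrib_left mult.assoc)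
        also have "\<dots> \<in> span (power_multiples y (J + D) G)"
        proof (intro span_sum ev_times_in_span)
          fix g assume "g \<in> G"
          then show "degree (monom 1 j * p x g) < J + D"
            using D[OF jx(2)] jx(1) degree_mult_le[of "monom 1 j" "p x g"] degree_monom_le[of "1::'k" j]
            by fastforce
        qed
        finally show "v \<in> span (power_multiples y (J + D) G)" .
      qed
      then have "card (power_multiples y J X') \<le> card (power_multiples y (J + D) G)"
        using independent_span_bound[OF finite_power_multiples[OF G(1)] independent_power_multiples(1)[OF y X'(1,2)]]
        by blast
      also have "\<dots> \<le> (J + D) * card G"
        by (rule card_power_multiples_le[OF G(1)])
      finally show ?thesis
        by (simp add: independent_power_multiples(2)[OF y X'(1,2)] X'(3))
    qed
    show "card X \<le> card G"
    proof (rule ccontr)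
      assume "\<not> card X \<le> card G"
      then have "Suc (D * card G) * Suc (card G) \<le> Suc (D * card G) * card X"
        by (intro mult_le_mono2) simp
      also have "\<dots> \<le> (Suc (D * card G) + D) * card G"
        by (rule le)
      finally show False
        by (simp add: algebra_simps)
    qed
  qed
qed

text \<open>Let \<open>r\<close> be the rank and \<open>F\<close> the free module on a maximal independent set \<open>X\<close>. If \<open>Z\<close> is
  independent modulo \<open>F\<close>, then \<open>Z\<close> and the products \<open>y ^ j * x\<close> with \<open>j \<le> h - s\<close> have poles of order
  at most \<open>h\<close>, so \<open>card Z + r * (h - s + 1) \<le> r * (h + 1)\<close>, a bound on \<open>Z\<close> that is independent of \<open>h\<close>.\<close>

lemma finite_over_adjoin_if_integral:
  assumes B: "is_subring B" "K0 \<subseteq> B" "y \<in> B" and y: "y \<notin> K0"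
    and int: "\<And>b. b \<in> B \<Longrightarrow> integral_elem (adjoin K0 y) b"
  obtains G where "finite G" "G \<subseteq> B" "B = rspan (adjoin K0 y) G"
proof -
  let ?R = "adjoin K0 y"
  note R = is_subring_adjoin_K0[of y]
  have RB: "?R \<subseteq> B"
    by (rule adjoin_minimal[OF B])
  obtain n where n: "\<And>X. finite X \<Longrightarrow> lin_indep ?R X \<Longrightarrow> card X \<le> n"
    using card_lin_indep_bounded[OF y] by blast
  obtain X where X: "finite X" "X \<subseteq> B" "lin_indep ?R X"
    and denom: "\<And>b. b \<in> B \<Longrightarrow> \<exists>q\<in>?R. q \<noteq> 0 \<and> q * b \<in> rspan ?R X"
    by (rule maximal_lin_indep[OF R n, of B]) blast+
  define F where "F = rspan ?R X"
  have FB: "F \<subseteq> B"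
    unfolding F_def by (rule rspan_subset_subring[OF B(1) RB X(2)])
  have F: "subspace F"
    unfolding F_def using emb_in_adjoin by (intro subspace_rspan) blast
  have F_scale: "r * f \<in> F" if "r \<in> ?R" "f \<in> F" for r f
    using that unfolding F_def by (rule rspan_scale)
  have Bsub: "subspace B"
    by (rule subspace_if_subring[OF B(1,2)])
  have ybound: "\<exists>h. \<forall>x\<in>S. x \<in> pole_bounded y h" if "finite S" "S \<subseteq> B" for S
    using that
  proof (induction S)
    case (insert x S)
    then obtain h where h: "\<forall>x\<in>S. x \<in> pole_bounded y h" by auto
    obtain k where k: "x \<in> pole_bounded y k"
      using ex_pole_bounded[OF y int] insert.prems by auto
    have "x \<in> pole_bounded y (h + k)" "\<forall>x\<in>S. x \<in> pole_bounded y (h + k)"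
      using power_times_pole_bounded[OF y k, of 0 "h + k"] power_times_pole_bounded[OF y, of _ h 0 "h + k"] h
      by auto
    then show ?case by blast
  qed auto
  obtain s where s: "\<And>x. x \<in> X \<Longrightarrow> x \<in> pole_bounded y s"
    using ybound[OF X(1,2)] by blast
  have bound: "card Z \<le> card X * s"
    if Z: "finite Z" "Z \<subseteq> B" "independent Z" and ZF: "\<And>v. v \<in> span Z \<Longrightarrow> v \<in> F \<Longrightarrow> v = 0" for Z
  proof -
    obtain h0 where h0: "\<And>x. x \<in> Z \<Longrightarrow> x \<in> pole_bounded y h0"
      using ybound[OF Z(1,2)] by blast
    define h where "h = h0 + s"
    have Zh: "x \<in> pole_bounded y h" if "x \<in> Z" for x
      using power_times_pole_bounded[OF y h0[OF that], of 0 h] by (simp add: h_def)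
    define k where "k = Suc (h - s)"
    let ?P = "power_multiples y k X"
    have PF: "span ?P \<subseteq> F"
      by (rule span_minimal[OF _ F])
        (auto simp: power_multiples_def F_def intro!: rspan_scale[OF subring_power[OF R gen_in_adjoin]] intro: rspan_base)
    note finP = finite_power_multiples[OF X(1), of y k]
      and indP = independent_power_multiples[OF y X(1,3), of k]
    define V where "V = Z \<union> ?P"
    have disj: "v = 0" if "v \<in> span Z" "v \<in> span ?P" for v
      using ZF[OF that(1)] that(2) PF by blast
    have V: "finite V" "independent V" "card V = card Z + k * card X"
      unfolding V_def using independent_union[OF Z(1,3) finP indP(1) disj] Z(1) finP indP(2)
      by (auto simp: card_Un_disjoint)
    have "?P \<subseteq> B"
      using PF FB span_superset[of ?P] by blast
    then have VB: "V \<subseteq> B"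
      using Z(2) by (simp add: V_def)
    have "V \<subseteq> pole_bounded y h"
    proof
      fix v assume "v \<in> V"
      then show "v \<in> pole_bounded y h"
        unfolding V_def
      proof
        assume "v \<in> ?P"
        then obtain j x where jx: "j < k" "x \<in> X" "v = y ^ j * x"
          by (auto simp: power_multiples_def)
        then have "j + s \<le> h"
          by (simp add: k_def h_def)
        then show ?thesis
          unfolding jx(3) by (rule power_times_pole_bounded[OF y s[OF jx(2)]])
      qed (rule Zh)
    qed
    then have spanV: "span V \<subseteq> pole_bounded y h"
      by (rule span_minimal[OF _ subspace_pole_bounded[OF y]])
    have spanVB: "span V \<subseteq> B"
      by (rule span_minimal[OF VB Bsub])
    have "\<exists>q. q \<noteq> 0 \<and> (\<forall>b\<in>Z. ev y q * b \<in> F)"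
      using Z(1,2)
    proof (induction Z)
      case (insert b Z)
      then obtain q where q: "q \<noteq> 0" "\<forall>b\<in>Z. ev y q * b \<in> F" by auto
      obtain c where c: "c \<in> ?R" "c \<noteq> 0" "c * b \<in> F"
        using denom[of b] insert.prems by (auto simp: F_def)
      obtain r where r: "c = ev y r"
        using c(1) by (auto simp: adjoin_K0 simp del: ev_hom)
      have "ev y (q * r) * b' \<in> F" if b': "b' \<in> insert b Z" for b'
      proof (cases "b' = b")
        case True
        then show ?thesis
          using F_scale[OF ev_in_adjoin[of y q] c(3)] r by (simp add: mult.assoc)
      next
        case False
        then have "ev y q * b' \<in> F"
          using q(2) b' by auto
        then have "ev y r * (ev y q * b') \<in> F"
          by (rule F_scale[OF ev_in_adjoin])
        then show ?thesis
          by (simp add: ac_simps)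
      qed
      moreover have "q * r \<noteq> 0"
        using q(1) c(2) r by auto
      ultimately show ?case by blast
    qed (auto intro: exI[of _ 1])
    then obtain q where q: "q \<noteq> 0" "\<And>b. b \<in> Z \<Longrightarrow> ev y q * b \<in> F"
      by blast
    \<comment> \<open>The denominator is split as \<open>q = y ^ e * q1\<close> with
      \<open>q1\<close> nonzero at 0. Then \<open>d1\<close> is invertible modulo powers of
      \<open>y\<close>, so multiplying \<open>V\<close> by it preserves independence there, and
      \<open>y ^ e\<close> is absorbed by the shift in the Krull-Akizuki inequality.\<close>
    obtain q1 where q1: "q = [:- 0, 1:] ^ order 0 q * q1" "\<not> [:- 0, 1:] dvd q1"
      using order_decomp[OF q(1), of 0] by blast
    define e where "e = order 0 q"
    define d1 where "d1 = ev y q1"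
    have q_eq: "ev y q = y ^ e * d1"
      by (subst q1(1)) (simp add: d1_def e_def)
    have q1_0: "poly q1 0 \<noteq> 0"
      using q1(2) by (simp add: poly_eq_0_iff_dvd)
    then have "d1 \<noteq> 0"
      unfolding d1_def using ev_eq_0_iff[OF y, of q1] by auto
    let ?m = "Suc h"
    obtain a b where ab: "a * q1 + monom 1 ?m * b = 1"
      by (rule coprime_to_power_of_X[OF q1_0])
    have ab': "ev y a * d1 + y ^ ?m * ev y b = 1"
      using arg_cong[OF ab, of "ev y"] by (simp only: ev_hom d1_def) simp
    let ?z = "y ^ ?m"
    have "y \<noteq> 0"
    proof
      assume "y = 0"
      then have "y = emb 0" by simp
      then show False using y by blast
    qed
    have zB: "?z \<in> B"
      by (rule subring_power[OF B(1,3)])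
    \<comment> \<open>For \<open>z = y ^ (h + 1)\<close> the dimension of \<open>F / z F\<close> is
      at most \<open>(h + 1) * card X\<close>. \<open>V\<close> is independent modulo
      \<open>z B\<close> because a multiple of \<open>z\<close> in \<open>B\<close> with poles of
      order at most \<open>h\<close> is zero.\<close>
    have "card (d1 *t V) \<le> card (power_multiples y ?m X)"
    proof (rule card_independent_mod_times_le[OF F FB _ Bsub, where z = ?z])
      show "?z *t F \<subseteq> F"
        using F_scale[OF subring_power[OF R gen_in_adjoin]] by blast
      show "?z *t B \<subseteq> B"
        using subring_mult[OF B(1) zB] by blast
      show "?z \<noteq> 0"
        using \<open>y \<noteq> 0\<close> by simp
      show "finite (power_multiples y ?m X)"
        by (rule finite_power_multiples[OF X(1)])
      show "\<exists>t\<in>span (power_multiples y ?m X). \<exists>u'\<in>F. u = t + ?z * u'" if "u \<in> F" for u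
        using rspan_adjoin_decomposition[OF X(1)] that unfolding F_def by blast
      show "finite (d1 *t V)" "independent (d1 *t V)"
        using V independent_times[OF \<open>d1 \<noteq> 0\<close>] by auto
      show "d1 *t V \<subseteq> B"
        using VB RB ev_in_adjoin[of y q1] subring_mult[OF B(1)] by (auto simp: d1_def)
    next
      fix v assume v: "v \<in> span (d1 *t V)" "v \<in> ?z *t B"
      then obtain u w where uw: "u \<in> span V" "w \<in> B" "v = d1 * u" "v = ?z * w"
        by (auto simp: span_times)
      have uB: "u \<in> B"
        using uw(1) spanVB by blast
      \<comment> \<open>The identity \<open>ev y a * d1 + ?z * ev y b = 1\<close> turns
        \<open>d1 * u = ?z * w\<close> into \<open>u = ?z * b'\<close>.\<close>
      define b' where "b' = ev y a * w + ev y b * u"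
      have b'B: "b' \<in> B"
        unfolding b'_def using RB ev_in_adjoin uB uw(2) by (intro subring_add[OF B(1)] subring_mult[OF B(1)]) blast+
      have "u = (ev y a * d1 + ?z * ev y b) * u"
        using ab' by simp
      also have "\<dots> = ev y a * (d1 * u) + ?z * (ev y b * u)"
        by (simp only: distrib_right mult.assoc)
      also have "d1 * u = ?z * w"
        using uw(3,4) by simp
      also have "ev y a * (?z * w) + ?z * (ev y b * u) = ?z * b'"
        by (simp only: b'_def distrib_left mult.left_commute[of "?z"])
      finally have u: "u = ?z * b'" .
      then have "?z * b' \<in> pole_bounded y h"
        using uw(1) spanV by auto
      then have "b' = 0"
        by (rule pole_bounded_multiple_eq_0[OF y int[OF b'B]])
      then show "v = 0"
        using u uw(3) by simp
    next
      fix x assume "x \<in> d1 *t V"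
      then obtain x' where x': "x = d1 * x'" "x' \<in> V" by auto
      have pow: "y ^ i \<in> ?R" for i
        by (rule subring_power[OF R gen_in_adjoin])
      have "y ^ e * d1 * x' \<in> F"
        using x'(2) unfolding V_def
      proof
        assume "x' \<in> Z"
        then show ?thesis
          using q(2) by (simp only: q_eq)
      next
        assume "x' \<in> ?P"
        then have "x' \<in> F"
          using PF span_base by blast
        then show ?thesis
          unfolding d1_def by (intro F_scale subring_mult[OF R pow ev_in_adjoin])
      qed
      then have "y ^ (h * e) * (y ^ e * d1 * x') \<in> F"
        by (rule F_scale[OF pow])
      moreover have "?z ^ e = y ^ (h * e) * y ^ e"
        by (simp only: power_mult[symmetric] power_add[symmetric] mult_Suc add.commute)
      ultimately show "?z ^ e * x \<in> F"
        by (simp only: x'(1) mult.assoc)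
    qed
    also have "\<dots> \<le> ?m * card X"
      by (rule card_power_multiples_le[OF X(1)])
    also have "card (d1 *t V) = card V"
      by (rule card_image) (use \<open>d1 \<noteq> 0\<close> in \<open>auto simp: inj_on_def\<close>)
    finally have "card Z + k * card X \<le> Suc h * card X"
      using V(3) by simp
    moreover have "Suc h * card X = k * card X + card X * s"
      by (simp add: k_def h_def algebra_simps)
    ultimately show ?thesis by simp
  qed
  obtain Z where Z: "finite Z" "Z \<subseteq> B" "\<And>w. w \<in> B \<Longrightarrow> \<exists>t\<in>span Z. w - t \<in> F"
  proof (rule maximal_independent_mod[OF Bsub F, of "card X * s"])
    fix Z assume "finite Z" "Z \<subseteq> B" "independent Z" "\<And>v. v \<in> span Z \<Longrightarrow> v \<in> F \<Longrightarrow> v = 0"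
    then show "card Z \<le> card X * s"
      by (rule bound)
  qed blast
  show thesis
  proof (rule that)
    show "finite (X \<union> Z)" "X \<union> Z \<subseteq> B"
      using X Z by auto
    show "B = rspan ?R (X \<union> Z)"
    proof
      show "rspan ?R (X \<union> Z) \<subseteq> B"
        using X(2) Z(2) by (intro rspan_subset_subring[OF B(1) RB]) auto
      show "B \<subseteq> rspan ?R (X \<union> Z)"
      proof
        fix b assume "b \<in> B"
        then obtain t where t: "t \<in> span Z" "b - t \<in> F"
          using Z(3) by blast
        have sub: "subspace (rspan ?R (X \<union> Z))"
          using emb_in_adjoin by (intro subspace_rspan) blast
        have "t \<in> rspan ?R (X \<union> Z)"
          using span_minimal[OF _ sub, of Z] t(1) rspan_base by blast
        moreover have "F \<subseteq> rspan ?R (X \<union> Z)"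
          unfolding F_def by (rule rspan_trans) (auto intro: rspan_base)
        ultimately have "t + (b - t) \<in> rspan ?R (X \<union> Z)"
          using t(2) by (intro rspan_add) auto
        then show "b \<in> rspan ?R (X \<union> Z)" by simp
      qed
    qed
  qed
qed

section \<open>Finite generation of an arbitrary subalgebra\<close>

text \<open>Given \<open>b\<close> in \<open>B\<close>, pass to \<open>z = b + y ^ N\<close>, so
  that \<open>C z\<close> contains \<open>C y\<close> and \<open>b\<close>. The dimension modulo
  \<open>x\<close> cannot grow and, by minimality, cannot drop. Lifts of a basis generate a finite
  \<open>C y\<close>-module \<open>D\<close> inside \<open>C z\<close>; equal dimensions force
  \<open>D = C z\<close>, so \<open>b\<close> is integral over \<open>C y\<close>.\<close>

lemma subalgebra_fg:
  assumes B: "is_subring B" "K0 \<subseteq> B"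
  shows "\<exists>G. finite G \<and> is_subring hull (K0 \<union> G) = B"
proof (cases "B \<subseteq> K0")
  case True
  then have "B = K0" using B(2) by auto
  then show ?thesis
    using hull_same[of is_subring K0] is_subring_K0 by (intro exI[of _ "{}"]) auto
next
  case False
  then obtain x0 where x0: "x0 \<in> B" "x0 \<notin> K0" by auto
  obtain x where x: "x \<in> adjoin K0 x0" "x \<notin> K0" and gen: "\<And>a. \<exists>k. integral_elem (adjoin K0 x) (x ^ k * a)"
    by (rule generically_integral[OF x0(2)]) blast
  have xB: "x \<in> B"
    using x(1) adjoin_minimal[OF B x0(1)] by auto
  have "x \<noteq> 0"
  proof
    assume "x = 0"
    then have "x = emb 0" by simp
    then show False using x(2) by blast
  qed
  define C where "C y = {b \<in> B. integral_elem (adjoin K0 y) b}" for y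
  have C: "is_subring (C y)" "K0 \<subseteq> C y" "C y \<subseteq> B" for y
  proof -
    note I = is_subring_integral_closure[OF is_subring_adjoin_K0, of y]
    show "is_subring (C y)"
      using subring_1[OF I] subring_diff[OF I] subring_mult[OF I]
        subring_1[OF B(1)] subring_diff[OF B(1)] subring_mult[OF B(1)]
      by (intro is_subringI) (auto simp: C_def)
    show "K0 \<subseteq> C y"
      using B(2) integral_elem_base[OF is_subring_adjoin_K0 emb_in_adjoin] by (auto simp: C_def)
  qed (auto simp: C_def)
  have yC: "y \<in> C y" if "y \<in> B" for y
    using that integral_elem_base[OF is_subring_adjoin_K0 gen_in_adjoin] by (auto simp: C_def)
  have C_sub: "subspace (C y)" for y
    by (rule subspace_if_subring[OF C(1,2)])
  have transc: "y \<notin> K0" if "x \<in> C y" for y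
    using transcendental_if_integral[OF x(2)] that by (simp add: C_def)
  have powers: "\<exists>k. x ^ k * b \<in> C y" if "x \<in> C y" "b \<in> B" for b y
  proof -
    obtain k where "integral_elem (adjoin K0 x) (x ^ k * b)"
      using gen by blast
    then have "integral_elem (adjoin K0 y) (x ^ k * b)"
      using that(1) integral_over_adjoin_trans by (auto simp: C_def)
    then show ?thesis
      using subring_mult[OF B(1) subring_power[OF B(1) xB] that(2)] by (auto simp: C_def)
  qed
  have upow: "\<exists>e. \<forall>b\<in>S. x ^ e * b \<in> C y" if xy: "x \<in> C y" and S: "finite S" "S \<subseteq> B" for S y
    using S
  proof (induction S)
    case (insert b S)
    then obtain e where e: "\<forall>b\<in>S. x ^ e * b \<in> C y" by auto
    obtain k where k: "x ^ k * b \<in> C y"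
      using powers[OF xy] insert.prems by auto
    have xp: "x ^ i \<in> C y" for i
      by (rule subring_power[OF C(1) xy])
    have "x ^ (k + e) * b' \<in> C y" if "b' \<in> insert b S" for b'
    proof (cases "b' = b")
      case True
      then show ?thesis
        using subring_mult[OF C(1) xp[of e] k] by (simp add: power_add ac_simps)
    next
      case False
      then show ?thesis
        using subring_mult[OF C(1) xp[of k]] e that by (simp add: power_add mult.assoc)
    qed
    then show ?case by blast
  qed auto
  define indep_mod where "indep_mod W X \<longleftrightarrow> finite X \<and> X \<subseteq> W \<and> independent X \<and> (\<forall>v\<in>span X. v \<in> x *t W \<longrightarrow> v = 0)" for W X
  \<comment> \<open>This bounds the dimension of \<open>W / x W\<close> by \<open>n\<close>.\<close>
  define bounded where "bounded W n \<longleftrightarrow> (\<forall>X. indep_mod W X \<longrightarrow> card X \<le> n)" for W n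
  have max_indep: "\<exists>T. indep_mod W T \<and> card T \<le> n \<and> (\<forall>w\<in>W. \<exists>t\<in>span T. w - t \<in> x *t W)"
    if W: "subspace W" and bd: "bounded W n" for W n
  proof -
    obtain T where T: "finite T" "T \<subseteq> W" "independent T" "\<And>v. v \<in> span T \<Longrightarrow> v \<in> x *t W \<Longrightarrow> v = 0"
      "card T \<le> n" "\<And>w. w \<in> W \<Longrightarrow> \<exists>t\<in>span T. w - t \<in> x *t W"
    proof (rule maximal_independent_mod[OF W subspace_times[OF W], of x n])
      fix X assume "finite X" "X \<subseteq> W" "independent X" "\<And>v. v \<in> span X \<Longrightarrow> v \<in> x *t W \<Longrightarrow> v = 0"
      then have "indep_mod W X"
        unfolding indep_mod_def by (intro conjI ballI impI)
      then show "card X \<le> n"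
        using bd by (simp add: bounded_def)
    next
      fix X assume "finite X" "X \<subseteq> W" "independent X" "\<And>v. v \<in> span X \<Longrightarrow> v \<in> x *t W \<Longrightarrow> v = 0"
        "card X \<le> n" "\<And>w. w \<in> W \<Longrightarrow> \<exists>t\<in>span X. w - t \<in> x *t W"
      then show thesis
        by (rule that)
    qed
    have "indep_mod W T"
      unfolding indep_mod_def by (intro conjI ballI impI T(1-4))
    then show ?thesis
      using T(5,6) by (intro exI[of _ T] conjI ballI)
  qed
  \<comment> \<open>Krull-Akizuki for \<open>C y\<close> inside \<open>W\<close>: the required shift
    exists because one power of \<open>x\<close> carries a given finite subset of \<open>B\<close>
    into \<open>C y\<close>.\<close>
  have transfer: "bounded W n"
    if y: "x \<in> C y" and bd: "bounded (C y) n" and W: "subspace W" "C y \<subseteq> W" "W \<subseteq> B" "x *t W \<subseteq> W" for y n W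
  proof -
    obtain T where T: "indep_mod (C y) T" "card T \<le> n" "\<forall>w\<in>C y. \<exists>t\<in>span T. w - t \<in> x *t C y"
      using max_indep[OF C_sub bd] by blast
    have "card X \<le> n" if X: "indep_mod W X" for X
    proof -
      have "finite X" "X \<subseteq> B"
        using X W(3) by (auto simp: indep_mod_def)
      from upow[OF y this] obtain e where e: "\<forall>b\<in>X. x ^ e * b \<in> C y" ..
      have "card X \<le> card T"
      proof (rule card_independent_mod_times_le[OF C_sub W(2) _ W(1,4) \<open>x \<noteq> 0\<close>])
        show "x *t C y \<subseteq> C y"
          using subring_mult[OF C(1) y] by auto
        show "\<exists>t\<in>span T. \<exists>u'\<in>C y. u = t + x * u'" if "u \<in> C y" for u
        proof -
          from bspec[OF T(3) that] obtain t where t: "t \<in> span T" "u - t \<in> x *t C y" ..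
          from t(2) obtain u' where "u - t = x * u'" "u' \<in> C y" ..
          with t(1) show ?thesis
            by (intro bexI[of _ t] bexI[of _ u']) (simp_all add: algebra_simps)
        qed
      qed (use X T e in \<open>auto simp: indep_mod_def\<close>)
      then show ?thesis
        using T(2) by simp
    qed
    then show ?thesis
      by (simp add: bounded_def)
  qed
  have finite_C: "\<exists>G. finite G \<and> G \<subseteq> C y \<and> C y = rspan (adjoin K0 y) G" if yB: "y \<in> B" and xy: "x \<in> C y" for y
  proof -
    have "integral_elem (adjoin K0 y) b" if "b \<in> C y" for b
      using that by (simp add: C_def)
    then obtain G where "finite G" "G \<subseteq> C y" "C y = rspan (adjoin K0 y) G"
      by (rule finite_over_adjoin_if_integral[OF C(1,2) yC[OF yB] transc[OF xy]])
    then show ?thesis by blast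
  qed
  \<comment> \<open>The minimization needs one finite value to start from; finiteness of
    \<open>C x\<close> over \<open>K[x]\<close> supplies it.\<close>
  have "\<exists>n. bounded (C x) n"
  proof -
    obtain G where G: "finite G" "C x = rspan (adjoin K0 x) G"
      using finite_C[OF xB yC[OF xB]] by blast
    have "card X \<le> card (power_multiples x 1 G)" if X: "indep_mod (C x) X" for X
    proof (rule card_independent_mod_times_le[OF C_sub[of x] subset_refl _ C_sub[of x] _ \<open>x \<noteq> 0\<close>])
      show "x *t C x \<subseteq> C x" "x *t C x \<subseteq> C x"
        using subring_mult[OF C(1) yC[OF xB]] by auto
      show "finite (power_multiples x 1 G)"
        by (rule finite_power_multiples[OF G(1)])
      show "\<exists>t\<in>span (power_multiples x 1 G). \<exists>u'\<in>C x. u = t + x * u'" if "u \<in> C x" for u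
        using rspan_adjoin_decomposition[OF G(1), of u x 1] that unfolding G(2) by simp
      show "x ^ 0 * b \<in> C x" if "b \<in> X" for b
        using X that by (auto simp: indep_mod_def)
    qed (use X in \<open>auto simp: indep_mod_def\<close>)
    then show ?thesis
      by (auto simp: bounded_def)
  qed
  then have ex: "\<exists>n y. y \<in> B \<and> x \<in> C y \<and> bounded (C y) n"
    using xB yC[OF xB] by blast
  define n where "n = (LEAST n. \<exists>y. y \<in> B \<and> x \<in> C y \<and> bounded (C y) n)"
  obtain y where y: "y \<in> B" "x \<in> C y" "bounded (C y) n"
    using LeastI_ex[OF ex] unfolding n_def by blast
  have n_min: "n \<le> m" if "z \<in> B" "x \<in> C z" "bounded (C z) m" for m z
    unfolding n_def using that by (intro Least_le) blast
  have "B \<subseteq> C y"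
  proof
    fix b assume b: "b \<in> B"
    obtain N where N: "integral_elem (adjoin K0 (b + y ^ N)) y" "integral_elem (adjoin K0 (b + y ^ N)) b"
      by (rule common_integral_base[OF transc[OF y(2)], of b])
    define z where "z = b + y ^ N"
    have zB: "z \<in> B"
      unfolding z_def by (intro subring_add[OF B(1)] subring_power[OF B(1)] b y(1))
    have CC: "C y \<subseteq> C z"
      using integral_over_adjoin_trans[OF N(1)] by (auto simp: C_def z_def)
    then have xz: "x \<in> C z"
      using y(2) by blast
    have bz: "b \<in> C z"
      using N(2) b by (simp add: C_def z_def)
    have xC: "x *t C z \<subseteq> C z"
      using subring_mult[OF C(1) xz] by auto
    have bdz: "bounded (C z) n"
      by (rule transfer[OF y(2,3) C_sub CC C(3) xC])
    obtain X where X: "indep_mod (C z) X" "card X \<le> n" and Xspan: "\<forall>w\<in>C z. \<exists>t\<in>span X. w - t \<in> x *t C z"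
      using max_indep[OF C_sub bdz] by blast
    have "bounded (C z) (card X)"
      unfolding bounded_def
    proof (intro allI impI)
      fix X' assume "indep_mod (C z) X'"
      then show "card X' \<le> card X"
        using X(1) Xspan by (intro card_independent_mod_le[OF _ _ _ subspace_times[OF C_sub[of z], of x]])
          (auto simp: indep_mod_def)
    qed
    then have "n \<le> card X"
      by (rule n_min[OF zB xz])
    then have cardX: "card X = n"
      using X(2) by simp
    \<comment> \<open>As \<open>X\<close> spans \<open>C z\<close> modulo \<open>x C z\<close>, so
      does \<open>D\<close>; the generator 1 puts \<open>C y\<close> inside
      \<open>D\<close>.\<close>
    define D where "D = rspan (C y) (insert 1 X)"
    have finX: "finite X" and XC: "X \<subseteq> C z"
      using X(1) by (auto simp: indep_mod_def)
    have 1: "1 \<in> D" and XD: "X \<subseteq> D"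
      unfolding D_def by (auto intro: rspan_base)
    have DC: "D \<subseteq> C z"
      unfolding D_def using XC subring_1[OF C(1)] by (intro rspan_subset_subring[OF C(1) CC]) auto
    have CD: "C y \<subseteq> D"
    proof
      fix c assume "c \<in> C y"
      then show "c \<in> D"
        using rspan_scale[of c "C y" 1 "insert 1 X"] 1 by (simp add: D_def)
    qed
    have D_sub: "subspace D"
      unfolding D_def by (rule subspace_rspan[OF C(2)])
    have xD: "x *t D \<subseteq> D"
      unfolding D_def using y(2) by (auto intro: rspan_scale)
    have "bounded D n"
      by (rule transfer[OF y(2,3) D_sub CD _ xD]) (use DC C(3) in blast)
    then obtain T where T: "indep_mod D T" "card T \<le> n" and Tspan: "\<forall>w\<in>D. \<exists>t\<in>span T. w - t \<in> x *t D"
      using max_indep[OF D_sub] by blast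
    \<comment> \<open>\<open>T\<close> represents a basis of \<open>D / x D\<close>. It also spans
      \<open>X\<close> modulo \<open>x C z\<close> and has at most \<open>card X\<close> elements,
      so it stays independent modulo \<open>x C z\<close>: the map from \<open>D / x D\<close> to
      \<open>C z / x C z\<close> is injective.\<close>
    have Tindep: "v = 0" if "v \<in> span T" "v \<in> x *t C z" for v
    proof (rule spanning_independent_mod[OF _ _ subspace_times[OF C_sub[of z], of x]])
      show "finite T" "independent T" "finite X" "independent X"
        using T(1) X(1) by (auto simp: indep_mod_def)
      show "v = 0" if "v \<in> span X" "v \<in> x *t C z" for v
        using X(1) that by (auto simp: indep_mod_def)
      show "card T \<le> card X"
        using T(2) cardX by simp
      show "\<exists>t\<in>span T. w - t \<in> x *t C z" if "w \<in> X \<union> T" for w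
      proof -
        have "w \<in> D"
          using that XD T(1) by (auto simp: indep_mod_def)
        from bspec[OF Tspan this] obtain t where t: "t \<in> span T" "w - t \<in> x *t D" ..
        with DC show ?thesis
          by (intro bexI[of _ t]) auto
      qed
    qed (use that in auto)
    \<comment> \<open>The representative \<open>t\<close> of \<open>x * d'\<close> modulo
      \<open>x D\<close> lies in \<open>x C z\<close>, so it is zero, and \<open>x\<close> can be
      cancelled.\<close>
    have descend: "d' \<in> D" if d': "d' \<in> C z" "x * d' \<in> D" for d'
    proof -
      from bspec[OF Tspan d'(2)] obtain t where t1: "t \<in> span T" "x * d' - t \<in> x *t D" ..
      from t1(2) obtain d where "x * d' - t = x * d" "d \<in> D" ..
      note t = t1(1) this(2,1)
      have "t = x * (d' - d)"
        using t(3) by (simp add: algebra_simps)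
      moreover have "d' - d \<in> C z"
        using d'(1) t(2) DC by (intro subring_diff[OF C(1)]) auto
      ultimately have "t = 0"
        using Tindep[OF t(1)] by blast
      then have "d' = d"
        using t(3) \<open>x \<noteq> 0\<close> by simp
      then show ?thesis
        using t(2) by simp
    qed
    \<comment> \<open>Some power of \<open>x\<close> moves \<open>c\<close> into \<open>C y\<close>,
      hence into \<open>D\<close>; \<open>descend\<close> then removes the factors one at a
      time.\<close>
    have CzD: "C z \<subseteq> D"
    proof
      fix c assume c: "c \<in> C z"
      obtain k where "x ^ k * c \<in> C y"
        using powers[OF y(2)] c C(3) by blast
      then have "x ^ k * c \<in> D"
        using CD by blast
      then show "c \<in> D"
      proof (induction k)
        case (Suc k)
        have "x ^ k * c \<in> C z"
          using subring_mult[OF C(1) subring_power[OF C(1) xz] c] .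
        then show ?case
          using Suc descend[of "x ^ k * c"] by (simp add: mult.assoc)
      qed simp
    qed
    have "b \<in> stab D"
      unfolding stab_def using subring_mult[OF C(1) bz] DC CzD by blast
    then have "integral_elem (C y) b"
      using integral_if_stab_1[OF C(1), of "insert 1 X" y b] finX 1 by (simp add: D_def)
    then have "integral_elem (adjoin K0 y) b"
      by (rule integral_closure_trans[OF is_subring_adjoin_K0, rotated]) (simp add: C_def)
    then show "b \<in> C y"
      using b by (simp add: C_def)
  qed
  then have BC: "B = C y"
    using C(3) by blast
  obtain G where G: "finite G" "G \<subseteq> C y" "C y = rspan (adjoin K0 y) G"
    using finite_C[OF y(1,2)] by blast
  let ?H = "is_subring hull (K0 \<union> insert y G)"
  have H: "is_subring ?H"
    by (rule is_subring_hull)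
  have sub: "K0 \<subseteq> ?H" "y \<in> ?H" "G \<subseteq> ?H"
    by (auto intro: hull_inc)
  have "rspan (adjoin K0 y) G \<subseteq> ?H"
    by (rule rspan_subset_subring[OF H adjoin_minimal[OF H sub(1,2)] sub(3)])
  moreover have "?H \<subseteq> B"
    using B y(1) G(2) BC by (intro hull_minimal) auto
  ultimately have "?H = B"
    using BC G(3) by auto
  then show ?thesis
    using G(1) by blast
qed

end

theorem proposition13:
  fixes scale :: "'k::{alg_closed_field, field_char_0} \<Rightarrow> 'a::idom \<Rightarrow> 'a"
  assumes "comm_algebra scale"
    and "comm_algebra.finitely_generated scale UNIV"
  shows "(\<forall>B. comm_algebra.is_subalgebra scale B \<longrightarrow> comm_algebra.finitely_generated scale B)
    \<longleftrightarrow> krull_dim TYPE('a) \<le> 1"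
proof -
  interpret acf_algebra scale
    using assms(1) by (rule acf_algebra.intro)
  show ?thesis
  proof
    assume "\<forall>B. is_subalgebra B \<longrightarrow> finitely_generated B"
    then show "krull_dim TYPE('a) \<le> 1"
      by (intro krull_dim_le_1_if_subalgebras_fg) blast
  next
    assume dim: "krull_dim TYPE('a) \<le> 1"
    \<comment> \<open>The dimension bound enters through the assumption on algebraic
      elements.\<close>
    interpret curve_algebra scale
      by unfold_locales (use assms(2) dim algebraic_if_krull_dim_le_1 in auto)
    show "\<forall>B. is_subalgebra B \<longrightarrow> finitely_generated B"
      unfolding finitely_generated_def is_subalgebra_hull_eq
      using subalgebra_fg by (simp add: is_subalgebra_iff)
  qed
qed

end
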